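(* Let $\mathbf{MS}$, $\mathbf{SNE}$ and $\mathbf H$ be the sets of equivalence classes (defined in the context) of, respectively, maximal space-like surfaces of general type in $\mathbb R^4_2$ parametrized by canonical coordinates near $0$, solutions of the system of natural equations near $0$, and pairs of holomorphic functions near $0$. Consider the following correspondences: (i) $\mathbf{MS}\to\mathbf{SNE}$, sending a surface to the pair $(K,\varkappa)$ of its Gauss curvature and its curvature of the normal connection, as functions of the canonical coordinates; (ii) $\mathbf H\to\mathbf{MS}$, sending $(g_1,g_2)$ to the surface $x$ (defined in a neighborhood of $0$) with $$x_u-\mathrm i x_v=\left(\frac12\frac{g_1g_2+1}{\sqrt{g_1'g_2'}},\ \frac{\mathrm i}{2}\frac{g_1g_2-1}{\sqrt{g_1'g_2'}},\ \frac12\frac{g_1+g_2}{\sqrt{g_1'g_2'}},\ \frac{\mathrm i}{2}\frac{g_1-g_2}{\sqrt{g_1'g_2'}}\right);$$ (iii) $\mathbf H\to\mathbf{SNE}$, sending $(g_1,g_2)$ to $$K=\frac{8|g_1'g_2'|}{(|g_1|^2-1)(|g_2|^2-1)}\left(\frac{|g_1'|^2}{(|g_1|^2-1)^2}+\frac{|g_2'|^2}{(|g_2|^2-1)^2}\right),\quad \varkappa=\frac{-8|g_1'g_2'|}{(|g_1|^2-1)(|g_2|^2-1)}\left(\frac{|g_1'|^2}{(|g_1|^2-1)^2}-\frac{|g_2'|^2}{(|g_2|^2-1)^2}\right).$$ These induce well-defined maps between the sets of equivalence classes, the resulting triangular diagram commutes (the map (iii) is the composition of (ii) followed by (i)), and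 all three maps are bijections.
   Context: $\mathbb R^4_2$ is $\mathbb R^4$ with the scalar product $a\cdot b=a_1b_1+a_2b_2-a_3b_3-a_4b_4$, extended complex-bilinearly to $\mathbb C^4$; $a^2=a\cdot a$. A surface $(\mathcal D,x)$ ($x:\mathcal D\to\mathbb R^4_2$ an immersion, $\mathcal D\subset\mathbb R^2\equiv\mathbb C$) is space-like if the induced metric is positive definite and maximal if its mean curvature vector vanishes. Coordinates $t=u+\mathrm i v$ are isothermal if $x_u^2=x_v^2$, $x_u\cdot x_v=0$. Put $\Phi=x_u-\mathrm i x_v$ (holomorphic on a maximal space-like surface) and let $\Phi'^{\bot}$ be the component of $\Phi'$ in the complexified normal space. Isothermal coordinates are canonical if $(\Phi'^{\bot})^2=-1$; the surface is of general type if $(\Phi'^{\bot})^2\neq0$ at every point. $K$ is the Gauss curvature of the induced metric. The curvature of the normal connection is $\varkappa=R^N(X_1,X_2)n_2\cdot n_1$, where $R^N(X,Y)n=\nabla^N_X\nabla^N_Yn-\nabla^N_Y\nabla^N_Xn-\nabla^N_{[X,Y]}n$ is the curvature of the normal connection, $X_1,X_2$ are orthonormal tangent fields, $n_1,n_2$ are normal fields with $n_1^2=n_2^2=-1$, $n_1\cdot n_2=0$, and $(X_1,X_2,n_1,n_2)$ is positively oriented in $\mathbb R^4$. $\mathbf{MS}$: consider maximal space-like surfaces of general type $(\mathcal D,x)$ in $\mathbb R^4_2$, where $\mathcal D$ is a neighborhood of $0$ in $\mathbb C$ and the coordinates in $\mathcal D$ are canonical. $(\mathcal D,x)$ and $(\hat{\mathcal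 D},\hat x)$ are equivalent if there is a neighborhood of zero $\mathcal D_0\subset\mathcal D\cap\hat{\mathcal D}$ on which $\hat x=Ax+b$ with $A\in\mathbf{SO}(2,2,\mathbb R)$ (linear isometries of $\mathbb R^4_2$ with determinant $1$) and $b\in\mathbb R^4_2$. $\mathbf{SNE}$: consider triples $(\mathcal D,K,\varkappa)$, $\mathcal D$ a neighborhood of $0$, with $K,\varkappa$ real functions on $\mathcal D$ solving the system of natural equations $$\sqrt[4]{K^2-\varkappa^2}\,\Delta\ln\sqrt[4]{K^2-\varkappa^2}=2K,\quad \sqrt[4]{K^2-\varkappa^2}\,\Delta\ln\sqrt{\tfrac{K+\varkappa}{K-\varkappa}}=2\varkappa,\quad K^2-\varkappa^2>0,\ K>0,$$ with $\Delta$ the Laplacian in $(u,v)$. Two solutions are equivalent if they coincide on some neighborhood of zero contained in both domains. $\mathbf H$: consider triples $(\mathcal D,g_1,g_2)$, $\mathcal D$ a neighborhood of $0$, $g_1,g_2$ holomorphic in $\mathcal D$ with $g_1'g_2'\neq0$ and $(|g_1|^2-1)(|g_2|^2-1)>0$. $(\mathcal D,g_1,g_2)$ and $(\hat{\mathcal D},\hat g_1,\hat g_2)$ are equivalent if on some neighborhood of zero contained in both domains $\hat g_j=\frac{a_jg_j+\bar b_j}{b_jg_j+\bar a_j}$, $j=1,2$, with constants $a_j,b_j\in\mathbb C$ satisfying either $|a_j|^2-|b_j|^2=1$ for both $j$ or $|a_j|^2-|b_j|^2=-1$ for both $j$. The surface in (ii) is determined up to translation and up to the choice of the branch of the square root.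 *)

theory Defs
  imports "HOL-Analysis.Analysis"
begin

section \<open>Partial derivatives and smoothness in the parameter plane\<close>

text \<open>The parameter plane is the type \<^typ>\<open>complex\<close>, with \<open>t = u + \<i> v\<close>. Index \<open>1 :: 2\<close> stands for \<open>u\<close>
  and \<open>2 :: 2\<close> for \<open>v\<close>. All domains are open sets; functions are total, but only their values on
  the domain matter.\<close>

definition coord_dir :: "2 \<Rightarrow> complex" where
  "coord_dir i = (if i = 1 then 1 else \<i>)"

definition pd :: "2 \<Rightarrow> (complex \<Rightarrow> 'a::real_normed_vector) \<Rightarrow> complex \<Rightarrow> 'a" where
  "pd i f z = frechet_derivative f (at z) (coord_dir i)"

primrec Ck_on :: "nat \<Rightarrow> (complex \<Rightarrow> 'a::real_normed_vector) \<Rightarrow> complex set \<Rightarrow> bool" where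
  "Ck_on 0 f D \<longleftrightarrow> continuous_on D f"
| "Ck_on (Suc k) f D \<longleftrightarrow> (\<forall>z\<in>D. f differentiable (at z)) \<and> (\<forall>i. Ck_on k (pd i f) D)"

definition smooth_on :: "(complex \<Rightarrow> 'a::real_normed_vector) \<Rightarrow> complex set \<Rightarrow> bool" where
  "smooth_on f D \<longleftrightarrow> (\<forall>k. Ck_on k f D)"

definition laplacian :: "(complex \<Rightarrow> real) \<Rightarrow> complex \<Rightarrow> real" where
  "laplacian f z = pd 1 (pd 1 f) z + pd 2 (pd 2 f) z"


section \<open>The space \<open>\<real>\<^sup>4\<^sub>2\<close> and its complexification\<close>

text \<open>One polymorphic form serves both as the scalar product of \<^typ>\<open>real^4\<close> and as its
  complex-bilinear (not Hermitian) extension to \<^typ>\<open>complex^4\<close>.\<close>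

definition sp :: "'a::comm_ring_1^4 \<Rightarrow> 'a^4 \<Rightarrow> 'a" where
  "sp a b = a$1 * b$1 + a$2 * b$2 - a$3 * b$3 - a$4 * b$4"

definition cvec :: "real^4 \<Rightarrow> complex^4" where
  "cvec a = (\<chi> k. complex_of_real (a$k))"

definition SO22 :: "(real^4^4) set" where
  "SO22 = {A. (\<forall>a b. sp (A *v a) (A *v b) = sp a b) \<and> det A = 1}"

text \<open>Component of \<open>w\<close> orthogonal to the plane spanned by \<open>p\<close> and \<open>q\<close>. It exists and is unique
  when the Gram matrix of \<open>p, q\<close> is invertible.\<close>

definition normal_part :: "'a::field^4 \<Rightarrow> 'a^4 \<Rightarrow> 'a^4 \<Rightarrow> 'a^4" where
  "normal_part p q w =
     (THE n. sp n p = 0 \<and> sp n q = 0 \<and> (\<exists>\<alpha> \<beta>. w = \<alpha> *s p + \<beta> *s q + n))"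


lemma vector_4 [simp]:
  fixes a b c d :: "'a::zero"
  shows "(vector [a, b, c, d] :: 'a^4) $ 1 = a" "(vector [a, b, c, d] :: 'a^4) $ 2 = b"
    "(vector [a, b, c, d] :: 'a^4) $ 3 = c" "(vector [a, b, c, d] :: 'a^4) $ 4 = d"
  by (simp_all add: vector_def)


section \<open>Surfaces\<close>

definition surface :: "complex set \<Rightarrow> (complex \<Rightarrow> real^4) \<Rightarrow> bool" where
  "surface D x \<longleftrightarrow> smooth_on x D \<and> (\<forall>z\<in>D. inj (frechet_derivative x (at z)))"

definition induced_metric :: "(complex \<Rightarrow> real^4) \<Rightarrow> complex \<Rightarrow> real^2^2" where
  "induced_metric x z = (\<chi> i j. sp (pd i x z) (pd j x z))"

definition space_like :: "complex set \<Rightarrow> (complex \<Rightarrow> real^4) \<Rightarrow> bool" where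
  "space_like D x \<longleftrightarrow>
     (\<forall>z\<in>D. \<forall>h. h \<noteq> 0 \<longrightarrow> sp (frechet_derivative x (at z) h) (frechet_derivative x (at z) h) > 0)"

definition second_fundamental_form ::
  "(complex \<Rightarrow> real^4) \<Rightarrow> complex \<Rightarrow> 2 \<Rightarrow> 2 \<Rightarrow> real^4" where
  "second_fundamental_form x z i j = normal_part (pd 1 x z) (pd 2 x z) (pd i (pd j x) z)"

definition mean_curvature_vector :: "(complex \<Rightarrow> real^4) \<Rightarrow> complex \<Rightarrow> real^4" where
  "mean_curvature_vector x z =
     (1/2) *\<^sub>R (\<Sum>i\<in>UNIV. \<Sum>j\<in>UNIV.
        (matrix_inv (induced_metric x z) $ i $ j) *\<^sub>R second_fundamental_form x z i j)"

definition maximal :: "complex set \<Rightarrow> (complex \<Rightarrow> real^4) \<Rightarrow> bool" where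
  "maximal D x \<longleftrightarrow> (\<forall>z\<in>D. mean_curvature_vector x z = 0)"

definition isothermal :: "complex set \<Rightarrow> (complex \<Rightarrow> real^4) \<Rightarrow> bool" where
  "isothermal D x \<longleftrightarrow>
     (\<forall>z\<in>D. sp (pd 1 x z) (pd 1 x z) = sp (pd 2 x z) (pd 2 x z) \<and> sp (pd 1 x z) (pd 2 x z) = 0)"

definition Phi :: "(complex \<Rightarrow> real^4) \<Rightarrow> complex \<Rightarrow> complex^4" where
  "Phi x z = cvec (pd 1 x z) - \<i> *s cvec (pd 2 x z)"

definition Phi' :: "(complex \<Rightarrow> real^4) \<Rightarrow> complex \<Rightarrow> complex^4" where
  "Phi' x z = (\<chi> k. deriv (\<lambda>w. Phi x w $ k) z)"

definition Phi'_normal :: "(complex \<Rightarrow> real^4) \<Rightarrow> complex \<Rightarrow> complex^4" where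
  "Phi'_normal x z = normal_part (cvec (pd 1 x z)) (cvec (pd 2 x z)) (Phi' x z)"

definition general_type :: "complex set \<Rightarrow> (complex \<Rightarrow> real^4) \<Rightarrow> bool" where
  "general_type D x \<longleftrightarrow> (\<forall>z\<in>D. sp (Phi'_normal x z) (Phi'_normal x z) \<noteq> 0)"

definition canonical :: "complex set \<Rightarrow> (complex \<Rightarrow> real^4) \<Rightarrow> bool" where
  "canonical D x \<longleftrightarrow> isothermal D x \<and> (\<forall>z\<in>D. sp (Phi'_normal x z) (Phi'_normal x z) = -1)"


section \<open>Gauss curvature and curvature of the normal connection\<close>

definition christoffel :: "(complex \<Rightarrow> real^2^2) \<Rightarrow> 2 \<Rightarrow> 2 \<Rightarrow> 2 \<Rightarrow> complex \<Rightarrow> real" where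
  "christoffel g k i j z = (1/2) * (\<Sum>l\<in>UNIV. matrix_inv (g z) $ k $ l *
     (pd i (\<lambda>w. g w $ j $ l) z + pd j (\<lambda>w. g w $ i $ l) z - pd l (\<lambda>w. g w $ i $ j) z))"

text \<open>\<open>riemann g m i j k\<close> is the \<open>m\<close>-th coefficient of \<open>R(\<partial>\<^sub>i, \<partial>\<^sub>j)\<partial>\<^sub>k\<close>, where
  \<open>R(X, Y) = \<nabla>\<^sub>X\<nabla>\<^sub>Y - \<nabla>\<^sub>Y\<nabla>\<^sub>X - \<nabla>\<^bsub>[X, Y]\<^esub>\<close>. With this sign
  \<open>K = g(R(\<partial>\<^sub>u, \<partial>\<^sub>v)\<partial>\<^sub>v, \<partial>\<^sub>u) / det g\<close> is positive for the round sphere.\<close>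

definition riemann :: "(complex \<Rightarrow> real^2^2) \<Rightarrow> 2 \<Rightarrow> 2 \<Rightarrow> 2 \<Rightarrow> 2 \<Rightarrow> complex \<Rightarrow> real" where
  "riemann g m i j k z =
     pd i (christoffel g m j k) z - pd j (christoffel g m i k) z
     + (\<Sum>p\<in>UNIV. christoffel g m i p z * christoffel g p j k z
                 - christoffel g m j p z * christoffel g p i k z)"

definition gauss_curvature :: "(complex \<Rightarrow> real^2^2) \<Rightarrow> complex \<Rightarrow> real" where
  "gauss_curvature g z = (\<Sum>m\<in>UNIV. g z $ 1 $ m * riemann g m 1 2 2 z) / det (g z)"

text \<open>A tangent field is given by its coordinate expression \<open>X :: complex \<Rightarrow> complex\<close>; the
  corresponding field along the surface is \<open>dir_deriv X x\<close>.\<close>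

definition dir_deriv ::
  "(complex \<Rightarrow> complex) \<Rightarrow> (complex \<Rightarrow> 'a::real_normed_vector) \<Rightarrow> complex \<Rightarrow> 'a" where
  "dir_deriv X f z = frechet_derivative f (at z) (X z)"

definition lie_bracket ::
  "(complex \<Rightarrow> complex) \<Rightarrow> (complex \<Rightarrow> complex) \<Rightarrow> complex \<Rightarrow> complex" where
  "lie_bracket X Y z = dir_deriv X Y z - dir_deriv Y X z"

definition normal_connection ::
  "(complex \<Rightarrow> real^4) \<Rightarrow> (complex \<Rightarrow> complex) \<Rightarrow> (complex \<Rightarrow> real^4) \<Rightarrow> complex \<Rightarrow> real^4" where
  "normal_connection x X n z = normal_part (pd 1 x z) (pd 2 x z) (dir_deriv X n z)"

definition normal_riemann ::
  "(complex \<Rightarrow> real^4) \<Rightarrow> (complex \<Rightarrow> complex) \<Rightarrow> (complex \<Rightarrow> complex) \<Rightarrow> (complex \<Rightarrow> real^4)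
     \<Rightarrow> complex \<Rightarrow> real^4" where
  "normal_riemann x X Y n z =
     normal_connection x X (normal_connection x Y n) z
     - normal_connection x Y (normal_connection x X n) z
     - normal_connection x (lie_bracket X Y) n z"

definition adapted_frame ::
  "(complex \<Rightarrow> real^4) \<Rightarrow> complex set \<Rightarrow> (complex \<Rightarrow> complex) \<Rightarrow> (complex \<Rightarrow> complex)
     \<Rightarrow> (complex \<Rightarrow> real^4) \<Rightarrow> (complex \<Rightarrow> real^4) \<Rightarrow> bool" where
  "adapted_frame x U X\<^sub>1 X\<^sub>2 n\<^sub>1 n\<^sub>2 \<longleftrightarrow>
     smooth_on X\<^sub>1 U \<and> smooth_on X\<^sub>2 U \<and> smooth_on n\<^sub>1 U \<and> smooth_on n\<^sub>2 U \<and>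
     (\<forall>z\<in>U. let T\<^sub>1 = dir_deriv X\<^sub>1 x z; T\<^sub>2 = dir_deriv X\<^sub>2 x z in
        sp T\<^sub>1 T\<^sub>1 = 1 \<and> sp T\<^sub>2 T\<^sub>2 = 1 \<and> sp T\<^sub>1 T\<^sub>2 = 0 \<and>
        (\<forall>i. sp (n\<^sub>1 z) (pd i x z) = 0 \<and> sp (n\<^sub>2 z) (pd i x z) = 0) \<and>
        sp (n\<^sub>1 z) (n\<^sub>1 z) = -1 \<and> sp (n\<^sub>2 z) (n\<^sub>2 z) = -1 \<and> sp (n\<^sub>1 z) (n\<^sub>2 z) = 0 \<and>
        det (vector [T\<^sub>1, T\<^sub>2, n\<^sub>1 z, n\<^sub>2 z] :: real^4^4) > 0)"

text \<open>The value does not depend on the choice of the local frame: reversing the orientation of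
  \<open>(X\<^sub>1, X\<^sub>2)\<close> forces reversing that of \<open>(n\<^sub>1, n\<^sub>2)\<close>.\<close>

definition normal_curvature :: "(complex \<Rightarrow> real^4) \<Rightarrow> complex \<Rightarrow> real" where
  "normal_curvature x z =
     (THE \<kappa>. \<exists>U X\<^sub>1 X\<^sub>2 n\<^sub>1 n\<^sub>2. open U \<and> z \<in> U \<and> adapted_frame x U X\<^sub>1 X\<^sub>2 n\<^sub>1 n\<^sub>2 \<and>
        \<kappa> = sp (normal_riemann x X\<^sub>1 X\<^sub>2 n\<^sub>2 z) (n\<^sub>1 z))"


section \<open>The three sets of representatives and their equivalences\<close>

text \<open>The sets of equivalence classes are the quotients \<open>MSurf // MSurf_equiv\<close>, \<open>SNE // SNE_equiv\<close>
  and \<open>HH // HH_equiv\<close>.\<close>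

definition nbhd0 :: "complex set \<Rightarrow> bool" where
  "nbhd0 D \<longleftrightarrow> open D \<and> 0 \<in> D"

type_synonym surf = "complex set \<times> (complex \<Rightarrow> real^4)"
type_synonym natsol = "complex set \<times> (complex \<Rightarrow> real) \<times> (complex \<Rightarrow> real)"
type_synonym holpair = "complex set \<times> (complex \<Rightarrow> complex) \<times> (complex \<Rightarrow> complex)"

definition MSurf :: "surf set" where
  "MSurf = {(D, x). nbhd0 D \<and> surface D x \<and> space_like D x \<and> maximal D x \<and>
                 general_type D x \<and> canonical D x}"

definition MSurf_equiv :: "(surf \<times> surf) set" where
  "MSurf_equiv = {((D, x), (D', x')). (D, x) \<in> MSurf \<and> (D', x') \<in> MSurf \<and>
     (\<exists>D\<^sub>0 A b. nbhd0 D\<^sub>0 \<and> D\<^sub>0 \<subseteq> D \<inter> D' \<and> A \<in> SO22 \<and> (\<forall>z\<in>D\<^sub>0. x' z = A *v x z + b))}"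

definition natural_equations ::
  "(complex \<Rightarrow> real) \<Rightarrow> (complex \<Rightarrow> real) \<Rightarrow> complex \<Rightarrow> bool" where
  "natural_equations K \<kappa> z \<longleftrightarrow>
     root 4 ((K z)\<^sup>2 - (\<kappa> z)\<^sup>2) * laplacian (\<lambda>w. ln (root 4 ((K w)\<^sup>2 - (\<kappa> w)\<^sup>2))) z = 2 * K z \<and>
     root 4 ((K z)\<^sup>2 - (\<kappa> z)\<^sup>2) * laplacian (\<lambda>w. ln (sqrt ((K w + \<kappa> w) / (K w - \<kappa> w)))) z
       = 2 * \<kappa> z \<and>
     (K z)\<^sup>2 - (\<kappa> z)\<^sup>2 > 0 \<and> K z > 0"

text \<open>Solutions are classical, that is of class \<open>C\<^sup>2\<close>.\<close>

definition SNE :: "natsol set" where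
  "SNE = {(D, K, \<kappa>). nbhd0 D \<and> Ck_on 2 K D \<and> Ck_on 2 \<kappa> D \<and> (\<forall>z\<in>D. natural_equations K \<kappa> z)}"

definition SNE_equiv :: "(natsol \<times> natsol) set" where
  "SNE_equiv = {((D, K, \<kappa>), (D', K', \<kappa>')). (D, K, \<kappa>) \<in> SNE \<and> (D', K', \<kappa>') \<in> SNE \<and>
     (\<exists>D\<^sub>0. nbhd0 D\<^sub>0 \<and> D\<^sub>0 \<subseteq> D \<inter> D' \<and> (\<forall>z\<in>D\<^sub>0. K' z = K z \<and> \<kappa>' z = \<kappa> z))}"

definition HH :: "holpair set" where
  "HH = {(D, g\<^sub>1, g\<^sub>2). nbhd0 D \<and> g\<^sub>1 holomorphic_on D \<and> g\<^sub>2 holomorphic_on D \<and>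
     (\<forall>z\<in>D. deriv g\<^sub>1 z * deriv g\<^sub>2 z \<noteq> 0 \<and>
            ((cmod (g\<^sub>1 z))\<^sup>2 - 1) * ((cmod (g\<^sub>2 z))\<^sup>2 - 1) > 0)}"

definition moebius_related ::
  "complex set \<Rightarrow> complex \<Rightarrow> complex \<Rightarrow> (complex \<Rightarrow> complex) \<Rightarrow> (complex \<Rightarrow> complex) \<Rightarrow> bool" where
  "moebius_related D a b g g' \<longleftrightarrow>
     (\<forall>z\<in>D. b * g z + cnj a \<noteq> 0 \<and> g' z = (a * g z + cnj b) / (b * g z + cnj a))"

definition HH_equiv :: "(holpair \<times> holpair) set" where
  "HH_equiv = {((D, g\<^sub>1, g\<^sub>2), (D', g\<^sub>1', g\<^sub>2')). (D, g\<^sub>1, g\<^sub>2) \<in> HH \<and> (D', g\<^sub>1', g\<^sub>2') \<in> HH \<and>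
     (\<exists>D\<^sub>0 a\<^sub>1 b\<^sub>1 a\<^sub>2 b\<^sub>2. nbhd0 D\<^sub>0 \<and> D\<^sub>0 \<subseteq> D \<inter> D' \<and>
        ((cmod a\<^sub>1)\<^sup>2 - (cmod b\<^sub>1)\<^sup>2 = 1 \<and> (cmod a\<^sub>2)\<^sup>2 - (cmod b\<^sub>2)\<^sup>2 = 1 \<or>
         (cmod a\<^sub>1)\<^sup>2 - (cmod b\<^sub>1)\<^sup>2 = -1 \<and> (cmod a\<^sub>2)\<^sup>2 - (cmod b\<^sub>2)\<^sup>2 = -1) \<and>
        moebius_related D\<^sub>0 a\<^sub>1 b\<^sub>1 g\<^sub>1 g\<^sub>1' \<and> moebius_related D\<^sub>0 a\<^sub>2 b\<^sub>2 g\<^sub>2 g\<^sub>2')}"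


section \<open>The three correspondences\<close>

definition curvature_corr :: "(surf \<times> natsol) set" where
  "curvature_corr =
     {((D, x), (D', K, \<kappa>)). D' = D \<and>
        K = gauss_curvature (induced_metric x) \<and> \<kappa> = normal_curvature x}"

text \<open>A multivalued correspondence: the domain \<open>D'\<close>, the branch \<open>s\<close> of \<open>\<surd>(g\<^sub>1' g\<^sub>2')\<close> and the
  constant of integration of \<open>x\<close> are free.\<close>

definition weierstrass_corr :: "(holpair \<times> surf) set" where
  "weierstrass_corr =
     {((D, g\<^sub>1, g\<^sub>2), (D', x)). nbhd0 D' \<and> D' \<subseteq> D \<and> (\<forall>z\<in>D'. x differentiable (at z)) \<and>
        (\<exists>s. s holomorphic_on D' \<and> (\<forall>z\<in>D'. (s z)\<^sup>2 = deriv g\<^sub>1 z * deriv g\<^sub>2 z \<and>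
           Phi x z = vector [1/2 * ((g\<^sub>1 z * g\<^sub>2 z + 1) / s z),
                             \<i>/2 * ((g\<^sub>1 z * g\<^sub>2 z - 1) / s z),
                             1/2 * ((g\<^sub>1 z + g\<^sub>2 z) / s z),
                             \<i>/2 * ((g\<^sub>1 z - g\<^sub>2 z) / s z)]))}"

definition K_of :: "(complex \<Rightarrow> complex) \<Rightarrow> (complex \<Rightarrow> complex) \<Rightarrow> complex \<Rightarrow> real" where
  "K_of g\<^sub>1 g\<^sub>2 z =
     8 * cmod (deriv g\<^sub>1 z * deriv g\<^sub>2 z) / (((cmod (g\<^sub>1 z))\<^sup>2 - 1) * ((cmod (g\<^sub>2 z))\<^sup>2 - 1)) *
     ((cmod (deriv g\<^sub>1 z))\<^sup>2 / ((cmod (g\<^sub>1 z))\<^sup>2 - 1)\<^sup>2 +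
      (cmod (deriv g\<^sub>2 z))\<^sup>2 / ((cmod (g\<^sub>2 z))\<^sup>2 - 1)\<^sup>2)"

definition kappa_of :: "(complex \<Rightarrow> complex) \<Rightarrow> (complex \<Rightarrow> complex) \<Rightarrow> complex \<Rightarrow> real" where
  "kappa_of g\<^sub>1 g\<^sub>2 z =
     - 8 * cmod (deriv g\<^sub>1 z * deriv g\<^sub>2 z) / (((cmod (g\<^sub>1 z))\<^sup>2 - 1) * ((cmod (g\<^sub>2 z))\<^sup>2 - 1)) *
     ((cmod (deriv g\<^sub>1 z))\<^sup>2 / ((cmod (g\<^sub>1 z))\<^sup>2 - 1)\<^sup>2 -
      (cmod (deriv g\<^sub>2 z))\<^sup>2 / ((cmod (g\<^sub>2 z))\<^sup>2 - 1)\<^sup>2)"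

definition formula_corr :: "(holpair \<times> natsol) set" where
  "formula_corr =
     {((D, g\<^sub>1, g\<^sub>2), (D', K, \<kappa>)). D' = D \<and> K = K_of g\<^sub>1 g\<^sub>2 \<and> \<kappa> = kappa_of g\<^sub>1 g\<^sub>2}"

text \<open>The correspondence \<open>C\<close> between representatives is defined on all of \<open>A\<close>, takes values in
  \<open>B\<close>, and induces the map \<open>F\<close> of equivalence classes. This determines \<open>F\<close> on \<open>A // r\<close>.\<close>

definition induces ::
  "('a \<times> 'b) set \<Rightarrow> 'a set \<Rightarrow> ('a \<times> 'a) set \<Rightarrow> 'b set \<Rightarrow> ('b \<times> 'b) set \<Rightarrow> ('a set \<Rightarrow> 'b set) \<Rightarrow> bool"
  where
  "induces C A r B s F \<longleftrightarrow>
     (\<forall>a\<in>A. (\<exists>b. (a, b) \<in> C) \<and> (\<forall>b. (a, b) \<in> C \<longrightarrow> b \<in> B \<and> F (r `` {a}) = s `` {b}))"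

end

theory Submission
  imports Defs "HOL-Complex_Analysis.Complex_Analysis"
begin

text \<open>Both curvatures depend only on the hyperbolic densities \<open>a = |g\<^sub>1'| / | |g\<^sub>1|\<^sup>2 - 1 |\<close> and
  \<open>b = |g\<^sub>2'| / | |g\<^sub>2|\<^sup>2 - 1 |\<close>: the induced metric is \<open>(du\<^sup>2 + dv\<^sup>2) / (4ab)\<close>, \<open>K = 8ab(a\<^sup>2 + b\<^sup>2)\<close> and
  \<open>\<kappa> = 8ab(b\<^sup>2 - a\<^sup>2)\<close>. In terms of \<open>a\<close> and \<open>b\<close> the natural equations decouple into the Liouville
  equations \<open>\<Delta> ln a = 4a\<^sup>2\<close> and \<open>\<Delta> ln b = 4b\<^sup>2\<close>. Each of them is solved by a quotient \<open>g = y\<^sub>1 / y\<^sub>2\<close> of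
  solutions of \<open>y'' = -S y\<close>, where \<open>S = \<partial>\<^sup>2 w - (\<partial>w)\<^sup>2\<close> is holomorphic for \<open>w = ln a\<close>, and \<open>g\<close> is unique up to
  the hyperbolic isometries (the sign of \<open>|g|\<^sup>2 - 1\<close> accounts for the two signs of \<open>|a\<^sub>j|\<^sup>2 - |b\<^sub>j|\<^sup>2\<close>). This
  gives the bijection (iii), and with it the injectivity of (ii), because curvatures are invariant under
  congruences. Conversely \<open>g\<^sub>1\<close> and \<open>g\<^sub>2\<close> are quotients of combinations of the components of \<open>\<Phi>\<close>, after a
  reflection in \<open>SO(2,2)\<close> if the common denominator vanishes at 0; hence (ii) is surjective, and (i) is
  the composition of (iii) with the inverse of (ii).\<close>

no_notation fps_nth (infixl "$" 75)

section \<open>Partial derivatives and classes \<open>C\<^sup>k\<close>\<close>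

text \<open>Solutions of the natural equations are only C^2, so w = ln a has no third derivatives
  and S cannot be shown holomorphic by differentiating it. Instead S arises as the complex
  derivative of a holomorphic function: the form (\<partial>w)^2 dt + e^(2w) dt-bar is closed, and
  \<partial>w minus a primitive of it is annihilated by d/dt-bar. With the pair (y1, y2) in place of
  g, the Liouville equation is a statement about the Hermitian form |y2|^2 - |y1|^2. The problem
  becomes linear, poles of g do no harm, and the isometries of g become matrices preserving this
  form up to sign. The normal curvature is a definite description over frames. It becomes computable
  through 2 det(x_u, x_v, x_uu, x_uv) / (x_u^2)^3, which contains no frame and shows the invariance
  under SO(2,2). The condition (|g1|^2 - 1)(|g2|^2 - 1) > 0 is the positivity of the metric. It also
  forces the determinants of the two Moebius maps to have the same sign, and exactly this makes the
  associated linear map an isometry rather than an anti-isometry.\<close>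

lemma coord_dir_simps [simp]: "coord_dir 1 = 1" "coord_dir 2 = \<i>"
  by (simp_all add: coord_dir_def)

lemma pd_unique: "(f has_derivative f') (at z) \<Longrightarrow> pd i f z = f' (coord_dir i)"
  unfolding pd_def using frechet_derivative_at by metis

lemma has_derivative_pd:
  assumes "f differentiable (at z)"
  shows "(f has_derivative (\<lambda>h. Re h *\<^sub>R pd 1 f z + Im h *\<^sub>R pd 2 f z)) (at z)"
proof -
  let ?f' = "frechet_derivative f (at z)"
  have d: "(f has_derivative ?f') (at z)"
    using assms frechet_derivative_works by blast
  interpret bounded_linear ?f' using d by (rule has_derivative_bounded_linear)
  have "?f' h = Re h *\<^sub>R pd 1 f z + Im h *\<^sub>R pd 2 f z" for h
  proof -
    have "h = Re h *\<^sub>R 1 + Im h *\<^sub>R \<i>" by (simp add: complex_eq_iff)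
    then have "?f' h = ?f' (Re h *\<^sub>R 1 + Im h *\<^sub>R \<i>)" by simp
    then show ?thesis by (simp add: add scale pd_def)
  qed
  then have "?f' = (\<lambda>h. Re h *\<^sub>R pd 1 f z + Im h *\<^sub>R pd 2 f z)" by auto
  then show ?thesis using d by simp
qed

lemma frechet_derivative_pd:
  "f differentiable (at z) \<Longrightarrow> frechet_derivative f (at z) h = Re h *\<^sub>R pd 1 f z + Im h *\<^sub>R pd 2 f z"
  using fun_cong[OF frechet_derivative_at[OF has_derivative_pd], of f z h] by simp

lemma differentiable_cong_open:
  assumes "open D" "z \<in> D" "\<And>w. w \<in> D \<Longrightarrow> f w = g w" "f differentiable (at z)"
  shows "g differentiable (at z)"
  using assms has_derivative_transform_within_open unfolding differentiable_def by blast

lemma pd_cong_open: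
  assumes "open D" "z \<in> D" "\<And>w. w \<in> D \<Longrightarrow> f w = g w"
  shows "pd i f z = pd i g z"
proof -
  have "(f has_derivative f') (at z) \<longleftrightarrow> (g has_derivative f') (at z)" for f'
    using assms has_derivative_transform_within_open by metis
  then show ?thesis by (simp add: pd_def frechet_derivative_def)
qed

section \<open>Closure of the classes C^k under algebraic operations, powers, logarithm and
  exponential\<close>

lemma Ck_on_cong:
  assumes "open D" "\<And>z. z \<in> D \<Longrightarrow> f z = g z" "Ck_on k f D"
  shows "Ck_on k g D"
  using assms(2,3)
proof (induction k arbitrary: f g)
  case 0
  then show ?case by (simp cong: continuous_on_cong)
next
  case (Suc k)
  have "g differentiable (at z)" if "z \<in> D" for z
    using differentiable_cong_open[OF assms(1) that Suc.prems(1)] Suc.prems(2) that by auto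
  moreover have "Ck_on k (pd i g) D" for i
  proof (rule Suc.IH)
    show "Ck_on k (pd i f) D" using Suc.prems(2) by auto
    show "pd i f z = pd i g z" if "z \<in> D" for z
      by (rule pd_cong_open[OF assms(1) that Suc.prems(1)])
  qed
  ultimately show ?case by auto
qed

lemma Ck_on_continuous: "Ck_on k f D \<Longrightarrow> continuous_on D f"
  by (cases k) (auto intro!: continuous_at_imp_continuous_on differentiable_imp_continuous_within)

lemma Ck_on_SucD: "Ck_on (Suc k) f D \<Longrightarrow> Ck_on k f D"
proof (induction k arbitrary: f)
  case 0
  then show ?case using Ck_on_continuous[of "Suc 0" f D] by simp
next
  case (Suc k)
  then show ?case by (metis Ck_on.simps(2))
qed

lemma Ck_on_le: "Ck_on k f D \<Longrightarrow> j \<le> k \<Longrightarrow> Ck_on j f D"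
  by (induction k) (auto simp: le_Suc_eq simp del: Ck_on.simps dest: Ck_on_SucD)

lemma Ck_on_subset: "Ck_on k f D \<Longrightarrow> E \<subseteq> D \<Longrightarrow> Ck_on k f E"
  by (induction k arbitrary: f) (auto intro: continuous_on_subset)

text \<open>The curvatures of a surface are computed only near points, where a Weierstrass
  representation is available; this carries their regularity to the whole domain.\<close>

lemma Ck_on_local:
  assumes "\<And>z. z \<in> D \<Longrightarrow> \<exists>U. open U \<and> z \<in> U \<and> Ck_on k f U"
  shows "Ck_on k f D"
  using assms
proof (induction k arbitrary: f)
  case 0
  then show ?case
    by (metis Ck_on.simps(1) continuous_at_imp_continuous_on continuous_on_eq_continuous_at)
next
  case (Suc k)
  then show ?case by (metis Ck_on.simps(2))
qed

lemma Ck_on_const [simp]: "Ck_on k (\<lambda>z. c) D"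
proof (induction k arbitrary: c)
  case (Suc k)
  have "pd i (\<lambda>z. c) = (\<lambda>z. 0)" for i by (rule ext) (simp add: pd_unique[OF has_derivative_const])
  then show ?case using Suc by simp
qed simp

lemma pd_linear:
  assumes "bounded_linear L" "f differentiable (at z)"
  shows "pd i (\<lambda>z. L (f z)) z = L (pd i f z)"
proof -
  interpret bounded_linear L by fact
  show ?thesis
    using pd_unique[OF has_derivative[OF has_derivative_pd[OF assms(2)]], of i]
      pd_unique[OF has_derivative_pd[OF assms(2)], of i] by simp
qed

lemma pd_bilinear:
  assumes "bounded_bilinear B" "f differentiable (at z)" "g differentiable (at z)"
  shows "pd i (\<lambda>z. B (f z) (g z)) z = B (f z) (pd i g z) + B (pd i f z) (g z)"
proof -
  interpret bounded_bilinear B by fact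
  show ?thesis
    using pd_unique[OF FDERIV[OF has_derivative_pd[OF assms(2)] has_derivative_pd[OF assms(3)]], of i]
      pd_unique[OF has_derivative_pd[OF assms(2)], of i]
      pd_unique[OF has_derivative_pd[OF assms(3)], of i] by simp
qed

lemma pd_add:
  assumes "f differentiable (at z)" "g differentiable (at z)"
  shows "pd i (\<lambda>z. f z + g z) z = pd i f z + pd i g z"
  using pd_unique[OF has_derivative_add[OF has_derivative_pd[OF assms(1)] has_derivative_pd[OF assms(2)]], of i]
      pd_unique[OF has_derivative_pd[OF assms(1)], of i]
      pd_unique[OF has_derivative_pd[OF assms(2)], of i] by simp

lemma Ck_on_linear:
  assumes L: "bounded_linear L" and "open D" "Ck_on k f D"
  shows "Ck_on k (\<lambda>z. L (f z)) D"
  using assms(3)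
proof (induction k arbitrary: f)
  case 0
  then show ?case by (simp add: bounded_linear.continuous_on[OF L])
next
  case (Suc k)
  have "Ck_on k (pd i (\<lambda>z. L (f z))) D" for i
    by (rule Ck_on_cong[OF \<open>open D\<close> _ Suc.IH[of "pd i f"]]) (use Suc.prems pd_linear[OF L] in auto)
  then show ?case using Suc.prems bounded_linear_imp_differentiable[OF L] differentiable_chain_at[of f _ L] by (auto simp: comp_def)
qed

lemma Ck_on_add:
  assumes "open D" "Ck_on k f D" "Ck_on k g D"
  shows "Ck_on k (\<lambda>z. f z + g z) D"
  using assms(2,3)
proof (induction k arbitrary: f g)
  case 0
  then show ?case by (simp add: continuous_on_add)
next
  case (Suc k)
  have "Ck_on k (pd i (\<lambda>z. f z + g z)) D" for i
    by (rule Ck_on_cong[OF \<open>open D\<close> _ Suc.IH[of "pd i f" "pd i g"]]) (use Suc.prems in \<open>auto simp: pd_add\<close>)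
  then show ?case using Suc.prems by auto
qed

lemma Ck_on_bilinear:
  assumes B: "bounded_bilinear B" and "open D" "Ck_on k f D" "Ck_on k g D"
  shows "Ck_on k (\<lambda>z. B (f z) (g z)) D"
  using assms(3,4)
proof (induction k arbitrary: f g)
  case 0
  then show ?case by (simp add: bounded_bilinear.continuous_on[OF B])
next
  case (Suc k)
  have fg: "Ck_on k f D" "Ck_on k g D" using Suc.prems Ck_on_SucD by blast+
  have "Ck_on k (pd i (\<lambda>z. B (f z) (g z))) D" for i
    by (rule Ck_on_cong[OF \<open>open D\<close> _
          Ck_on_add[OF \<open>open D\<close> Suc.IH[of f "pd i g"] Suc.IH[of "pd i f" g]]])
       (use fg Suc.prems pd_bilinear[OF B] in auto)
  moreover have "(\<lambda>z. B (f z) (g z)) differentiable (at z)" if "z \<in> D" for z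
    using bounded_bilinear.FDERIV[OF B has_derivative_pd has_derivative_pd, of f z g] Suc.prems that
      differentiable_def[of "\<lambda>z. B (f z) (g z)"] by auto
  ultimately show ?case by simp
qed

lemmas Ck_on_mult = Ck_on_bilinear[OF bounded_bilinear_mult]
lemma Ck_on_minus: "open D \<Longrightarrow> Ck_on k f D \<Longrightarrow> Ck_on k (\<lambda>z. - f z) D"
  by (rule Ck_on_linear[OF bounded_linear_minus[OF bounded_linear_ident]])

lemma Ck_on_diff:
  "open D \<Longrightarrow> Ck_on k f D \<Longrightarrow> Ck_on k g D \<Longrightarrow> Ck_on k (\<lambda>z. f z - g z) D"
  using Ck_on_add[of D k f "\<lambda>z. - g z"] Ck_on_minus[of D k g] by simp

lemma Ck_on_sum:
  "open D \<Longrightarrow> (\<And>i. i \<in> I \<Longrightarrow> Ck_on k (f i) D) \<Longrightarrow> Ck_on k (\<lambda>z. \<Sum>i\<in>I. f i z) D"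
  by (induction I rule: infinite_finite_induct) (simp_all add: Ck_on_add)

lemma Ck_on_vec:
  fixes f :: "complex \<Rightarrow> real^'n"
  assumes "open D" "\<And>i. Ck_on k (\<lambda>z. f z $ i) D"
  shows "Ck_on k f D"
proof -
  have "f = (\<lambda>z. \<Sum>i\<in>UNIV. (f z $ i) *\<^sub>R axis i 1)"
    by (rule ext) (simp add: basis_expansion scalar_mult_eq_scaleR[symmetric])
  moreover have "Ck_on k (\<lambda>z. \<Sum>i\<in>UNIV. (f z $ i) *\<^sub>R (axis i 1 :: real^'n)) D"
    by (rule Ck_on_sum[OF assms(1)])
       (rule Ck_on_linear[OF bounded_linear_scaleR_left assms(1) assms(2)])
  ultimately show ?thesis by simp
qed

lemma pd_chain:
  fixes f :: "complex \<Rightarrow> real"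
  assumes "f differentiable (at z)" "(h has_real_derivative h') (at (f z))"
  shows "((\<lambda>z. h (f z)) has_derivative (\<lambda>v. h' * (Re v *\<^sub>R pd 1 f z + Im v *\<^sub>R pd 2 f z))) (at z)"
    and "pd i (\<lambda>z. h (f z)) z = h' * pd i f z"
proof -
  show *: "((\<lambda>z. h (f z)) has_derivative (\<lambda>v. h' * (Re v *\<^sub>R pd 1 f z + Im v *\<^sub>R pd 2 f z))) (at z)"
    using has_derivative_compose[OF has_derivative_pd[OF assms(1)]
        has_field_derivative_imp_has_derivative[OF assms(2)]] by simp
  show "pd i (\<lambda>z. h (f z)) z = h' * pd i f z"
    using pd_unique[OF *, of i] pd_unique[OF has_derivative_pd[OF assms(1)], of i] by simp
qed

text \<open>The derivative of \<open>f powr \<alpha>\<close> contains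
  \<open>f powr (\<alpha> - 1)\<close>, so the induction runs over all exponents at once. The
  exponent -1 serves as reciprocal, the exponents 1/2 and -1/2 as square roots.\<close>

lemma Ck_on_powr:
  fixes f :: "complex \<Rightarrow> real"
  assumes "open D" "Ck_on k f D" "\<And>z. z \<in> D \<Longrightarrow> f z > 0"
  shows "Ck_on k (\<lambda>z. f z powr \<alpha>) D"
  using assms(2)
proof (induction k arbitrary: \<alpha>)
  case 0
  then show ?case using assms(3) by (auto intro!: continuous_on_powr continuous_on_const) force
next
  case (Suc k)
  have f: "Ck_on k f D" and d: "\<And>z. z \<in> D \<Longrightarrow> f differentiable (at z)" and p: "\<And>i. Ck_on k (pd i f) D"
    using Suc.prems Ck_on_SucD by auto
  have D: "((\<lambda>y. y powr \<alpha>) has_real_derivative \<alpha> * f z powr (\<alpha> - 1)) (at (f z))" if "z \<in> D" for z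
    by (rule has_real_derivative_powr) (use assms(3) that in auto)
  have "Ck_on k (pd i (\<lambda>z. f z powr \<alpha>)) D" for i
    by (rule Ck_on_cong[OF assms(1) _ Ck_on_mult[OF assms(1)
          Ck_on_mult[OF assms(1) Ck_on_const[of k \<alpha>] Suc.IH[OF f, of "\<alpha> - 1"]] p[of i]]])
       (use pd_chain(2)[OF d D] in simp)
  moreover have "(\<lambda>z. f z powr \<alpha>) differentiable (at z)" if "z \<in> D" for z
    using pd_chain(1)[OF d[OF that] D[OF that]] unfolding differentiable_def by blast
  ultimately show ?case by simp
qed

lemma Ck_on_ln:
  fixes f :: "complex \<Rightarrow> real"
  assumes "open D" "Ck_on k f D" "\<And>z. z \<in> D \<Longrightarrow> f z > 0"
  shows "Ck_on k (\<lambda>z. ln (f z)) D"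
proof (cases k)
  case 0
  then show ?thesis using assms by (auto intro!: continuous_on_ln) force
next
  case (Suc j)
  have f: "Ck_on j f D" and d: "\<And>z. z \<in> D \<Longrightarrow> f differentiable (at z)" and p: "\<And>i. Ck_on j (pd i f) D"
    using assms(2) Ck_on_SucD Suc by auto
  have D: "(ln has_real_derivative f z powr (- 1)) (at (f z))" if "z \<in> D" for z
    using DERIV_ln[of "f z"] assms(3)[OF that] by (simp add: powr_minus)
  have "Ck_on j (pd i (\<lambda>z. ln (f z))) D" for i
    by (rule Ck_on_cong[OF assms(1) _ Ck_on_mult[OF assms(1) Ck_on_powr[OF assms(1) f assms(3), of "-1"] p[of i]]])
       (use pd_chain(2)[OF d D] in simp_all)
  moreover have "(\<lambda>z. ln (f z)) differentiable (at z)" if "z \<in> D" for z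
    using pd_chain(1)[OF d[OF that] D[OF that]] unfolding differentiable_def by blast
  ultimately show ?thesis using Suc by simp
qed

lemma Ck_on_exp:
  fixes f :: "complex \<Rightarrow> real"
  assumes "open D" "Ck_on k f D"
  shows "Ck_on k (\<lambda>z. exp (f z)) D"
  using assms(2)
proof (induction k)
  case 0
  then show ?case by (auto intro!: continuous_on_exp)
next
  case (Suc k)
  have f: "Ck_on k f D" and d: "\<And>z. z \<in> D \<Longrightarrow> f differentiable (at z)" and p: "\<And>i. Ck_on k (pd i f) D"
    using Suc.prems Ck_on_SucD by auto
  have "Ck_on k (pd i (\<lambda>z. exp (f z))) D" for i
    by (rule Ck_on_cong[OF assms(1) _ Ck_on_mult[OF assms(1) Suc.IH[OF f] p[of i]]])
       (use pd_chain(2)[OF d DERIV_exp] in simp)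
  moreover have "(\<lambda>z. exp (f z)) differentiable (at z)" if "z \<in> D" for z
    using pd_chain(1)[OF d[OF that] DERIV_exp] unfolding differentiable_def by blast
  ultimately show ?case by simp
qed

lemma pd_holomorphic:
  assumes "f holomorphic_on D" "open D" "z \<in> D"
  shows "f differentiable (at z)" "pd i f z = deriv f z * coord_dir i"
proof -
  have *: "(f has_derivative (*) (deriv f z)) (at z)"
    using holomorphic_derivI[OF assms] by (simp add: has_field_derivative_def)
  then show "f differentiable (at z)" "pd i f z = deriv f z * coord_dir i"
    using pd_unique[OF *] by (auto simp: differentiable_def)
qed

lemma Ck_on_holomorphic:
  assumes "open D" "f holomorphic_on D"
  shows "Ck_on k f D"
  using assms(2)
proof (induction k arbitrary: f)
  case 0
  then show ?case by (simp add: holomorphic_on_imp_continuous_on)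
next
  case (Suc k)
  have "Ck_on k (pd i f) D" for i
    by (rule Ck_on_cong[OF assms(1) _ Ck_on_mult[OF assms(1) Suc.IH[OF holomorphic_deriv[OF Suc.prems assms(1)]]
            Ck_on_const[of k "coord_dir i"]]])
       (use pd_holomorphic[OF Suc.prems assms(1)] in simp)
  then show ?case using pd_holomorphic(1)[OF Suc.prems assms(1)] by auto
qed

section \<open>Symmetry of second partial derivatives\<close>

lemma DERIV_along:
  fixes f :: "complex \<Rightarrow> real"
  assumes "f differentiable (at (z + of_real s * coord_dir i))"
  shows "((\<lambda>s. f (z + of_real s * coord_dir i)) has_real_derivative pd i f (z + of_real s * coord_dir i)) (at s)"
proof -
  let ?L = "\<lambda>h. Re h *\<^sub>R pd 1 f (z + of_real s * coord_dir i) + Im h *\<^sub>R pd 2 f (z + of_real s * coord_dir i)"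
  have g: "((\<lambda>s. z + of_real s * coord_dir i) has_derivative (\<lambda>h. of_real h * coord_dir i)) (at s)"
    by (auto intro!: derivative_eq_intros)
  have "((\<lambda>s. f (z + of_real s * coord_dir i)) has_derivative (\<lambda>h. ?L (of_real h * coord_dir i))) (at s)"
    by (rule has_derivative_compose[OF g has_derivative_pd[OF assms]])
  moreover have "?L (of_real h * coord_dir i) = pd i f (z + of_real s * coord_dir i) * h" for h
    using pd_unique[OF has_derivative_pd[OF assms], of i]
    by (simp add: coord_dir_def split: if_splits)
  ultimately show ?thesis by (simp add: has_field_derivative_def)
qed

text \<open>The mean value theorem is applied twice: along direction i to the increment of f over a
  step in direction j, then along j to \<open>pd i f\<close>. The intermediate point stays within 2h
  of z, as the limit h -> 0 requires.\<close>

lemma second_difference: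
  fixes f :: "complex \<Rightarrow> real"
  assumes f: "\<And>w. w \<in> ball z r \<Longrightarrow> f differentiable (at w)"
    "\<And>w. w \<in> ball z r \<Longrightarrow> pd i f differentiable (at w)"
    and h: "0 < h" "2 * h < r"
  obtains w where "dist z w < 2 * h"
    "f (z + of_real h * coord_dir i + of_real h * coord_dir j) - f (z + of_real h * coord_dir i)
       - f (z + of_real h * coord_dir j) + f z = h * h * pd j (pd i f) w"
proof -
  let ?p = "\<lambda>s t. z + of_real s * coord_dir i + of_real t * coord_dir j"
  have p: "dist z (?p s t) < 2 * h" if "\<bar>s\<bar> \<le> h" "\<bar>t\<bar> \<le> h" "\<bar>s\<bar> < h \<or> \<bar>t\<bar> < h" for s t
  proof -
    have "norm (of_real s * coord_dir i + of_real t * coord_dir j) \<le> \<bar>s\<bar> + \<bar>t\<bar>"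
      by (rule order_trans[OF norm_triangle_ineq]) (auto simp: norm_mult coord_dir_def)
    moreover have "dist z (?p s t) = norm (of_real s * coord_dir i + of_real t * coord_dir j)"
      by (subst norm_minus_cancel[symmetric]) (simp add: dist_norm algebra_simps)
    ultimately show ?thesis using that by linarith
  qed
  have p': "?p s t \<in> ball z r" if "\<bar>s\<bar> \<le> h" "\<bar>t\<bar> \<le> h" for s t
  proof -
    have "norm (of_real s * coord_dir i + of_real t * coord_dir j) \<le> \<bar>s\<bar> + \<bar>t\<bar>"
      by (rule order_trans[OF norm_triangle_ineq]) (auto simp: norm_mult coord_dir_def)
    moreover have "dist z (?p s t) = norm (of_real s * coord_dir i + of_real t * coord_dir j)"
      by (subst norm_minus_cancel[symmetric]) (simp add: dist_norm algebra_simps)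
    ultimately show ?thesis using that h by simp
  qed
  have swap: "?p s t = z + of_real t * coord_dir j + of_real s * coord_dir i" for s t by simp
  have D: "((\<lambda>s. f (?p s h) - f (?p s 0)) has_real_derivative pd i f (?p s h) - pd i f (?p s 0)) (at s)"
    if "0 \<le> s" "s \<le> h" for s
    unfolding swap
    by (intro DERIV_diff DERIV_along f(1)) (use p'[of s h] p'[of s 0] that h swap in auto)
  obtain s where s: "0 < s" "s < h"
    "(f (?p h h) - f (?p h 0)) - (f (?p 0 h) - f (?p 0 0)) = (h - 0) * (pd i f (?p s h) - pd i f (?p s 0))"
    using MVT2[OF h(1) D] by auto
  have D2: "((\<lambda>t. pd i f (?p s t)) has_real_derivative pd j (pd i f) (?p s t)) (at t)"
    if "0 \<le> t" "t \<le> h" for t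
    by (intro DERIV_along f(2)) (use p'[of s t] that h s in auto)
  obtain t where t: "0 < t" "t < h"
    "pd i f (?p s h) - pd i f (?p s 0) = (h - 0) * pd j (pd i f) (?p s t)"
    using MVT2[OF h(1) D2] by auto
  show ?thesis
    by (rule that[of "?p s t"]) (use p[of s t] s t in \<open>auto simp: algebra_simps\<close>)
qed

text \<open>The second difference is symmetric in the two directions, so the two mixed derivatives
  take a common value at two points arbitrarily close to z. Continuity at z does the rest.\<close>

lemma pd_commute_real:
  fixes f :: "complex \<Rightarrow> real"
  assumes "open D" "Ck_on 2 f D" "z \<in> D"
  shows "pd 1 (pd 2 f) z = pd 2 (pd 1 f) z"
proof -
  have C: "Ck_on 1 (pd i f) D" and d: "\<And>w. w \<in> D \<Longrightarrow> f differentiable (at w)" for i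
    using assms(2) by (auto simp: numeral_2_eq_2)
  have d2: "\<And>w. w \<in> D \<Longrightarrow> pd i f differentiable (at w)" and cont: "continuous_on D (pd j (pd i f))" for i j
    using C[of i] by auto
  obtain r where r: "r > 0" "ball z r \<subseteq> D" using assms open_contains_ball by blast
  have "\<bar>pd 1 (pd 2 f) z - pd 2 (pd 1 f) z\<bar> < e" if "e > 0" for e
  proof -
    have ct: "\<exists>d>0. \<forall>w. dist w z < d \<longrightarrow> dist (pd i (pd j f) w) (pd i (pd j f) z) < e/2" for i j
    proof -
      have "continuous (at z) (pd i (pd j f))"
        using cont[of i j] assms(1,3) by (simp add: continuous_on_eq_continuous_at)
      then show ?thesis unfolding continuous_at_eps_delta using half_gt_zero[OF that] by blast
    qed
    obtain d1 where d1: "d1 > 0" "\<And>w. dist w z < d1 \<Longrightarrow> dist (pd 1 (pd 2 f) w) (pd 1 (pd 2 f) z) < e/2"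
      using ct[of 1 2] by auto
    obtain d2' where d2': "d2' > 0" "\<And>w. dist w z < d2' \<Longrightarrow> dist (pd 2 (pd 1 f) w) (pd 2 (pd 1 f) z) < e/2"
      using ct[of 2 1] by auto
    note dd = d1 d2'
    define h where "h = min r (min d1 d2') / 4"
    have h: "h > 0" "2*h < r" "2*h < d1" "2*h < d2'" using r dd by (auto simp: h_def min_def)
    obtain w1 where w1: "dist z w1 < 2 * h"
      "f (z + of_real h * coord_dir 1 + of_real h * coord_dir 2) - f (z + of_real h * coord_dir 1)
       - f (z + of_real h * coord_dir 2) + f z = h * h * pd 2 (pd 1 f) w1"
      using second_difference[of z r f 1 h 2] d d2 r h by (auto simp: subset_iff)
    obtain w2 where w2: "dist z w2 < 2 * h"
      "f (z + of_real h * coord_dir 2 + of_real h * coord_dir 1) - f (z + of_real h * coord_dir 2)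
       - f (z + of_real h * coord_dir 1) + f z = h * h * pd 1 (pd 2 f) w2"
      using second_difference[of z r f 2 h 1] d d2 r h by (auto simp: subset_iff)
    have "h * h * pd 2 (pd 1 f) w1 = h * h * pd 1 (pd 2 f) w2"
      using w1(2) w2(2) by (simp add: algebra_simps)
    then have "pd 2 (pd 1 f) w1 = pd 1 (pd 2 f) w2" using h by simp
    moreover have "dist (pd 1 (pd 2 f) w2) (pd 1 (pd 2 f) z) < e/2" "dist (pd 2 (pd 1 f) w1) (pd 2 (pd 1 f) z) < e/2"
      using dd w1(1) w2(1) h by (auto simp: dist_commute)
    ultimately show ?thesis unfolding dist_real_def by linarith
  qed
  from this[of "\<bar>pd 1 (pd 2 f) z - pd 2 (pd 1 f) z\<bar>"] show ?thesis by (cases "pd 1 (pd 2 f) z = pd 2 (pd 1 f) z") auto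
qed

lemma pd_commute:
  fixes f :: "complex \<Rightarrow> 'a::euclidean_space"
  assumes "open D" "Ck_on 2 f D" "z \<in> D"
  shows "pd i (pd j f) z = pd j (pd i f) z"
proof -
  have C: "\<And>w. w \<in> D \<Longrightarrow> f differentiable (at w)" "\<And>i w. w \<in> D \<Longrightarrow> pd i f differentiable (at w)"
    using assms(2) by (auto simp: numeral_2_eq_2)
  have *: "pd i (pd j f) z \<bullet> b = pd i (pd j (\<lambda>w. f w \<bullet> b)) z" for i j b
  proof -
    have "pd i (pd j (\<lambda>w. f w \<bullet> b)) z = pd i (\<lambda>w. pd j f w \<bullet> b) z"
      by (rule pd_cong_open[OF assms(1,3)]) (rule pd_linear[OF bounded_linear_inner_left C(1)])
    also have "\<dots> = pd i (pd j f) z \<bullet> b"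
      by (rule pd_linear[OF bounded_linear_inner_left C(2)[OF assms(3)]])
    finally show ?thesis by simp
  qed
  have c: "pd 1 (pd 2 f) z = pd 2 (pd 1 f) z"
    by (rule euclidean_eqI)
       (simp add: * pd_commute_real[OF assms(1) Ck_on_linear[OF bounded_linear_inner_left assms(1,2)] assms(3)])
  show ?thesis using c exhaust_2[of i] exhaust_2[of j] by auto
qed

section \<open>Wirtinger derivatives\<close>

text \<open>The coefficients a and b are the derivatives of f in t and in the conjugate variable.
  This is a relation rather than a pair of operators, so that each rule delivers real
  differentiability together with both values.\<close>

definition wirt :: "(complex \<Rightarrow> complex) \<Rightarrow> complex \<Rightarrow> complex \<Rightarrow> complex \<Rightarrow> bool" where
  "wirt f a b z \<longleftrightarrow> (f has_derivative (\<lambda>h. a * h + b * cnj h)) (at z)"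

lemma wirt_unique:
  assumes "wirt f a b z" "wirt f c d z"
  shows "a = c" "b = d"
proof -
  have "(\<lambda>h. a * h + b * cnj h) = (\<lambda>h. c * h + d * cnj h)"
    using assms has_derivative_unique unfolding wirt_def by blast
  from fun_cong[OF this, of 1] fun_cong[OF this, of \<i>]
  have *: "a + b = c + d" "a * \<i> - b * \<i> = c * \<i> - d * \<i>" by simp_all
  from *(2) have "\<i> * (a - b) = \<i> * (c - d)" by (simp add: algebra_simps)
  then have "a - b = c - d" by simp
  with *(1) have "2 * a = 2 * c" "2 * b = 2 * d" by algebra+
  then show "a = c" "b = d" by simp_all
qed

lemma wirt_const: "wirt (\<lambda>z. c) 0 0 z"
  by (simp add: wirt_def)

lemma wirt_holomorphic: "(f has_field_derivative f') (at z) \<Longrightarrow> wirt f f' 0 z"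
  by (simp add: wirt_def has_field_derivative_def)

lemma wirt_hol: "f holomorphic_on U \<Longrightarrow> open U \<Longrightarrow> z \<in> U \<Longrightarrow> wirt f (deriv f z) 0 z"
  by (rule wirt_holomorphic) (rule holomorphic_derivI)

lemma wirt_cnj: "wirt f a b z \<Longrightarrow> wirt (\<lambda>z. cnj (f z)) (cnj b) (cnj a) z"
  unfolding wirt_def by (drule has_derivative_cnj) (simp add: add.commute)

lemma wirt_cnj_hol: "f holomorphic_on U \<Longrightarrow> open U \<Longrightarrow> z \<in> U \<Longrightarrow> wirt (\<lambda>z. cnj (f z)) 0 (cnj (deriv f z)) z"
  using wirt_cnj[OF wirt_hol] by simp

lemma wirt_add: "wirt f a b z \<Longrightarrow> wirt g c d z \<Longrightarrow> wirt (\<lambda>z. f z + g z) (a + c) (b + d) z"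
  unfolding wirt_def by (drule (1) has_derivative_add) (simp add: algebra_simps)

lemma wirt_minus: "wirt f a b z \<Longrightarrow> wirt (\<lambda>z. - f z) (- a) (- b) z"
  unfolding wirt_def by (drule has_derivative_minus) (simp add: algebra_simps)

lemma wirt_diff: "wirt f a b z \<Longrightarrow> wirt g c d z \<Longrightarrow> wirt (\<lambda>z. f z - g z) (a - c) (b - d) z"
  using wirt_add[OF _ wirt_minus, of f a b z g c d] by simp

lemma wirt_mult:
  "wirt f a b z \<Longrightarrow> wirt g c d z \<Longrightarrow> wirt (\<lambda>z. f z * g z) (a * g z + f z * c) (b * g z + f z * d) z"
  unfolding wirt_def by (drule (1) has_derivative_mult) (simp add: algebra_simps)

lemma wirt_cmult: "wirt f a b z \<Longrightarrow> wirt (\<lambda>z. c * f z) (c * a) (c * b) z"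
  using wirt_mult[OF wirt_const, of f a b z c] by simp

lemma wirt_inverse:
  assumes "wirt f a b z" "f z \<noteq> 0"
  shows "wirt (\<lambda>z. inverse (f z)) (- a / (f z)\<^sup>2) (- b / (f z)\<^sup>2) z"
proof -
  have "((\<lambda>w. inverse (f w)) has_derivative (\<lambda>h. - (inverse (f z) ^ 2) * (a * h + b * cnj h))) (at z)"
    using has_derivative_compose[OF assms(1)[unfolded wirt_def]
        has_field_derivative_imp_has_derivative[OF DERIV_inverse[OF assms(2)]]]
    by (simp add: numeral_2_eq_2)
  then show ?thesis
    unfolding wirt_def by (rule has_derivative_eq_rhs) (auto simp: field_simps assms(2))
qed

lemma wirt_cong:
  assumes "wirt f a b z" "open U" "z \<in> U" "\<And>w. w \<in> U \<Longrightarrow> f w = g w"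
  shows "wirt g a b z"
  using assms has_derivative_transform_within_open unfolding wirt_def by blast

lemma wirt_rewrite: "wirt f a b z \<Longrightarrow> a = c \<Longrightarrow> b = d \<Longrightarrow> wirt f c d z"
  by simp

lemma wirt_pd:
  assumes "wirt f a b z"
  shows "f differentiable (at z)" "pd 1 f z = a + b" "pd 2 f z = \<i> * (a - b)"
  using assms pd_unique[of f "\<lambda>h. a * h + b * cnj h" z] unfolding wirt_def
  by (auto simp: differentiable_def algebra_simps)

lemma pd_wirt:
  assumes "f differentiable (at z)"
  shows "wirt f ((pd 1 f z - \<i> * pd 2 f z) / 2) ((pd 1 f z + \<i> * pd 2 f z) / 2) z"
proof -
  have "Re h *\<^sub>R pd 1 f z + Im h *\<^sub>R pd 2 f z =
      (pd 1 f z - \<i> * pd 2 f z) / 2 * h + (pd 1 f z + \<i> * pd 2 f z) / 2 * cnj h" for h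
    by (simp add: complex_eq_iff field_simps)
  then show ?thesis using has_derivative_pd[OF assms] unfolding wirt_def by simp
qed

text \<open>For a real function the two coefficients are conjugate to each other, so it suffices to
  keep track of the derivative in t.\<close>

lemma wirt_real:
  fixes r :: "complex \<Rightarrow> real"
  assumes "wirt (\<lambda>z. of_real (r z)) a b z"
  shows "r differentiable (at z)" "pd 1 r z = 2 * Re a" "pd 2 r z = - 2 * Im a" "b = cnj a"
proof -
  have *: "(r has_derivative (\<lambda>h. Re (a * h + b * cnj h))) (at z)"
    using bounded_linear.has_derivative[OF bounded_linear_Re assms[unfolded wirt_def]] by simp
  have "((\<lambda>z. 0) has_derivative (\<lambda>h. Im (a * h + b * cnj h))) (at z)"
    using bounded_linear.has_derivative[OF bounded_linear_Im assms[unfolded wirt_def]] by simp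
  then have "(\<lambda>h. Im (a * h + b * cnj h)) = (\<lambda>h. 0)"
    using has_derivative_unique has_derivative_const by blast
  from fun_cong[OF this, of 1] fun_cong[OF this, of \<i>]
  show b: "b = cnj a" by (simp add: complex_eq_iff)
  show "r differentiable (at z)" using * unfolding differentiable_def by blast
  show "pd 1 r z = 2 * Re a" "pd 2 r z = - 2 * Im a"
    using pd_unique[OF *] b by simp_all
qed

lemma real_wirt:
  fixes r :: "complex \<Rightarrow> real"
  assumes "r differentiable (at z)"
  shows "wirt (\<lambda>z. of_real (r z)) (Complex (pd 1 r z / 2) (- pd 2 r z / 2)) (Complex (pd 1 r z / 2) (pd 2 r z / 2)) z"
proof -
  have "complex_of_real (Re h *\<^sub>R pd 1 r z + Im h *\<^sub>R pd 2 r z) =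
      Complex (pd 1 r z / 2) (- pd 2 r z / 2) * h + Complex (pd 1 r z / 2) (pd 2 r z / 2) * cnj h" for h
    by (simp add: complex_eq_iff algebra_simps)
  then show ?thesis
    using bounded_linear.has_derivative[OF bounded_linear_of_real has_derivative_pd[OF assms], where ?'a2=complex]
    unfolding wirt_def by simp
qed

lemma wirt_chain_real:
  fixes r :: "complex \<Rightarrow> real"
  assumes "wirt (\<lambda>z. of_real (r z)) a b z" "(h has_real_derivative h') (at (r z))"
  shows "wirt (\<lambda>z. of_real (h (r z))) (of_real h' * a) (of_real h' * b) z"
proof -
  note r = wirt_real[OF assms(1)]
  have d: "(\<lambda>z. h (r z)) differentiable (at z)"
    using pd_chain(1)[OF r(1) assms(2)] unfolding differentiable_def by blast
  show ?thesis
    by (rule wirt_rewrite[OF real_wirt[OF d]])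
       (simp_all add: pd_chain(2)[OF r(1) assms(2)] r complex_eq_iff)
qed

text \<open>The Laplacian is four times d/dt-bar d/dt: \<open>p\<close> is the derivative in t near
  z, and \<open>b\<close> is the derivative of \<open>p\<close> in the conjugate variable.\<close>

lemma laplacian_wirt:
  fixes r :: "complex \<Rightarrow> real"
  assumes "open U" "\<And>z. z \<in> U \<Longrightarrow> wirt (\<lambda>z. of_real (r z)) (p z) (q z) z" "z \<in> U" "wirt p a b z"
  shows "laplacian r z = 4 * Re b"
proof -
  note d = wirt_pd[OF assms(4)]
  have lin: "bounded_linear (\<lambda>w. 2 * Re w)" "bounded_linear (\<lambda>w. - 2 * Im w)"
    by (intro bounded_linear_const_mult bounded_linear_Re bounded_linear_Im)+
  have "pd 1 (pd 1 r) z = pd 1 (\<lambda>w. 2 * Re (p w)) z"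
    by (rule pd_cong_open[OF assms(1,3)]) (rule wirt_real(2)[OF assms(2)])
  also have "\<dots> = 2 * Re (a + b)" using pd_linear[OF lin(1) d(1)] d by simp
  finally have 1: "pd 1 (pd 1 r) z = 2 * Re (a + b)" .
  have "pd 2 (pd 2 r) z = pd 2 (\<lambda>w. - 2 * Im (p w)) z"
    by (rule pd_cong_open[OF assms(1,3)]) (rule wirt_real(3)[OF assms(2)])
  also have "\<dots> = - 2 * Im (\<i> * (a - b))" using pd_linear[OF lin(2) d(1)] d by simp
  finally show ?thesis using 1 by (simp add: laplacian_def)
qed

lemma holomorphic_wirt:
  assumes "\<And>z. z \<in> U \<Longrightarrow> wirt f (f' z) 0 z"
  shows "f holomorphic_on U" "z \<in> U \<Longrightarrow> deriv f z = f' z"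
proof -
  have *: "(f has_field_derivative f' z) (at z)" if "z \<in> U" for z
    using assms[OF that] by (simp add: wirt_def has_field_derivative_def)
  show "f holomorphic_on U"
    unfolding holomorphic_on_def
    using * field_differentiable_def field_differentiable_at_within by blast
  show "z \<in> U \<Longrightarrow> deriv f z = f' z" using * DERIV_imp_deriv by blast
qed

text \<open>Poincare lemma on a disc. The primitive is the integral of the form along the segment
  from 0 to z. Closedness turns the z-derivative of the integrand into a total derivative in the
  segment parameter.\<close>

lemma poincare_ball:
  fixes P Q :: "complex \<Rightarrow> complex"
  assumes C: "Ck_on 1 P (ball 0 r)" "Ck_on 1 Q (ball 0 r)"
    and closed: "\<And>z. z \<in> ball 0 r \<Longrightarrow> pd 2 P z = pd 1 Q z"
  obtains G where "\<And>z. z \<in> ball 0 r \<Longrightarrow> (G has_derivative (\<lambda>h. Re h *\<^sub>R P z + Im h *\<^sub>R Q z)) (at z)"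
proof -
  let ?B = "ball (0::complex) r"
  have dP: "\<And>z. z \<in> ?B \<Longrightarrow> P differentiable (at z)" and dQ: "\<And>z. z \<in> ?B \<Longrightarrow> Q differentiable (at z)"
    and cP': "\<And>i. continuous_on ?B (pd i P)" and cQ': "\<And>i. continuous_on ?B (pd i Q)"
    using C by auto
  have cP: "continuous_on ?B P" and cQ: "continuous_on ?B Q" using C Ck_on_continuous by blast+
  have tB: "t *\<^sub>R z \<in> ?B" if "z \<in> ?B" "t \<in> cbox 0 (1::real)" for t z
  proof -
    have "\<bar>t\<bar> * norm z \<le> 1 * norm z" using that by (intro mult_right_mono) auto
    then show ?thesis using that by auto
  qed
  define f where "f = (\<lambda>z t. Re z *\<^sub>R P (t *\<^sub>R z) + Im z *\<^sub>R Q (t *\<^sub>R z))"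
  \<comment> \<open>Derivative of \<open>f z t\<close> in z, in the direction h.\<close>
  define L where "L = (\<lambda>z t h. Re h *\<^sub>R P (t *\<^sub>R z) + Im h *\<^sub>R Q (t *\<^sub>R z)
     + Re z *\<^sub>R (Re (t *\<^sub>R h) *\<^sub>R pd 1 P (t *\<^sub>R z) + Im (t *\<^sub>R h) *\<^sub>R pd 2 P (t *\<^sub>R z))
     + Im z *\<^sub>R (Re (t *\<^sub>R h) *\<^sub>R pd 1 Q (t *\<^sub>R z) + Im (t *\<^sub>R h) *\<^sub>R pd 2 Q (t *\<^sub>R z)))"
  have bl: "bounded_linear (L z t)" for z t
    unfolding L_def
    by (intro bounded_linear_add bounded_linear_scaleR_const bounded_linear_Re bounded_linear_Im
        bounded_linear_const_scaleR bounded_linear_compose[OF bounded_linear_Re bounded_linear_scaleR_right]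
        bounded_linear_compose[OF bounded_linear_Im bounded_linear_scaleR_right]
        bounded_linear_compose[OF bounded_linear_scaleR_right])
  have Lder: "((\<lambda>z. f z t) has_derivative L z t) (at z within ?B)" if "z \<in> ?B" "t \<in> cbox 0 1" for z t
  proof -
    have s: "((\<lambda>z. t *\<^sub>R z) has_derivative (\<lambda>h. t *\<^sub>R h)) (at z)" by (auto intro!: derivative_eq_intros)
    note p = has_derivative_compose[OF s has_derivative_pd[OF dP[OF tB[OF that]]]]
    note q = has_derivative_compose[OF s has_derivative_pd[OF dQ[OF tB[OF that]]]]
    have "((\<lambda>z. f z t) has_derivative L z t) (at z)"
      unfolding f_def L_def
      by (rule has_derivative_eq_rhs, rule has_derivative_add,
          rule has_derivative_scaleR[OF bounded_linear.has_derivative[OF bounded_linear_Re has_derivative_ident] p],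
          rule has_derivative_scaleR[OF bounded_linear.has_derivative[OF bounded_linear_Im has_derivative_ident] q])
         (auto simp: algebra_simps)
    then show ?thesis by (rule has_derivative_at_withinI)
  qed
  \<comment> \<open>Differentiation under the integral asks for the derivative as a bounded linear
    map that is jointly continuous in z and t.\<close>
  define fx where "fx = (\<lambda>z t. Blinfun (L z t))"
  have fx: "blinfun_apply (fx z t) = L z t" for z t
    unfolding fx_def by (rule bounded_linear_Blinfun_apply[OF bl])
  have sub: "(\<lambda>x. snd x *\<^sub>R fst x) ` (?B \<times> cbox 0 1) \<subseteq> ?B" using tB by auto
  have cc: "continuous_on (?B \<times> cbox 0 1) (\<lambda>x. F (snd x *\<^sub>R fst x))" if "continuous_on ?B F"
    for F :: "complex \<Rightarrow> complex"
    by (rule continuous_on_compose2[OF that _ sub]) (intro continuous_intros)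
  have cfx: "continuous_on (?B \<times> cbox 0 1) (\<lambda>(z, t). fx z t)"
    unfolding case_prod_unfold
    by (rule continuous_on_blinfun_componentwise, unfold fx L_def)
       (intro continuous_intros cc cP cQ cP' cQ')
  have int: "f z integrable_on cbox 0 1" if "z \<in> ?B" for z
  proof (rule integrable_continuous)
    have "(\<lambda>t. t *\<^sub>R z) ` cbox 0 1 \<subseteq> ?B" using tB[OF that] by auto
    then have "continuous_on (cbox 0 1) (\<lambda>t. F (t *\<^sub>R z))" if "continuous_on ?B F" for F :: "complex \<Rightarrow> complex"
      by (intro continuous_on_compose2[OF that]) (auto intro!: continuous_intros)
    then show "continuous_on (cbox 0 1) (f z)" unfolding f_def by (intro continuous_intros) (use cP cQ in auto)
  qed
  show ?thesis
  proof (rule that)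
    fix z assume z: "z \<in> ?B"
    have c1: "continuous_on (cbox 0 1) (fx z)"
    proof -
      have "continuous_on (cbox 0 1) (\<lambda>t. (\<lambda>(z, t). fx z t) (z, t))"
        by (rule continuous_on_compose2[OF cfx]) (use z in \<open>auto intro!: continuous_intros\<close>)
      then show ?thesis by simp
    qed
    have app: "blinfun_apply (integral (cbox 0 1) (fx z)) h = Re h *\<^sub>R P z + Im h *\<^sub>R Q z" for h
    proof -
      have "blinfun_apply (integral (cbox 0 1) (fx z)) h = integral (cbox 0 1) (\<lambda>t. L z t h)"
        using blinfun_apply_integral[OF integrable_continuous[OF c1], of h] fx by simp
      \<comment> \<open>By closedness \<open>L z t h\<close> is the t-derivative of t (Re h P(tz) +
        Im h Q(tz)), so its integral is the value of this product at t = 1.\<close>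
      also have "((\<lambda>t. L z t h) has_integral
          1 *\<^sub>R (Re h *\<^sub>R P (1 *\<^sub>R z) + Im h *\<^sub>R Q (1 *\<^sub>R z)) - 0 *\<^sub>R (Re h *\<^sub>R P (0 *\<^sub>R z) + Im h *\<^sub>R Q (0 *\<^sub>R z)))
          {0..1}"
      proof (rule fundamental_theorem_of_calculus)
        fix t :: real assume t: "t \<in> {0..1}"
        then have tz: "t *\<^sub>R z \<in> ?B" using tB[OF z, of t] by simp
        have s: "((\<lambda>t. t *\<^sub>R z) has_derivative (\<lambda>s. s *\<^sub>R z)) (at t)" by (auto intro!: derivative_eq_intros)
        note p = has_derivative_compose[OF s has_derivative_pd[OF dP[OF tz]]]
        note q = has_derivative_compose[OF s has_derivative_pd[OF dQ[OF tz]]]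
        have "((\<lambda>t. t *\<^sub>R (Re h *\<^sub>R P (t *\<^sub>R z) + Im h *\<^sub>R Q (t *\<^sub>R z))) has_derivative (\<lambda>s. s *\<^sub>R L z t h)) (at t)"
          by (rule has_derivative_eq_rhs, rule has_derivative_scaleR[OF has_derivative_ident],
              rule has_derivative_add, rule has_derivative_scaleR_right[OF p], rule has_derivative_scaleR_right[OF q])
             (auto simp: L_def algebra_simps closed[OF tz])
        then show "((\<lambda>t. t *\<^sub>R (Re h *\<^sub>R P (t *\<^sub>R z) + Im h *\<^sub>R Q (t *\<^sub>R z))) has_vector_derivative L z t h) (at t within {0..1})"
          by (simp add: has_vector_derivative_def has_derivative_at_withinI)
      qed simp
      then have "integral (cbox 0 1) (\<lambda>t. L z t h) = Re h *\<^sub>R P z + Im h *\<^sub>R Q z"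
        by (simp add: integral_unique)
      finally show ?thesis .
    qed
    have "((\<lambda>z. integral (cbox 0 1) (f z)) has_derivative blinfun_apply (integral (cbox 0 1) (fx z))) (at z within ?B)"
      by (rule leibniz_rule[OF _ int cfx z convex_ball]) (use Lder fx in auto)
    then have "((\<lambda>z. integral (cbox 0 1) (f z)) has_derivative (\<lambda>h. Re h *\<^sub>R P z + Im h *\<^sub>R Q z)) (at z within ?B)"
      by (rule has_derivative_eq_rhs) (rule ext, rule app)
    then show "((\<lambda>z. integral (cbox 0 1) (f z)) has_derivative (\<lambda>h. Re h *\<^sub>R P z + Im h *\<^sub>R Q z)) (at z)"
      using z at_within_open[OF z] by simp
  qed
qed

section \<open>The linear equation \<open>y'' = -S y\<close>\<close>

text \<open>Taylor coefficients at 0 of the solution of y'' = -S y with y(0) = a and y'(0) = b,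
  where s lists the coefficients of S: the recursion compares the coefficients of t^n.\<close>

fun ode_coeff :: "(nat \<Rightarrow> complex) \<Rightarrow> complex \<Rightarrow> complex \<Rightarrow> nat \<Rightarrow> complex" where
  "ode_coeff s a b 0 = a"
| "ode_coeff s a b (Suc 0) = b"
| "ode_coeff s a b (Suc (Suc n)) =
     - (\<Sum>k=0..n. s k * ode_coeff s a b (n - k)) / (of_nat (Suc n) * of_nat (Suc (Suc n)))"

text \<open>At a radius \<rho> inside the disc of convergence the terms of the series are bounded by
  some M, and R = 1/\<rho>.\<close>

lemma fps_coeff_bound:
  assumes "fps_conv_radius (F :: complex fps) > 0"
  obtains M R where "M > 0" "R > 0" "\<And>n. norm (fps_nth F n) \<le> M * R ^ n"
proof -
  obtain \<rho> :: real where \<rho>: "\<rho> > 0" "ereal \<rho> < fps_conv_radius F"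
    using ereal_dense2[OF assms] by (metis ereal_less(2) less_ereal.simps(1) zero_ereal_def)
  have "summable (\<lambda>n. norm (fps_nth F n * of_real \<rho> ^ n))"
    by (rule norm_summable_fps) (use \<rho> in auto)
  then have "Bseq (\<lambda>n. norm (fps_nth F n * of_real \<rho> ^ n))"
    by (intro convergent_imp_Bseq) (auto simp: convergent_def dest: summable_LIMSEQ_zero)
  then obtain M where M: "M > 0" "\<And>n. norm (fps_nth F n * of_real \<rho> ^ n) \<le> M"
    unfolding Bseq_def by auto
  show ?thesis
  proof (rule that[of M "1/\<rho>"])
    show "norm (fps_nth F n) \<le> M * (1 / \<rho>) ^ n" for n
      using M(2)[of n] \<rho> by (simp add: norm_mult norm_power field_simps)
  qed (use M \<rho> in auto)
qed

text \<open>A geometric majorant. The sum in the recursion has m + 1 terms, each at most M C Q^m,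
  and the denominator (m + 1)(m + 2) absorbs their number. \<open>Q\<close> is at least R, 1 and M,
  so M \<le> Q^2 pays for the step from exponent m to m + 2.\<close>

lemma ode_coeff_bound:
  assumes s: "\<And>k. norm (s k) \<le> M * R ^ k" and "M > 0" "R > 0"
  obtains C Q where "Q > 0" "\<And>n. norm (ode_coeff s a b n) \<le> C * Q ^ n"
proof -
  define Q where "Q = max R (max 1 M)"
  define C where "C = norm a + norm b"
  have Q: "Q \<ge> R" "Q \<ge> 1" "Q \<ge> M" by (auto simp: Q_def)
  have C: "C \<ge> 0" by (simp add: C_def)
  have MQ: "M \<le> Q * Q" using Q mult_mono[of 1 Q M Q] assms(2) by simp
  have "norm (ode_coeff s a b n) \<le> C * Q ^ n" for n
  proof (induction n rule: less_induct)
    case (less n)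
    consider "n = 0" | "n = Suc 0" | m where "n = Suc (Suc m)" by (metis not0_implies_Suc)
    then show ?case
    proof cases
      case 1 then show ?thesis by (simp add: C_def)
    next
      case 2
      have "norm b * 1 \<le> C * Q" using Q C by (intro mult_mono) (auto simp: C_def)
      then show ?thesis using 2 by simp
    next
      case 3
      have "norm (\<Sum>k=0..m. s k * ode_coeff s a b (m - k)) \<le> (\<Sum>k=0..m. M * C * Q ^ m)"
      proof (rule sum_norm_le)
        fix k assume k: "k \<in> {0..m}"
        have "norm (s k * ode_coeff s a b (m - k)) \<le> (M * Q ^ k) * (C * Q ^ (m - k))"
          unfolding norm_mult
        proof (rule mult_mono)
          have "R ^ k \<le> Q ^ k" using Q assms by (intro power_mono) auto
          then show "norm (s k) \<le> M * Q ^ k"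
            using s[of k] assms by (meson mult_left_mono less_imp_le order_trans)
          show "norm (ode_coeff s a b (m - k)) \<le> C * Q ^ (m - k)" using less.IH 3 by auto
        qed (use Q assms in auto)
        also have "\<dots> = M * C * (Q ^ k * Q ^ (m - k))" by simp
        also have "Q ^ k * Q ^ (m - k) = Q ^ m" using k by (simp add: power_add[symmetric])
        finally show "norm (s k * ode_coeff s a b (m - k)) \<le> M * C * Q ^ m" .
      qed
      then have *: "norm (\<Sum>k=0..m. s k * ode_coeff s a b (m - k)) \<le> real (Suc m) * (M * C * Q ^ m)" by simp
      have "norm (ode_coeff s a b n) =
          norm (\<Sum>k=0..m. s k * ode_coeff s a b (m - k)) / (real (Suc m) * real (Suc (Suc m)))"
        unfolding 3 ode_coeff.simps norm_divide norm_mult norm_minus_cancel norm_of_nat ..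
      also have "\<dots> \<le> real (Suc m) * (M * C * Q ^ m) / (real (Suc m) * real (Suc (Suc m)))"
        by (rule divide_right_mono[OF *]) simp
      also have "\<dots> = M * C * Q ^ m / real (Suc (Suc m))" by (simp del: of_nat_Suc)
      also have "\<dots> \<le> M * C * Q ^ m / 1"
        by (rule divide_left_mono) (use assms C Q in auto)
      also have "\<dots> \<le> (Q * Q) * C * Q ^ m"
        using MQ C Q by (auto intro!: mult_right_mono)
      finally show ?thesis using 3 by (simp add: mult_ac)
    qed
  qed
  then show ?thesis using that[of Q C] Q by auto
qed

lemma linear_ode_solution:
  assumes "S holomorphic_on ball 0 r" "r > 0"
  obtains y \<rho> where "0 < \<rho>" "\<rho> \<le> r" "y holomorphic_on ball 0 \<rho>" "y 0 = a" "deriv y 0 = b"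
    "\<And>z. z \<in> ball 0 \<rho> \<Longrightarrow> deriv (deriv y) z = - S z * y z"
proof -
  define F where "F = fps_expansion S 0"
  have exp: "S has_fps_expansion F"
    unfolding F_def by (rule has_fps_expansion_fps_expansion[OF open_ball _ assms(1)]) (use assms in auto)
  then have rF: "fps_conv_radius F > 0" and ev: "eventually (\<lambda>z. eval_fps F z = S z) (nhds 0)"
    unfolding has_fps_expansion_def by auto
  obtain M R where MR: "M > 0" "R > 0" "\<And>n. norm (fps_nth F n) \<le> M * R ^ n"
    using fps_coeff_bound[OF rF] by blast
  obtain C Q where CQ: "Q > 0" "\<And>n. norm (ode_coeff (fps_nth F) a b n) \<le> C * Q ^ n"
    using ode_coeff_bound[OF MR(3,1,2)] by blast
  define Y where "Y = Abs_fps (ode_coeff (fps_nth F) a b)"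
  have Y: "fps_deriv (fps_deriv Y) = - F * Y"
  proof (rule fps_ext)
    fix n
    have "fps_nth (fps_deriv (fps_deriv Y)) n =
       of_nat (Suc n) * of_nat (Suc (Suc n)) * ode_coeff (fps_nth F) a b (Suc (Suc n))"
      by (simp add: Y_def mult_ac)
    also have "\<dots> = - (\<Sum>k=0..n. fps_nth F k * ode_coeff (fps_nth F) a b (n - k))"
      by (simp del: of_nat_Suc)
    also have "\<dots> = fps_nth (- F * Y) n"
      by (simp add: Y_def fps_mult_nth sum_negf)
    finally show "fps_nth (fps_deriv (fps_deriv Y)) n = fps_nth (- F * Y) n" .
  qed
  have rY: "fps_conv_radius Y \<ge> ereal (1 / (2 * Q))"
    unfolding fps_conv_radius_def
  proof (rule conv_radius_geI_ex')
    fix \<rho> :: real assume \<rho>: "0 < \<rho>" "ereal \<rho> < ereal (1 / (2 * Q))"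
    have "summable (\<lambda>n. C * (1/2) ^ n :: real)" by (intro summable_mult summable_geometric) auto
    then show "summable (\<lambda>n. fps_nth Y n * of_real \<rho> ^ n)"
    proof (rule summable_comparison_test'[where N = 0])
      fix n :: nat
      have "norm (fps_nth Y n * of_real \<rho> ^ n) = norm (ode_coeff (fps_nth F) a b n) * \<rho> ^ n"
        using \<rho> by (simp add: Y_def norm_mult norm_power)
      also have "\<dots> \<le> (C * Q ^ n) * (1 / (2 * Q)) ^ n"
        using CQ(2)[of n] \<rho> by (intro mult_mono power_mono order_trans[OF norm_ge_zero CQ(2)]) auto
      also have "\<dots> = C * (1/2) ^ n" using CQ by (simp add: power_divide power_mult_distrib)
      finally show "norm (fps_nth Y n * of_real \<rho> ^ n) \<le> C * (1/2) ^ n" .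
    qed
  qed
  have posQ: "0 < 1 / (2 * Q)" using CQ by simp
  obtain d where d: "d > 0" "\<And>z. dist z 0 < d \<Longrightarrow> eval_fps F z = S z"
    using ev unfolding eventually_nhds_metric by auto
  obtain \<rho>F :: real where \<rho>F: "\<rho>F > 0" "ereal \<rho>F < fps_conv_radius F"
    using ereal_dense2[OF rF] by (metis ereal_less(2) less_ereal.simps(1) zero_ereal_def)
  \<comment> \<open>On this disc the series of S converges and sums to S. Up to radius 1/(2Q) the
    solution series is dominated by a geometric series of ratio 1/2.\<close>
  define \<rho> where "\<rho> = min r (min d (min \<rho>F (1 / (2 * Q))))"
  have \<rho>: "\<rho> > 0" "\<rho> \<le> r" "\<rho> \<le> d" "\<rho> \<le> \<rho>F" "\<rho> \<le> 1 / (2 * Q)"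
    using assms d \<rho>F posQ by (auto simp: \<rho>_def)
  have inY: "ereal (norm z) < fps_conv_radius Y" and inF: "ereal (norm z) < fps_conv_radius F" if "z \<in> ball 0 \<rho>" for z :: complex
  proof -
    have "ereal (norm z) < ereal (1 / (2 * Q))" "ereal (norm z) < ereal \<rho>F" using that \<rho> by auto
    then show "ereal (norm z) < fps_conv_radius Y" "ereal (norm z) < fps_conv_radius F"
      using less_le_trans[OF _ rY] order.strict_trans[OF _ \<rho>F(2)] by blast+
  qed
  let ?y = "eval_fps Y"
  have d1: "deriv ?y z = eval_fps (fps_deriv Y) z" if "z \<in> ball 0 \<rho>" for z
    using eval_fps_deriv[OF inY[OF that]] by simp
  have inY': "ereal (norm z) < fps_conv_radius (fps_deriv Y)" if "z \<in> ball 0 \<rho>" for z :: complex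
    using inY[OF that] fps_conv_radius_deriv[of Y] by (simp add: less_le_trans)
  show ?thesis
  proof (rule that[of \<rho> ?y])
    show "0 < \<rho>" "\<rho> \<le> r" using \<rho> by auto
    show "?y holomorphic_on ball 0 \<rho>"
      by (intro holomorphic_on_eval_fps) (use inY in \<open>auto simp: in_eball_iff\<close>)
    show "?y 0 = a" by (simp add: eval_fps_at_0 Y_def)
    show "deriv ?y 0 = b" using d1[of 0] \<rho> by (simp add: eval_fps_at_0 Y_def)
    fix z :: complex assume z: "z \<in> ball 0 \<rho>"
    have "deriv (deriv ?y) z = deriv (eval_fps (fps_deriv Y)) z"
      by (rule complex_derivative_transform_within_open[of _ "ball 0 \<rho>"])
         (use d1 z inY inY' in \<open>auto intro!: holomorphic_intros\<close>)
    also have "\<dots> = eval_fps (- F * Y) z" using eval_fps_deriv[OF inY'[OF z]] Y by simp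
    also have "\<dots> = - S z * ?y z"
      using eval_fps_mult[OF _ inY[OF z], of "- F"] inF[OF z] d(2)[of z] \<rho> z
      by (simp add: eval_fps_minus)
    finally show "deriv (deriv ?y) z = - S z * ?y z" .
  qed
qed

section \<open>The Liouville equation\<close>

text \<open>A meromorphic function \<open>g\<close> with \<open>g' \<noteq> 0\<close> is encoded by the pair
  \<open>y\<^sub>1 = g / \<surd>g'\<close>, \<open>y\<^sub>2 = 1 / \<surd>g'\<close> of Wronskian 1.\<close>

definition wpair :: "complex set \<Rightarrow> (complex \<Rightarrow> complex) \<Rightarrow> (complex \<Rightarrow> complex) \<Rightarrow> bool" where
  "wpair U y\<^sub>1 y\<^sub>2 \<longleftrightarrow> open U \<and> y\<^sub>1 holomorphic_on U \<and> y\<^sub>2 holomorphic_on U \<and>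
     (\<forall>z\<in>U. deriv y\<^sub>1 z * y\<^sub>2 z - y\<^sub>1 z * deriv y\<^sub>2 z = 1)"

text \<open>For g = y1/y2 this is |y2|^2 (1 - |g|^2), so for a pair of Wronskian 1 its absolute
  value is the reciprocal of the hyperbolic density of g. As a Hermitian form of signature (1,1) in
  (y1, y2) it makes sense at poles of g as well.\<close>

definition pform :: "(complex \<Rightarrow> complex) \<Rightarrow> (complex \<Rightarrow> complex) \<Rightarrow> complex \<Rightarrow> real" where
  "pform y\<^sub>1 y\<^sub>2 z = (cmod (y\<^sub>2 z))\<^sup>2 - (cmod (y\<^sub>1 z))\<^sup>2"

lemma of_real_pform: "complex_of_real (pform y\<^sub>1 y\<^sub>2 z) = y\<^sub>2 z * cnj (y\<^sub>2 z) - y\<^sub>1 z * cnj (y\<^sub>1 z)"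
  unfolding pform_def of_real_diff complex_norm_square ..

lemma wirt_pform:
  assumes "y\<^sub>1 holomorphic_on U" "y\<^sub>2 holomorphic_on U" "open U" "z \<in> U"
  shows "wirt (\<lambda>z. of_real (pform y\<^sub>1 y\<^sub>2 z)) (deriv y\<^sub>2 z * cnj (y\<^sub>2 z) - deriv y\<^sub>1 z * cnj (y\<^sub>1 z))
           (y\<^sub>2 z * cnj (deriv y\<^sub>2 z) - y\<^sub>1 z * cnj (deriv y\<^sub>1 z)) z"
  unfolding of_real_pform
  by (rule wirt_rewrite[OF wirt_diff[OF wirt_mult[OF wirt_hol wirt_cnj_hol] wirt_mult[OF wirt_hol wirt_cnj_hol]]])
     (use assms in auto)

lemma wirt_pform_t:
  assumes "y\<^sub>1 holomorphic_on U" "y\<^sub>2 holomorphic_on U" "open U" "z \<in> U"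
  shows "wirt (\<lambda>z. deriv y\<^sub>2 z * cnj (y\<^sub>2 z) - deriv y\<^sub>1 z * cnj (y\<^sub>1 z))
           (deriv (deriv y\<^sub>2) z * cnj (y\<^sub>2 z) - deriv (deriv y\<^sub>1) z * cnj (y\<^sub>1 z))
           (deriv y\<^sub>2 z * cnj (deriv y\<^sub>2 z) - deriv y\<^sub>1 z * cnj (deriv y\<^sub>1 z)) z"
  by (rule wirt_rewrite[OF wirt_diff[OF wirt_mult[OF wirt_hol wirt_cnj_hol] wirt_mult[OF wirt_hol wirt_cnj_hol]]])
     (use assms in \<open>auto intro: holomorphic_deriv\<close>)

text \<open>Write F for \<open>pform\<close> and T for the conjugate variable. The Laplacian of ln F
  is 4 (F F_tT - F_t F_T) / F^2, and by an identity of Lagrange type the numerator in parentheses is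
  minus the squared modulus of the Wronskian. The sign \<sigma> makes the argument of the logarithm
  positive.\<close>

lemma laplacian_ln_pform:
  assumes "wpair U y\<^sub>1 y\<^sub>2" "\<sigma>\<^sup>2 = 1" "\<And>z. z \<in> U \<Longrightarrow> \<sigma> * pform y\<^sub>1 y\<^sub>2 z > 0" "z \<in> U"
  shows "laplacian (\<lambda>z. ln (\<sigma> * pform y\<^sub>1 y\<^sub>2 z)) z = - 4 / (pform y\<^sub>1 y\<^sub>2 z)\<^sup>2"
proof -
  have U: "open U" "y\<^sub>1 holomorphic_on U" "y\<^sub>2 holomorphic_on U"
    and W: "deriv y\<^sub>1 z * y\<^sub>2 z - y\<^sub>1 z * deriv y\<^sub>2 z = 1" using assms by (auto simp: wpair_def)
  have ne: "pform y\<^sub>1 y\<^sub>2 w \<noteq> 0" if "w \<in> U" for w using assms(3)[OF that] by auto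
  let ?p = "\<lambda>z. deriv y\<^sub>2 z * cnj (y\<^sub>2 z) - deriv y\<^sub>1 z * cnj (y\<^sub>1 z)"
  let ?q = "\<lambda>z. y\<^sub>2 z * cnj (deriv y\<^sub>2 z) - y\<^sub>1 z * cnj (deriv y\<^sub>1 z)"
  let ?F = "\<lambda>z. complex_of_real (pform y\<^sub>1 y\<^sub>2 z)"
  have 1: "wirt (\<lambda>z. of_real (ln (\<sigma> * pform y\<^sub>1 y\<^sub>2 z))) (inverse (?F w) * ?p w) (inverse (?F w) * ?q w) w"
    if w: "w \<in> U" for w
  proof -
    have "wirt (\<lambda>z. of_real (\<sigma> * pform y\<^sub>1 y\<^sub>2 z)) (of_real \<sigma> * ?p w) (of_real \<sigma> * ?q w) w"
      using wirt_cmult[OF wirt_pform[OF U(2,3,1) w], of "of_real \<sigma>"] by simp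
    from wirt_chain_real[OF this DERIV_ln[OF assms(3)[OF w]]]
    show ?thesis
      by (rule wirt_rewrite) (use assms(2) in \<open>auto simp: power2_eq_1_iff\<close>)
  qed
  have "wirt (\<lambda>z. inverse (?F z) * ?p z)
     (- ?p z / (?F z)\<^sup>2 * ?p z + inverse (?F z) * (deriv (deriv y\<^sub>2) z * cnj (y\<^sub>2 z) - deriv (deriv y\<^sub>1) z * cnj (y\<^sub>1 z)))
     (- ?q z / (?F z)\<^sup>2 * ?p z + inverse (?F z) * (deriv y\<^sub>2 z * cnj (deriv y\<^sub>2 z) - deriv y\<^sub>1 z * cnj (deriv y\<^sub>1 z))) z"
    by (rule wirt_mult[OF wirt_inverse[OF wirt_pform[OF U(2,3,1) assms(4)]] wirt_pform_t[OF U(2,3,1) assms(4)]])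
       (use ne[OF assms(4)] in simp)
  from laplacian_wirt[OF U(1) 1 assms(4) this]
  have L: "laplacian (\<lambda>z. ln (\<sigma> * pform y\<^sub>1 y\<^sub>2 z)) z =
     4 * Re (- ?q z / (?F z)\<^sup>2 * ?p z + inverse (?F z) * (deriv y\<^sub>2 z * cnj (deriv y\<^sub>2 z) - deriv y\<^sub>1 z * cnj (deriv y\<^sub>1 z)))" .
  have "- ?q z / (?F z)\<^sup>2 * ?p z + inverse (?F z) * (deriv y\<^sub>2 z * cnj (deriv y\<^sub>2 z) - deriv y\<^sub>1 z * cnj (deriv y\<^sub>1 z))
     = (?F z * (deriv y\<^sub>2 z * cnj (deriv y\<^sub>2 z) - deriv y\<^sub>1 z * cnj (deriv y\<^sub>1 z)) - ?q z * ?p z) / (?F z)\<^sup>2"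
    using ne[OF assms(4)] by (simp add: field_simps power2_eq_square)
  also have "?F z * (deriv y\<^sub>2 z * cnj (deriv y\<^sub>2 z) - deriv y\<^sub>1 z * cnj (deriv y\<^sub>1 z)) - ?q z * ?p z
     = - ((deriv y\<^sub>1 z * y\<^sub>2 z - y\<^sub>1 z * deriv y\<^sub>2 z) * cnj (deriv y\<^sub>1 z * y\<^sub>2 z - y\<^sub>1 z * deriv y\<^sub>2 z))"
    unfolding of_real_pform complex_cnj_diff complex_cnj_mult by algebra
  also have "\<dots> = -1" using W by simp
  also have "- 1 / (?F z)\<^sup>2 = complex_of_real (- 1 / (pform y\<^sub>1 y\<^sub>2 z)\<^sup>2)" by simp
  finally show ?thesis unfolding L by simp
qed

section \<open>Wronskians, and uniqueness for the Liouville equation\<close>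

lemma wpair_wronskian: "wpair U y\<^sub>1 y\<^sub>2 \<Longrightarrow> z \<in> U \<Longrightarrow> deriv y\<^sub>1 z * y\<^sub>2 z - y\<^sub>1 z * deriv y\<^sub>2 z = 1"
  by (simp add: wpair_def)

text \<open>Differentiation in the conjugate variable leaves the holomorphic factors a and b alone.
  This gives a second linear equation for a(z) and b(z), and the determinant of the system is the
  conjugate of the Wronskian 1.\<close>

lemma cnj_independent:
  assumes y: "wpair U y\<^sub>1 y\<^sub>2" and ab: "a holomorphic_on U" "b holomorphic_on U"
    and eq: "\<And>z. z \<in> U \<Longrightarrow> a z * cnj (y\<^sub>1 z) + b z * cnj (y\<^sub>2 z) = 0" and z: "z \<in> U"
  shows "a z = 0" "b z = 0"
proof -
  have U: "open U" "y\<^sub>1 holomorphic_on U" "y\<^sub>2 holomorphic_on U" using y by (auto simp: wpair_def)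
  have "wirt (\<lambda>z. a z * cnj (y\<^sub>1 z) + b z * cnj (y\<^sub>2 z))
      (deriv a z * cnj (y\<^sub>1 z) + deriv b z * cnj (y\<^sub>2 z)) (a z * cnj (deriv y\<^sub>1 z) + b z * cnj (deriv y\<^sub>2 z)) z"
    by (rule wirt_rewrite[OF wirt_add[OF wirt_mult[OF wirt_hol wirt_cnj_hol] wirt_mult[OF wirt_hol wirt_cnj_hol]]])
       (use U ab z in auto)
  moreover have "wirt (\<lambda>z. a z * cnj (y\<^sub>1 z) + b z * cnj (y\<^sub>2 z)) 0 0 z"
    by (rule wirt_cong[OF wirt_const[of 0] U(1) z]) (simp add: eq)
  ultimately have e2: "a z * cnj (deriv y\<^sub>1 z) + b z * cnj (deriv y\<^sub>2 z) = 0"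
    using wirt_unique(2) by blast
  have W: "cnj (deriv y\<^sub>1 z) * cnj (y\<^sub>2 z) - cnj (y\<^sub>1 z) * cnj (deriv y\<^sub>2 z) = 1"
    using arg_cong[OF wpair_wronskian[OF y z], of cnj] by simp
  show "a z = 0" "b z = 0" using e2 eq[OF z] W by algebra+
qed

lemma hol_independent:
  assumes y: "wpair U y\<^sub>1 y\<^sub>2" and eq: "\<And>z. z \<in> U \<Longrightarrow> a * y\<^sub>1 z + b * y\<^sub>2 z = 0" and "z \<in> U"
  shows "a = 0" "b = 0"
proof -
  have "cnj a * cnj (y\<^sub>1 w) + cnj b * cnj (y\<^sub>2 w) = 0" if "w \<in> U" for w
    using arg_cong[OF eq[OF that], of cnj] by simp
  from cnj_independent[OF y _ _ this assms(3)] show "a = 0" "b = 0" by auto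
qed

lemma wronskian_constant:
  assumes "f holomorphic_on ball c r" "g holomorphic_on ball c r"
    "\<And>z. z \<in> ball c r \<Longrightarrow> deriv (deriv f) z = - S z * f z" "\<And>z. z \<in> ball c r \<Longrightarrow> deriv (deriv g) z = - S z * g z"
    and z: "z \<in> ball c r"
  shows "deriv f z * g z - f z * deriv g z = deriv f c * g c - f c * deriv g c"
proof -
  have "wirt (\<lambda>z. deriv f z * g z - f z * deriv g z) 0 0 w" if "w \<in> ball c r" for w
    by (rule wirt_rewrite[OF wirt_diff[OF wirt_mult[OF wirt_hol wirt_hol] wirt_mult[OF wirt_hol wirt_hol]]])
       (use assms that in \<open>auto intro: holomorphic_deriv\<close>)
  then have "((\<lambda>z. deriv f z * g z - f z * deriv g z) has_derivative (\<lambda>h. 0)) (at w within ball c r)"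
    if "w \<in> ball c r" for w
    using that unfolding wirt_def by (auto intro: has_derivative_at_withinI)
  from has_derivative_zero_constant[OF convex_ball this] obtain k
    where k: "\<And>w. w \<in> ball c r \<Longrightarrow> deriv f w * g w - f w * deriv g w = k" by auto
  have "c \<in> ball c r" using z by (metis centre_in_ball mem_ball zero_le_dist order.strict_trans1)
  with k z show ?thesis by simp
qed

text \<open>Cramer's rule: f is recovered from its Wronskians with y1 and y2, which are constant and
  can be evaluated at the centre.\<close>

lemma linear_ode_combination:
  assumes y: "wpair (ball c r) y\<^sub>1 y\<^sub>2" and f: "f holomorphic_on ball c r"
    and S: "\<And>z. z \<in> ball c r \<Longrightarrow> deriv (deriv f) z = - S z * f z"
      "\<And>z. z \<in> ball c r \<Longrightarrow> deriv (deriv y\<^sub>1) z = - S z * y\<^sub>1 z"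
      "\<And>z. z \<in> ball c r \<Longrightarrow> deriv (deriv y\<^sub>2) z = - S z * y\<^sub>2 z"
    and z: "z \<in> ball c r"
  shows "f z = (deriv f c * y\<^sub>2 c - f c * deriv y\<^sub>2 c) * y\<^sub>1 z - (deriv f c * y\<^sub>1 c - f c * deriv y\<^sub>1 c) * y\<^sub>2 z"
proof -
  have U: "y\<^sub>1 holomorphic_on ball c r" "y\<^sub>2 holomorphic_on ball c r" using y by (auto simp: wpair_def)
  show ?thesis
    using wronskian_constant[OF f U(1) S(1,2) z] wronskian_constant[OF f U(2) S(1,3) z] wpair_wronskian[OF y z]
    by algebra
qed

text \<open>The derivative of the constant Wronskian vanishes; hence y1 and y2 solve one common
  equation y'' = -S y.\<close>

lemma wpair_same_potential:
  assumes "wpair U y\<^sub>1 y\<^sub>2" "z \<in> U"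
  shows "deriv (deriv y\<^sub>1) z * y\<^sub>2 z = y\<^sub>1 z * deriv (deriv y\<^sub>2) z"
proof -
  have U: "open U" "y\<^sub>1 holomorphic_on U" "y\<^sub>2 holomorphic_on U" using assms by (auto simp: wpair_def)
  have "wirt (\<lambda>z. deriv y\<^sub>1 z * y\<^sub>2 z - y\<^sub>1 z * deriv y\<^sub>2 z)
      (deriv (deriv y\<^sub>1) z * y\<^sub>2 z - y\<^sub>1 z * deriv (deriv y\<^sub>2) z) 0 z"
    by (rule wirt_rewrite[OF wirt_diff[OF wirt_mult[OF wirt_hol wirt_hol] wirt_mult[OF wirt_hol wirt_hol]]])
       (use U assms in \<open>auto intro: holomorphic_deriv\<close>)
  moreover have "wirt (\<lambda>z. deriv y\<^sub>1 z * y\<^sub>2 z - y\<^sub>1 z * deriv y\<^sub>2 z) 0 0 z"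
    by (rule wirt_cong[OF wirt_const[of 1] U(1) assms(2)]) (simp add: wpair_wronskian[OF assms(1)])
  ultimately show ?thesis using wirt_unique(1) by fastforce
qed

text \<open>Two t-derivatives of the relation between the forms show that both pairs have the same
  potential, so (Y1, Y2) is a constant matrix times (y1, y2). The relation itself then says that
  this matrix preserves the Hermitian form up to the factor \<tau>. The scalar k only normalises the
  matrix and disappears in the quotient.\<close>

theorem liouville_unique:
  assumes y: "wpair (ball c r) y\<^sub>1 y\<^sub>2" and Y: "wpair (ball c r) Y\<^sub>1 Y\<^sub>2" and "r > 0"
    and \<tau>: "\<tau>\<^sup>2 = (1::real)" and ne: "\<And>z. z \<in> ball c r \<Longrightarrow> pform y\<^sub>1 y\<^sub>2 z \<noteq> 0"
    and eq: "\<And>z. z \<in> ball c r \<Longrightarrow> pform Y\<^sub>1 Y\<^sub>2 z = \<tau> * pform y\<^sub>1 y\<^sub>2 z"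
  obtains a b k where "k \<noteq> 0" "(cmod a)\<^sup>2 - (cmod b)\<^sup>2 = \<tau>"
    "\<And>z. z \<in> ball c r \<Longrightarrow> k * Y\<^sub>1 z = a * y\<^sub>1 z + cnj b * y\<^sub>2 z"
    "\<And>z. z \<in> ball c r \<Longrightarrow> k * Y\<^sub>2 z = b * y\<^sub>1 z + cnj a * y\<^sub>2 z"
proof -
  let ?B = "ball c r"
  have cB: "c \<in> ?B" using \<open>r > 0\<close> by simp
  have hy: "y\<^sub>1 holomorphic_on ?B" "y\<^sub>2 holomorphic_on ?B" and hY: "Y\<^sub>1 holomorphic_on ?B" "Y\<^sub>2 holomorphic_on ?B"
    using y Y by (auto simp: wpair_def)
  have eqc: "complex_of_real (pform Y\<^sub>1 Y\<^sub>2 z) = of_real \<tau> * complex_of_real (pform y\<^sub>1 y\<^sub>2 z)" if "z \<in> ?B" for z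
    using eq[OF that] by simp
  have d1: "deriv Y\<^sub>2 z * cnj (Y\<^sub>2 z) - deriv Y\<^sub>1 z * cnj (Y\<^sub>1 z) =
      of_real \<tau> * (deriv y\<^sub>2 z * cnj (y\<^sub>2 z) - deriv y\<^sub>1 z * cnj (y\<^sub>1 z))" if z: "z \<in> ?B" for z
  proof -
    have "wirt (\<lambda>z. of_real \<tau> * complex_of_real (pform y\<^sub>1 y\<^sub>2 z)) (deriv Y\<^sub>2 z * cnj (Y\<^sub>2 z) - deriv Y\<^sub>1 z * cnj (Y\<^sub>1 z))
       (Y\<^sub>2 z * cnj (deriv Y\<^sub>2 z) - Y\<^sub>1 z * cnj (deriv Y\<^sub>1 z)) z"
      by (rule wirt_cong[OF wirt_pform[OF hY open_ball z] open_ball z eqc])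
    from wirt_unique(1)[OF this wirt_cmult[OF wirt_pform[OF hy open_ball z]]] show ?thesis .
  qed
  have d2: "deriv (deriv Y\<^sub>2) z * cnj (Y\<^sub>2 z) - deriv (deriv Y\<^sub>1) z * cnj (Y\<^sub>1 z) =
      of_real \<tau> * (deriv (deriv y\<^sub>2) z * cnj (y\<^sub>2 z) - deriv (deriv y\<^sub>1) z * cnj (y\<^sub>1 z))" if z: "z \<in> ?B" for z
    using wirt_unique(1)[OF wirt_cong[OF wirt_pform_t[OF hY open_ball z] open_ball z d1]
        wirt_cmult[OF wirt_pform_t[OF hy open_ball z]]] .
  \<comment> \<open>By Wronskian 1 this is the potential -y''/y, written without division.\<close>
  define S where "S = (\<lambda>z. deriv (deriv y\<^sub>1) z * deriv y\<^sub>2 z - deriv y\<^sub>1 z * deriv (deriv y\<^sub>2) z)"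
  define T where "T = (\<lambda>z. deriv (deriv Y\<^sub>1) z * deriv Y\<^sub>2 z - deriv Y\<^sub>1 z * deriv (deriv Y\<^sub>2) z)"
  have Sy: "deriv (deriv y\<^sub>1) z = - S z * y\<^sub>1 z" "deriv (deriv y\<^sub>2) z = - S z * y\<^sub>2 z" if z: "z \<in> ?B" for z
    using wpair_wronskian[OF y z] wpair_same_potential[OF y z] unfolding S_def by algebra+
  have TY: "deriv (deriv Y\<^sub>1) z = - T z * Y\<^sub>1 z" "deriv (deriv Y\<^sub>2) z = - T z * Y\<^sub>2 z" if z: "z \<in> ?B" for z
    using wpair_wronskian[OF Y z] wpair_same_potential[OF Y z] unfolding T_def by algebra+
  have \<tau>0: "\<tau> \<noteq> 0" using \<tau> by auto
  \<comment> \<open>The second t-derivative of \<open>pform\<close> is minus the potential times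
    \<open>pform\<close>, and \<open>pform\<close> vanishes nowhere.\<close>
  have ST: "S z = T z" if z: "z \<in> ?B" for z
  proof -
    have "- T z * complex_of_real (pform Y\<^sub>1 Y\<^sub>2 z) = - S z * (of_real \<tau> * complex_of_real (pform y\<^sub>1 y\<^sub>2 z))"
      using d2[OF z] unfolding TY[OF z] Sy[OF z] of_real_pform by (simp add: algebra_simps)
    then show ?thesis using eqc[OF z] ne[OF z] \<tau>0 by simp
  qed
  define m11 m12 m21 m22 where
    "m11 = deriv Y\<^sub>1 c * y\<^sub>2 c - Y\<^sub>1 c * deriv y\<^sub>2 c" and "m12 = - (deriv Y\<^sub>1 c * y\<^sub>1 c - Y\<^sub>1 c * deriv y\<^sub>1 c)" and
    "m21 = deriv Y\<^sub>2 c * y\<^sub>2 c - Y\<^sub>2 c * deriv y\<^sub>2 c" and "m22 = - (deriv Y\<^sub>2 c * y\<^sub>1 c - Y\<^sub>2 c * deriv y\<^sub>1 c)"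
  have Ym: "Y\<^sub>1 z = m11 * y\<^sub>1 z + m12 * y\<^sub>2 z" "Y\<^sub>2 z = m21 * y\<^sub>1 z + m22 * y\<^sub>2 z" if z: "z \<in> ?B" for z
  proof -
    have "deriv (deriv Y\<^sub>1) w = - S w * Y\<^sub>1 w" "deriv (deriv Y\<^sub>2) w = - S w * Y\<^sub>2 w" if "w \<in> ?B" for w
      using TY[OF that] ST[OF that] by simp_all
    then show "Y\<^sub>1 z = m11 * y\<^sub>1 z + m12 * y\<^sub>2 z" "Y\<^sub>2 z = m21 * y\<^sub>1 z + m22 * y\<^sub>2 z"
      using linear_ode_combination[OF y hY(1), of S z] linear_ode_combination[OF y hY(2), of S z] Sy z
      unfolding m11_def m12_def m21_def m22_def by (simp_all add: algebra_simps)
  qed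
  have det: "m11 * m22 - m12 * m21 = 1"
    using wpair_wronskian[OF y cB] wpair_wronskian[OF Y cB]
    unfolding m11_def m12_def m21_def m22_def by algebra
  \<comment> \<open>The relation between the forms is sorted by the conjugates of y1 and y2; their
    holomorphic coefficients must vanish separately.\<close>
  have "cnj m21 * Y\<^sub>2 z - cnj m11 * Y\<^sub>1 z + of_real \<tau> * y\<^sub>1 z = 0 \<and>
      cnj m22 * Y\<^sub>2 z - cnj m12 * Y\<^sub>1 z - of_real \<tau> * y\<^sub>2 z = 0" if z: "z \<in> ?B" for z
  proof -
    have e: "(cnj m21 * Y\<^sub>2 w - cnj m11 * Y\<^sub>1 w + of_real \<tau> * y\<^sub>1 w) * cnj (y\<^sub>1 w) +
       (cnj m22 * Y\<^sub>2 w - cnj m12 * Y\<^sub>1 w - of_real \<tau> * y\<^sub>2 w) * cnj (y\<^sub>2 w) = 0" if w: "w \<in> ?B" for w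
    proof -
      have "cnj (Y\<^sub>1 w) = cnj m11 * cnj (y\<^sub>1 w) + cnj m12 * cnj (y\<^sub>2 w)"
        "cnj (Y\<^sub>2 w) = cnj m21 * cnj (y\<^sub>1 w) + cnj m22 * cnj (y\<^sub>2 w)" by (simp_all add: Ym[OF w])
      then show ?thesis using eqc[OF w] unfolding of_real_pform by algebra
    qed
    show ?thesis
      by (intro conjI cnj_independent[OF y _ _ e z]) (use hy hY in \<open>auto intro!: holomorphic_intros\<close>)
  qed
  then have e1: "cnj m21 * Y\<^sub>2 z - cnj m11 * Y\<^sub>1 z + of_real \<tau> * y\<^sub>1 z = 0"
    and e2: "cnj m22 * Y\<^sub>2 z - cnj m12 * Y\<^sub>1 z - of_real \<tau> * y\<^sub>2 z = 0" if "z \<in> ?B" for z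
    using that by auto
  have "(cnj m21 * m21 - cnj m11 * m11 + of_real \<tau>) * y\<^sub>1 z + (cnj m21 * m22 - cnj m11 * m12) * y\<^sub>2 z = 0" if "z \<in> ?B" for z
    using e1[OF that] unfolding Ym[OF that] by (simp add: algebra_simps)
  from hol_independent[OF y this cB]
  have r1: "cnj m21 * m21 - cnj m11 * m11 + of_real \<tau> = 0" and r2: "cnj m21 * m22 - cnj m11 * m12 = 0" by auto
  have t2: "of_real \<tau> * of_real \<tau> = (1::complex)" using \<tau> by (metis of_real_1 of_real_mult power2_eq_square)
  have c22: "m22 = of_real \<tau> * cnj m11" and c12: "m12 = of_real \<tau> * cnj m21"
    using r1 r2 det t2 by algebra+
  have nn: "(cmod m11)\<^sup>2 - (cmod m21)\<^sup>2 = \<tau>"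
  proof -
    have "complex_of_real ((cmod m11)\<^sup>2 - (cmod m21)\<^sup>2) = of_real \<tau>"
      unfolding of_real_diff complex_norm_square using r1 by algebra
    then show ?thesis using of_real_eq_iff by blast
  qed
  consider "\<tau> = 1" | "\<tau> = -1" using \<tau> by (auto simp: power2_eq_1_iff)
  then show ?thesis
  proof cases
    case 1
    show ?thesis by (rule that[of 1 m11 m21]) (use nn Ym c22 c12 1 in auto)
  next
    case 2
    \<comment> \<open>For \<tau> = -1 the matrix has rows (m11, -cnj m21) and (m21, -cnj m11). The
      common factor \<i> brings it to the shape with rows (a, cnj b) and (b, cnj a).\<close>
    show ?thesis
    proof (rule that[of \<i> "\<i> * m11" "\<i> * m21"])
      show "(cmod (\<i> * m11))\<^sup>2 - (cmod (\<i> * m21))\<^sup>2 = \<tau>" using nn by (simp add: norm_mult)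
    next
      fix z assume "z \<in> ?B"
      note Yz = Ym[OF this]
      show "\<i> * Y\<^sub>1 z = \<i> * m11 * y\<^sub>1 z + cnj (\<i> * m21) * y\<^sub>2 z"
        "\<i> * Y\<^sub>2 z = \<i> * m21 * y\<^sub>1 z + cnj (\<i> * m11) * y\<^sub>2 z"
        unfolding Yz c22 c12 2 by (simp_all add: algebra_simps)
    qed simp
  qed
qed

section \<open>Existence for the Liouville equation\<close>

lemma differentiable_linear:
  "bounded_linear L \<Longrightarrow> f differentiable (at z) \<Longrightarrow> (\<lambda>z. L (f z)) differentiable (at z)"
  using bounded_linear.has_derivative unfolding differentiable_def by blast

text \<open>Two solutions of y'' = -S y are started so that their form agrees with e^(-w) at 0 in
  value, in both first Wirtinger derivatives and in the mixed one. The difference is real and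
  satisfies the same linear equation in t, so these data force it to vanish.\<close>

theorem liouville_exists:
  assumes "open D" "0 \<in> D" and C: "Ck_on 2 w D" and L: "\<And>z. z \<in> D \<Longrightarrow> laplacian w z = 4 * exp (2 * w z)"
  obtains r y\<^sub>1 y\<^sub>2 where "r > 0" "ball 0 r \<subseteq> D" "wpair (ball 0 r) y\<^sub>1 y\<^sub>2"
    "\<And>z. z \<in> ball 0 r \<Longrightarrow> exp (- w z) = pform y\<^sub>1 y\<^sub>2 z"
proof -
  obtain r\<^sub>0 where r0: "r\<^sub>0 > 0" "ball 0 r\<^sub>0 \<subseteq> D" using assms open_contains_ball by blast
  let ?B = "ball (0::complex) r\<^sub>0"
  have CB: "Ck_on 2 w ?B" using Ck_on_subset[OF C r0(2)] .
  have dw: "w differentiable (at z)" and dw2: "pd i w differentiable (at z)" if "z \<in> ?B" for z i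
    using CB that unfolding numeral_2_eq_2 by auto
  have C1: "Ck_on 1 (pd i w) ?B" for i using CB unfolding numeral_2_eq_2 by simp
  have bl: "bounded_linear complex_of_real" by (rule bounded_linear_of_real)
  \<comment> \<open>p is dw/dt, and q = e^(2w) is the derivative of p in the conjugate variable, by
    the Liouville equation.\<close>
  define p where "p = (\<lambda>z. complex_of_real (pd 1 w z / 2) - \<i> * complex_of_real (pd 2 w z / 2))"
  define q where "q = (\<lambda>z. complex_of_real (exp (2 * w z)))"
  define pt where "pt = (\<lambda>z. (pd 1 p z - \<i> * pd 2 p z) / 2)"
  have C1p: "Ck_on 1 p ?B"
  proof -
    have "Ck_on 1 (\<lambda>z. complex_of_real (pd i w z / 2)) ?B" for i
      using Ck_on_linear[OF bounded_linear_compose[OF bl bounded_linear_divide[of 2]] open_ball C1] by simp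
    then show ?thesis
      unfolding p_def by (intro Ck_on_diff Ck_on_mult open_ball Ck_on_const)
  qed
  have C1q: "Ck_on 1 q ?B"
    unfolding q_def
    by (intro Ck_on_linear[OF bl] Ck_on_exp Ck_on_mult Ck_on_const open_ball Ck_on_le[OF CB]) simp
  have ww: "wirt (\<lambda>z. of_real (w z)) (p z) (cnj (p z)) z" if "z \<in> ?B" for z
    by (rule wirt_rewrite[OF real_wirt[OF dw[OF that]]]) (simp_all add: p_def complex_eq_iff)
  have wp: "wirt p (pt z) (q z) z" if z: "z \<in> ?B" for z
  proof -
    have d: "p differentiable (at z)" using C1p z by auto
    have pdp: "pd i p z = complex_of_real (pd i (pd 1 w) z / 2) - \<i> * complex_of_real (pd i (pd 2 w) z / 2)" for i
    proof -
      have l0: "bounded_linear (\<lambda>x. complex_of_real (x / 2))"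
        by (rule bounded_linear_compose[OF bl bounded_linear_divide])
      note l1 = l0 bounded_linear_const_mult[OF l0, of "- \<i>"]
      have "p = (\<lambda>z. complex_of_real (pd 1 w z / 2) + (- \<i>) * complex_of_real (pd 2 w z / 2))"
        by (simp add: p_def)
      moreover have "pd i \<dots> z = complex_of_real (pd i (pd 1 w) z / 2) + (- \<i>) * complex_of_real (pd i (pd 2 w) z / 2)"
        unfolding pd_add[OF differentiable_linear[OF l1(1) dw2[OF z]] differentiable_linear[OF l1(2) dw2[OF z]]]
          pd_linear[OF l1(1) dw2[OF z]] pd_linear[OF l1(2) dw2[OF z]] ..
      ultimately show ?thesis by simp
    qed
    have lap: "pd 1 (pd 1 w) z + pd 2 (pd 2 w) z = 4 * exp (2 * w z)"
      using L[of z] z r0 by (auto simp: laplacian_def)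
    have "(pd 1 p z + \<i> * pd 2 p z) / 2 = of_real ((pd 1 (pd 1 w) z + pd 2 (pd 2 w) z) / 4)"
      unfolding pdp pd_commute_real[OF open_ball CB z] by (simp add: complex_eq_iff field_simps)
    also have "\<dots> = q z" unfolding lap q_def by simp
    finally show ?thesis using pd_wirt[OF d] by (simp add: pt_def)
  qed
  have wq: "wirt q (2 * p z * q z) (2 * cnj (p z) * q z) z" if "z \<in> ?B" for z
  proof -
    have "((\<lambda>x. exp (2 * x)) has_real_derivative 2 * exp (2 * w z)) (at (w z))"
      by (auto intro!: derivative_eq_intros)
    from wirt_chain_real[OF ww[OF that] this] show ?thesis
      unfolding q_def by (rule wirt_rewrite) simp_all
  qed
  \<comment> \<open>P du + Q dv is the form -(p^2 dt + q dt-bar). It is closed, since the conjugate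
    derivative of p^2 and the t-derivative of q are both 2pq; only second derivatives of w enter.
    Adding its primitive \<open>G\<close> to p cancels the conjugate derivative q of p, while the
    t-derivative becomes S = pt - p^2.\<close>
  define P where "P = (\<lambda>z. - q z - p z * p z)"
  define Q where "Q = (\<lambda>z. \<i> * (q z - p z * p z))"
  have wP: "wirt P (- (2 * p z * q z) - (pt z * p z + p z * pt z)) (- (2 * cnj (p z) * q z) - (q z * p z + p z * q z)) z"
    and wQ: "wirt Q (\<i> * (2 * p z * q z - (pt z * p z + p z * pt z))) (\<i> * (2 * cnj (p z) * q z - (q z * p z + p z * q z))) z"
    if "z \<in> ?B" for z
    unfolding P_def Q_def
    by (rule wirt_diff[OF wirt_minus[OF wq[OF that]] wirt_mult[OF wp[OF that] wp[OF that]]],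
        rule wirt_cmult[OF wirt_diff[OF wq[OF that] wirt_mult[OF wp[OF that] wp[OF that]]]])
  have CPQ: "Ck_on 1 P ?B" "Ck_on 1 Q ?B"
    unfolding P_def Q_def
    by (intro Ck_on_diff Ck_on_minus Ck_on_mult Ck_on_const C1p C1q open_ball)+
  have closed: "pd 2 P z = pd 1 Q z" if "z \<in> ?B" for z
    unfolding wirt_pd(3)[OF wP[OF that]] wirt_pd(2)[OF wQ[OF that]] by (simp add: algebra_simps)
  obtain G where G: "\<And>z. z \<in> ?B \<Longrightarrow> (G has_derivative (\<lambda>h. Re h *\<^sub>R P z + Im h *\<^sub>R Q z)) (at z)"
    using poincare_ball[OF CPQ closed] by metis
  have wG: "wirt G (- (p z * p z)) (- q z) z" if "z \<in> ?B" for z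
  proof -
    have "Re h *\<^sub>R P z + Im h *\<^sub>R Q z = - (p z * p z) * h + - q z * cnj h" for h
      by (simp add: P_def Q_def complex_eq_iff algebra_simps)
    then show ?thesis using G[OF that] by (simp add: wirt_def)
  qed
  define S where "S = (\<lambda>z. pt z - p z * p z)"
  have wH: "wirt (\<lambda>z. p z + G z) (S z) 0 z" if "z \<in> ?B" for z
    using wirt_add[OF wp[OF that] wG[OF that]] by (simp add: S_def)
  have holS: "S holomorphic_on ?B"
  proof -
    have "deriv (\<lambda>z. p z + G z) holomorphic_on ?B"
      by (rule holomorphic_deriv[OF holomorphic_wirt(1)[OF wH] open_ball])
    then show ?thesis by (rule holomorphic_transform) (rule holomorphic_wirt(2)[OF wH])
  qed
  define \<phi> where "\<phi> = (\<lambda>z. complex_of_real (exp (- w z)))"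
  have w\<phi>: "wirt \<phi> (- p z * \<phi> z) (- cnj (p z) * \<phi> z) z" if "z \<in> ?B" for z
  proof -
    have "((\<lambda>x. exp (- x)) has_real_derivative - exp (- w z)) (at (w z))"
      by (auto intro!: derivative_eq_intros)
    from wirt_chain_real[OF ww[OF that] this] show ?thesis
      unfolding \<phi>_def by (rule wirt_rewrite) simp_all
  qed
  have w\<phi>t: "wirt (\<lambda>z. - p z * \<phi> z) (- S z * \<phi> z) ((p z * cnj (p z) - q z) * \<phi> z) z" if "z \<in> ?B" for z
    by (rule wirt_rewrite[OF wirt_mult[OF wirt_minus[OF wp[OF that]] w\<phi>[OF that]]])
       (simp_all add: S_def algebra_simps)
  \<comment> \<open>Initial data: y1(0) = 0 and y2(0) = h match the value e^(-w(0)) = h^2, and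
    y2'(0) = -p(0) h matches the t-derivative. Wronskian 1 then dictates y1'(0) = 1/h, which matches
    the mixed derivative because q(0) = h^(-4).\<close>
  define h where "h = exp (- w 0 / 2)"
  have h: "h > 0" "h * h = exp (- w 0)" by (simp_all add: h_def exp_add[symmetric])
  have \<phi>0: "\<phi> 0 = of_real h * of_real h" unfolding \<phi>_def h(2)[symmetric] by simp
  obtain y\<^sub>1 \<rho>\<^sub>1 where y1: "0 < \<rho>\<^sub>1" "\<rho>\<^sub>1 \<le> r\<^sub>0" "y\<^sub>1 holomorphic_on ball 0 \<rho>\<^sub>1" "y\<^sub>1 0 = 0" "deriv y\<^sub>1 0 = 1 / of_real h"
    "\<And>z. z \<in> ball 0 \<rho>\<^sub>1 \<Longrightarrow> deriv (deriv y\<^sub>1) z = - S z * y\<^sub>1 z"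
    by (rule linear_ode_solution[OF holS r0(1), of 0 "1 / of_real h"]) blast
  obtain y\<^sub>2 \<rho>\<^sub>2 where y2: "0 < \<rho>\<^sub>2" "\<rho>\<^sub>2 \<le> r\<^sub>0" "y\<^sub>2 holomorphic_on ball 0 \<rho>\<^sub>2" "y\<^sub>2 0 = of_real h" "deriv y\<^sub>2 0 = - p 0 * of_real h"
    "\<And>z. z \<in> ball 0 \<rho>\<^sub>2 \<Longrightarrow> deriv (deriv y\<^sub>2) z = - S z * y\<^sub>2 z"
    by (rule linear_ode_solution[OF holS r0(1), of "of_real h" "- p 0 * of_real h"]) blast
  define r where "r = min \<rho>\<^sub>1 \<rho>\<^sub>2"
  have r: "r > 0" "r \<le> r\<^sub>0" using y1 y2 by (auto simp: r_def)
  let ?U = "ball (0::complex) r"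
  have UB: "z \<in> ?B" if "z \<in> ?U" for z using that r by simp
  have hol: "y\<^sub>1 holomorphic_on ?U" "y\<^sub>2 holomorphic_on ?U"
    by (rule holomorphic_on_subset[OF y1(3)], simp add: r_def subset_ball)
       (rule holomorphic_on_subset[OF y2(3)], simp add: r_def subset_ball)
  have S1: "deriv (deriv y\<^sub>1) z = - S z * y\<^sub>1 z" and S2: "deriv (deriv y\<^sub>2) z = - S z * y\<^sub>2 z" if "z \<in> ?U" for z
    using that y1(6) y2(6) by (auto simp: r_def)
  have U0: "0 \<in> ?U" using r by simp
  have y: "wpair ?U y\<^sub>1 y\<^sub>2"
    unfolding wpair_def
  proof (intro conjI ballI hol open_ball)
    fix z assume "z \<in> ?U"
    from wronskian_constant[OF hol S1 S2 this]
    show "deriv y\<^sub>1 z * y\<^sub>2 z - y\<^sub>1 z * deriv y\<^sub>2 z = 1" using h y1 y2 by simp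
  qed
  define \<psi> where "\<psi> = (\<lambda>z. exp (- w z) - pform y\<^sub>1 y\<^sub>2 z)"
  define \<psi>\<^sub>1 where "\<psi>\<^sub>1 = (\<lambda>z. - p z * \<phi> z - (deriv y\<^sub>2 z * cnj (y\<^sub>2 z) - deriv y\<^sub>1 z * cnj (y\<^sub>1 z)))"
  define \<psi>\<^sub>2 where "\<psi>\<^sub>2 = (\<lambda>z. (p z * cnj (p z) - q z) * \<phi> z - (deriv y\<^sub>2 z * cnj (deriv y\<^sub>2 z) - deriv y\<^sub>1 z * cnj (deriv y\<^sub>1 z)))"
  have w\<psi>: "wirt (\<lambda>z. of_real (\<psi> z)) (\<psi>\<^sub>1 z) (cnj (\<psi>\<^sub>1 z)) z" if z: "z \<in> ?U" for z
  proof -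
    have "wirt (\<lambda>z. of_real (\<psi> z)) (\<psi>\<^sub>1 z) (- cnj (p z) * \<phi> z - (y\<^sub>2 z * cnj (deriv y\<^sub>2 z) - y\<^sub>1 z * cnj (deriv y\<^sub>1 z))) z"
      using wirt_diff[OF w\<phi>[OF UB[OF z]] wirt_pform[OF hol open_ball z]]
      unfolding \<psi>_def \<psi>\<^sub>1_def \<phi>_def by simp
    with wirt_real(4)[OF this] show ?thesis by simp
  qed
  have w\<psi>1: "wirt \<psi>\<^sub>1 (- S z * of_real (\<psi> z)) (\<psi>\<^sub>2 z) z" if z: "z \<in> ?U" for z
    unfolding \<psi>\<^sub>1_def
    by (rule wirt_rewrite[OF wirt_diff[OF w\<phi>t[OF UB[OF z]] wirt_pform_t[OF hol open_ball z]]])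
       (simp_all add: \<psi>\<^sub>2_def \<psi>_def S1[OF z] S2[OF z] of_real_diff of_real_pform \<phi>_def[symmetric] algebra_simps
         , simp add: \<phi>_def)
  text \<open>Variation of constants: \<open>cnj (vc y)\<close> is holomorphic and again solves the equation, with zero initial data.\<close>
  define vc where "vc = (\<lambda>y z. of_real (\<psi> z) * deriv y z - \<psi>\<^sub>1 z * y z)"
  have wvc: "wirt (vc y) 0 (cnj (\<psi>\<^sub>1 z) * deriv y z - \<psi>\<^sub>2 z * y z) z"
    if "y holomorphic_on ?U" "deriv (deriv y) z = - S z * y z" "z \<in> ?U" for y z
    unfolding vc_def
    by (rule wirt_rewrite[OF wirt_diff[OF wirt_mult[OF w\<psi> wirt_hol[of _ ?U]] wirt_mult[OF w\<psi>1 wirt_hol[of _ ?U]]]])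
       (use that in \<open>auto intro: holomorphic_deriv simp: algebra_simps\<close>)
  have wcvc: "wirt (\<lambda>z. cnj (vc y z)) (cnj (cnj (\<psi>\<^sub>1 z) * deriv y z - \<psi>\<^sub>2 z * y z)) 0 z"
    if "y holomorphic_on ?U" "\<And>z. z \<in> ?U \<Longrightarrow> deriv (deriv y) z = - S z * y z" "z \<in> ?U" for y z
    using wirt_cnj[OF wvc[OF that(1) that(2)[OF that(3)] that(3)]] by simp
  note U1 = holomorphic_wirt(1)[where U = ?U, OF wcvc] holomorphic_wirt(2)[where U = ?U, OF wcvc]
  define u v where "u = (\<lambda>z. cnj (vc y\<^sub>2 z))" and "v = (\<lambda>z. cnj (vc y\<^sub>1 z))"
  have hu: "u holomorphic_on ?U" and hv: "v holomorphic_on ?U"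
    unfolding u_def v_def by (rule U1(1)[OF hol(2) S2], assumption+, rule U1(1)[OF hol(1) S1], assumption+)
  \<comment> \<open>Wronskian 1 inverts the definition of \<open>vc\<close>: \<psi> is a combination
    of the conjugates of y1 and y2 with holomorphic coefficients.\<close>
  have \<psi>uv: "complex_of_real (\<psi> z) = v z * cnj (y\<^sub>2 z) - u z * cnj (y\<^sub>1 z)" if z: "z \<in> ?U" for z
  proof -
    have "vc y\<^sub>1 z * y\<^sub>2 z - vc y\<^sub>2 z * y\<^sub>1 z = of_real (\<psi> z)"
      unfolding vc_def using wpair_wronskian[OF y z] by algebra
    from arg_cong[OF this, of cnj] show ?thesis by (simp add: u_def v_def)
  qed
  have e1: "\<psi>\<^sub>1 z = deriv v z * cnj (y\<^sub>2 z) - deriv u z * cnj (y\<^sub>1 z)" if z: "z \<in> ?U" for z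
  proof -
    have "wirt (\<lambda>z. complex_of_real (\<psi> z)) (deriv v z * cnj (y\<^sub>2 z) - deriv u z * cnj (y\<^sub>1 z))
       (v z * cnj (deriv y\<^sub>2 z) - u z * cnj (deriv y\<^sub>1 z)) z"
      by (rule wirt_cong[OF wirt_rewrite[OF wirt_diff[OF wirt_mult[OF wirt_hol wirt_cnj_hol] wirt_mult[OF wirt_hol wirt_cnj_hol]]]
            open_ball z \<psi>uv[symmetric]])
         (use hu hv hol z in auto)
    from wirt_unique(1)[OF w\<psi>[OF z] this] show ?thesis .
  qed
  have e2: "- S z * of_real (\<psi> z) = deriv (deriv v) z * cnj (y\<^sub>2 z) - deriv (deriv u) z * cnj (y\<^sub>1 z)" if z: "z \<in> ?U" for z
  proof -
    have "wirt \<psi>\<^sub>1 (deriv (deriv v) z * cnj (y\<^sub>2 z) - deriv (deriv u) z * cnj (y\<^sub>1 z))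
       (deriv v z * cnj (deriv y\<^sub>2 z) - deriv u z * cnj (deriv y\<^sub>1 z)) z"
      by (rule wirt_cong[OF wirt_rewrite[OF wirt_diff[OF wirt_mult[OF wirt_hol wirt_cnj_hol] wirt_mult[OF wirt_hol wirt_cnj_hol]]]
            open_ball z e1[symmetric]])
         (use hu hv hol z in \<open>auto intro: holomorphic_deriv\<close>)
    from wirt_unique(1)[OF w\<psi>1[OF z] this] show ?thesis .
  qed
  \<comment> \<open>Two t-derivatives act on u and v alone, so separating the conjugates of y1 and
    y2 in the equation for \<psi> gives the same equation for u and v.\<close>
  have "- (deriv (deriv u) z + S z * u z) = 0 \<and> deriv (deriv v) z + S z * v z = 0" if z: "z \<in> ?U" for z
  proof -
    have hS: "S holomorphic_on ?U" using holomorphic_on_subset[OF holS] UB by blast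
    have e: "- (deriv (deriv u) w + S w * u w) * cnj (y\<^sub>1 w) + (deriv (deriv v) w + S w * v w) * cnj (y\<^sub>2 w) = 0"
      if "w \<in> ?U" for w
      using e2[OF that] unfolding \<psi>uv[OF that] by (simp add: algebra_simps)
    show ?thesis
      by (intro conjI cnj_independent[OF y _ _ e z])
         (use hu hv hS in \<open>auto intro!: holomorphic_intros\<close>)
  qed
  note uv = this
  have Su: "deriv (deriv u) z = - S z * u z" and Sv: "deriv (deriv v) z = - S z * v z" if "z \<in> ?U" for z
    using uv[OF that] by algebra+
  have i0: "\<psi> 0 = 0" "\<psi>\<^sub>1 0 = 0"
    using h y1 y2 \<phi>0 by (simp_all add: \<psi>_def \<psi>\<^sub>1_def pform_def power2_eq_square)
  have i2: "\<psi>\<^sub>2 0 = 0"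
  proof -
    have "q 0 = 1 / (of_real h * of_real h) ^ 2"
    proof -
      have "exp (2 * w 0) * (h * h) ^ 2 = 1"
        unfolding h(2) by (simp add: power2_eq_square exp_add[symmetric])
      then have "exp (2 * w 0) = 1 / (h * h) ^ 2" using h by (simp add: field_simps)
      then show ?thesis by (simp add: q_def)
    qed
    with h(1) show ?thesis
      unfolding \<psi>\<^sub>2_def y1(5) y2(5) \<phi>0 by (simp add: field_simps power2_eq_square)
  qed
  have "u 0 = 0" "v 0 = 0" "deriv u 0 = 0" "deriv v 0 = 0"
    using i0 i2 U1(2)[OF hol(1) S1 _ U0] U1(2)[OF hol(2) S2 _ U0] by (simp_all add: u_def v_def vc_def)
  then have "u z = 0" "v z = 0" if "z \<in> ?U" for z
    using linear_ode_combination[OF y hu Su S1 S2 that] linear_ode_combination[OF y hv Sv S1 S2 that] by simp_all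
  then have "\<psi> z = 0" if "z \<in> ?U" for z using \<psi>uv[OF that] that by simp
  moreover have "?U \<subseteq> D" using r(2) r0(2) subset_ball by blast
  ultimately show ?thesis
    using that[OF r(1) _ y] by (auto simp: \<psi>_def)
qed

section \<open>Hyperbolic density and the natural equations\<close>

text \<open>Density of the pull-back under \<open>g\<close> of the hyperbolic metric of the disc, or of its exterior.\<close>

definition hdens :: "(complex \<Rightarrow> complex) \<Rightarrow> complex \<Rightarrow> real" where
  "hdens g z = cmod (deriv g z) / \<bar>(cmod (g z))\<^sup>2 - 1\<bar>"

text \<open>A disc is contractible, so the zero-free \<open>deriv g\<close> has a holomorphic square
  root s on it; the pair is (g/s, 1/s).\<close>

lemma wpair_exists:
  assumes g: "g holomorphic_on ball c r" and nz: "\<And>z. z \<in> ball c r \<Longrightarrow> deriv g z \<noteq> 0"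
  obtains y\<^sub>1 y\<^sub>2 where "wpair (ball c r) y\<^sub>1 y\<^sub>2" "\<And>z. z \<in> ball c r \<Longrightarrow> y\<^sub>2 z \<noteq> 0"
    "\<And>z. z \<in> ball c r \<Longrightarrow> g z = y\<^sub>1 z / y\<^sub>2 z" "\<And>z. z \<in> ball c r \<Longrightarrow> deriv g z = 1 / (y\<^sub>2 z)\<^sup>2"
proof -
  obtain s where s: "s holomorphic_on ball c r" "\<And>z. z \<in> ball c r \<Longrightarrow> deriv g z = (s z)\<^sup>2"
    using contractible_imp_holomorphic_sqrt[OF holomorphic_deriv[OF g open_ball] convex_imp_contractible[OF convex_ball] nz]
    by metis
  have s0: "s z \<noteq> 0" if "z \<in> ball c r" for z using nz[OF that] s(2)[OF that] by auto
  show ?thesis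
  proof (rule that[of "\<lambda>z. g z / s z" "\<lambda>z. 1 / s z"])
    show "wpair (ball c r) (\<lambda>z. g z / s z) (\<lambda>z. 1 / s z)"
      unfolding wpair_def
    proof (intro conjI ballI open_ball)
      show "(\<lambda>z. g z / s z) holomorphic_on ball c r" "(\<lambda>z. 1 / s z) holomorphic_on ball c r"
        using g s s0 by (auto intro!: holomorphic_intros)
      fix z assume z: "z \<in> ball c r"
      note dg = holomorphic_derivI[OF g open_ball z] and ds = holomorphic_derivI[OF s(1) open_ball z]
      have "deriv (\<lambda>z. g z / s z) z = (deriv g z * s z - g z * deriv s z) / (s z * s z)"
        "deriv (\<lambda>z. 1 / s z) z = (0 * s z - 1 * deriv s z) / (s z * s z)"
        using DERIV_imp_deriv[OF DERIV_divide[OF dg ds s0[OF z]]]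
          DERIV_imp_deriv[OF DERIV_divide[OF DERIV_const ds s0[OF z]]] by auto
      note d = this
      show "deriv (\<lambda>z. g z / s z) z * (1 / s z) - g z / s z * deriv (\<lambda>z. 1 / s z) z = 1"
        unfolding d s(2)[OF z] using s0[OF z] by (simp add: field_simps power2_eq_square)
    qed
  qed (use s s0 in \<open>auto simp: power_divide\<close>)
qed

lemma wpair_quotient:
  assumes "wpair U y\<^sub>1 y\<^sub>2" "\<And>z. z \<in> U \<Longrightarrow> y\<^sub>2 z \<noteq> 0"
  shows "(\<lambda>z. y\<^sub>1 z / y\<^sub>2 z) holomorphic_on U" "z \<in> U \<Longrightarrow> deriv (\<lambda>z. y\<^sub>1 z / y\<^sub>2 z) z = 1 / (y\<^sub>2 z)\<^sup>2"
proof -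
  have U: "open U" "y\<^sub>1 holomorphic_on U" "y\<^sub>2 holomorphic_on U" using assms by (auto simp: wpair_def)
  show "(\<lambda>z. y\<^sub>1 z / y\<^sub>2 z) holomorphic_on U"
    using U assms(2) by (auto intro!: holomorphic_intros)
  assume z: "z \<in> U"
  have "deriv (\<lambda>z. y\<^sub>1 z / y\<^sub>2 z) z = (deriv y\<^sub>1 z * y\<^sub>2 z - y\<^sub>1 z * deriv y\<^sub>2 z) / (y\<^sub>2 z * y\<^sub>2 z)"
    by (rule DERIV_imp_deriv[OF DERIV_divide[OF holomorphic_derivI[OF U(2,1) z] holomorphic_derivI[OF U(3,1) z] assms(2)[OF z]]])
  then show "deriv (\<lambda>z. y\<^sub>1 z / y\<^sub>2 z) z = 1 / (y\<^sub>2 z)\<^sup>2"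
    using wpair_wronskian[OF assms(1) z] by (simp add: power2_eq_square)
qed

lemma pform_quotient:
  assumes "y\<^sub>2 z \<noteq> 0" "g z = y\<^sub>1 z / y\<^sub>2 z"
  shows "pform y\<^sub>1 y\<^sub>2 z = (cmod (y\<^sub>2 z))\<^sup>2 * (1 - (cmod (g z))\<^sup>2)"
proof -
  have "y\<^sub>1 z = g z * y\<^sub>2 z" using assms by simp
  then show ?thesis by (simp add: pform_def norm_mult power_mult_distrib algebra_simps)
qed

lemma hdens_pform:
  assumes "y\<^sub>2 z \<noteq> 0" "g z = y\<^sub>1 z / y\<^sub>2 z" "deriv g z = 1 / (y\<^sub>2 z)\<^sup>2"
  shows "hdens g z = 1 / \<bar>pform y\<^sub>1 y\<^sub>2 z\<bar>"
  unfolding hdens_def pform_quotient[of y\<^sub>2 z g y\<^sub>1, OF assms(1,2)] assms(3)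
  by (simp add: norm_divide norm_power abs_mult abs_minus_commute)

lemma constant_sign:
  fixes f :: "complex \<Rightarrow> real"
  assumes "connected U" "continuous_on U f" "\<And>z. z \<in> U \<Longrightarrow> f z \<noteq> 0"
  obtains \<sigma> :: real where "\<sigma>\<^sup>2 = 1" "\<And>z. z \<in> U \<Longrightarrow> \<sigma> * f z > 0"
proof (cases "\<exists>z\<in>U. f z < 0")
  case True
  then obtain x where x: "x \<in> U" "f x < 0" by auto
  have "f y < 0" if "y \<in> U" for y
  proof (rule ccontr)
    assume "\<not> f y < 0"
    then have "0 \<in> {f x..f y}" using x by auto
    also have "{f x..f y} \<subseteq> f ` U"
      using connected_contains_Icc[OF connected_continuous_image[OF assms(2,1)]] x that by blast
    finally show False using assms(3) by auto
  qed
  then show ?thesis using that[of "-1"] by auto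
next
  case False
  then have "f z > 0" if "z \<in> U" for z using assms(3)[OF that] that by force
  then show ?thesis using that[of 1] by simp
qed

lemma laplacian_cong:
  assumes "open U" "z \<in> U" "\<And>w. w \<in> U \<Longrightarrow> f w = g w"
  shows "laplacian f z = laplacian g z"
proof -
  have "pd i (pd i f) z = pd i (pd i g) z" for i
    by (rule pd_cong_open[OF assms(1,2)]) (rule pd_cong_open[OF assms(1) _ assms(3)])
  then show ?thesis by (simp add: laplacian_def)
qed

lemma laplacian_combination:
  assumes "open U" "Ck_on 2 f U" "Ck_on 2 g U" "z \<in> U"
  shows "laplacian (\<lambda>z. \<alpha> * f z + \<beta> * g z + \<gamma>) z = \<alpha> * laplacian f z + \<beta> * laplacian g z"
proof -
  have d: "f differentiable (at w)" "g differentiable (at w)" "pd i f differentiable (at w)" "pd i g differentiable (at w)"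
    if "w \<in> U" for w i using assms(2,3) that unfolding numeral_2_eq_2 by auto
  have dc: "(\<lambda>z. c * h z) differentiable (at w)" "pd i (\<lambda>z. c * h z) w = c * pd i h w"
    if "h differentiable (at w)" for h :: "complex \<Rightarrow> real" and c i w
    using differentiable_linear[OF bounded_linear_mult_right that] pd_linear[OF bounded_linear_mult_right that] by auto
  have sum: "pd i (\<lambda>z. \<alpha> * h z + \<beta> * k z + \<gamma>) w = \<alpha> * pd i h w + \<beta> * pd i k w"
    if "h differentiable (at w)" "k differentiable (at w)" for h k :: "complex \<Rightarrow> real" and \<gamma> i w
  proof -
    have "(\<lambda>z. \<alpha> * h z + \<beta> * k z) differentiable (at w)" using dc(1)[OF that(1)] dc(1)[OF that(2)] by auto
    from pd_add[OF this differentiable_const] show ?thesis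
      using pd_add[OF dc(1)[OF that(1)] dc(1)[OF that(2)]] dc(2)[OF that(1)] dc(2)[OF that(2)]
        pd_unique[OF has_derivative_const[of \<gamma>]] by simp
  qed
  have "pd i (pd i (\<lambda>z. \<alpha> * f z + \<beta> * g z + \<gamma>)) z = \<alpha> * pd i (pd i f) z + \<beta> * pd i (pd i g) z" for i
  proof -
    have "pd i (pd i (\<lambda>z. \<alpha> * f z + \<beta> * g z + \<gamma>)) z = pd i (\<lambda>z. \<alpha> * pd i f z + \<beta> * pd i g z + 0) z"
      by (rule pd_cong_open[OF assms(1,4)]) (simp add: sum[OF d(1,2)])
    then show ?thesis using sum[where h = "pd i f" and k = "pd i g" and w = z and \<gamma> = 0 and i = i] d[OF assms(4)] by simp
  qed
  then show ?thesis by (simp add: laplacian_def algebra_simps)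
qed

lemma Ck_on_cmod_square:
  assumes "open U" "f holomorphic_on U"
  shows "Ck_on k (\<lambda>z. (cmod (f z))\<^sup>2) U"
proof -
  have "Ck_on k (\<lambda>z. Re (f z) * Re (f z) + Im (f z) * Im (f z)) U"
    by (intro Ck_on_add Ck_on_mult assms(1) Ck_on_linear[OF bounded_linear_Re] Ck_on_linear[OF bounded_linear_Im]
        Ck_on_holomorphic assms(2))
  moreover have "(cmod (f z))\<^sup>2 = Re (f z) * Re (f z) + Im (f z) * Im (f z)" for z
    using cmod_power2[of "f z"] by (simp only: power2_eq_square)
  ultimately show ?thesis by simp
qed

lemma hdens_pos: "deriv g z \<noteq> 0 \<Longrightarrow> (cmod (g z))\<^sup>2 \<noteq> 1 \<Longrightarrow> hdens g z > 0"
  by (simp add: hdens_def)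

lemma powr_half_square: "((x::real)\<^sup>2) powr (1/2) = \<bar>x\<bar>"
  by (metis abs_ge_zero powr_half_sqrt power2_abs real_sqrt_abs zero_le_power2)

lemma Ck_on_hdens:
  assumes "open U" "g holomorphic_on U" "\<And>z. z \<in> U \<Longrightarrow> deriv g z \<noteq> 0" "\<And>z. z \<in> U \<Longrightarrow> (cmod (g z))\<^sup>2 \<noteq> 1"
  shows "Ck_on k (hdens g) U"
proof -
  have *: "Ck_on k (\<lambda>z. (cmod (g z))\<^sup>2 - 1) U"
    by (intro Ck_on_diff Ck_on_const Ck_on_cmod_square assms)
  \<comment> \<open>Modulus and absolute value are rewritten as square roots of positive smooth
    functions, which makes the regularity visible.\<close>
  have "Ck_on k (\<lambda>z. ((cmod (deriv g z))\<^sup>2) powr (1/2) * (((cmod (g z))\<^sup>2 - 1) * ((cmod (g z))\<^sup>2 - 1)) powr (- (1/2))) U"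
    by (intro Ck_on_mult Ck_on_powr Ck_on_cmod_square assms(1) holomorphic_deriv assms(2) *)
       (use assms(3,4) in \<open>auto simp: zero_less_mult_iff less_le\<close>)
  moreover have "((cmod (deriv g z))\<^sup>2) powr (1/2) * (((cmod (g z))\<^sup>2 - 1) * ((cmod (g z))\<^sup>2 - 1)) powr (- (1/2)) = hdens g z" for z
    unfolding power2_eq_square[of "(cmod (g z))\<^sup>2 - 1", symmetric] powr_minus powr_half_square
    by (simp add: hdens_def divide_inverse)
  ultimately show ?thesis by simp
qed

text \<open>The assertion is local. On a disc about z the function g is the quotient of a pair of
  Wronskian 1, and ln \<open>hdens\<close> is -ln (\<sigma> \<open>pform\<close>) with a constant
  sign \<sigma>.\<close>

lemma laplacian_ln_hdens:
  assumes "open U" "g holomorphic_on U" "\<And>z. z \<in> U \<Longrightarrow> deriv g z \<noteq> 0" "\<And>z. z \<in> U \<Longrightarrow> (cmod (g z))\<^sup>2 \<noteq> 1"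
    and z: "z \<in> U"
  shows "laplacian (\<lambda>z. ln (hdens g z)) z = 4 * (hdens g z)\<^sup>2"
proof -
  obtain r where r: "r > 0" "ball z r \<subseteq> U" using assms(1) z open_contains_ball by blast
  have zB: "z \<in> ball z r" using r by simp
  have hg: "g holomorphic_on ball z r" using holomorphic_on_subset[OF assms(2) r(2)] .
  obtain y\<^sub>1 y\<^sub>2 where y: "wpair (ball z r) y\<^sub>1 y\<^sub>2" "\<And>w. w \<in> ball z r \<Longrightarrow> y\<^sub>2 w \<noteq> 0"
    "\<And>w. w \<in> ball z r \<Longrightarrow> g w = y\<^sub>1 w / y\<^sub>2 w" "\<And>w. w \<in> ball z r \<Longrightarrow> deriv g w = 1 / (y\<^sub>2 w)\<^sup>2"
    using wpair_exists[OF hg] assms(3) r(2) by blast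
  have ne: "pform y\<^sub>1 y\<^sub>2 w \<noteq> 0" if w: "w \<in> ball z r" for w
    using pform_quotient[of y\<^sub>2 w g y\<^sub>1, OF y(2,3)[OF w]] y(2)[OF w] assms(4)[of w] r(2) w by auto
  have cont: "continuous_on (ball z r) (pform y\<^sub>1 y\<^sub>2)"
    using y(1) unfolding pform_def wpair_def
    by (auto intro!: continuous_intros holomorphic_on_imp_continuous_on)
  obtain \<sigma> :: real where \<sigma>: "\<sigma>\<^sup>2 = 1" "\<And>w. w \<in> ball z r \<Longrightarrow> \<sigma> * pform y\<^sub>1 y\<^sub>2 w > 0"
    using constant_sign[OF connected_ball cont ne] by blast
  have eq: "hdens g w = 1 / (\<sigma> * pform y\<^sub>1 y\<^sub>2 w)" if w: "w \<in> ball z r" for w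
  proof -
    have "\<bar>pform y\<^sub>1 y\<^sub>2 w\<bar> = \<sigma> * pform y\<^sub>1 y\<^sub>2 w"
      using \<sigma>(1) \<sigma>(2)[OF w] by (auto simp: power2_eq_1_iff)
    then show ?thesis using hdens_pform[of y\<^sub>2 w g y\<^sub>1, OF y(2-4)[OF w]] by simp
  qed
  have "laplacian (\<lambda>z. ln (hdens g z)) z = laplacian (\<lambda>w. (-1) * ln (\<sigma> * pform y\<^sub>1 y\<^sub>2 w) + 0 * 0 + 0) z"
  proof (rule laplacian_cong[OF open_ball zB])
    fix w assume w: "w \<in> ball z r"
    have "ln (1 / (\<sigma> * pform y\<^sub>1 y\<^sub>2 w)) = - ln (\<sigma> * pform y\<^sub>1 y\<^sub>2 w)"
      using ln_inverse[of "\<sigma> * pform y\<^sub>1 y\<^sub>2 w"] \<sigma>(2)[OF w] by (simp add: inverse_eq_divide)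
    then show "ln (hdens g w) = (-1) * ln (\<sigma> * pform y\<^sub>1 y\<^sub>2 w) + 0 * 0 + 0" using eq[OF w] by simp
  qed
  also have "\<dots> = (-1) * laplacian (\<lambda>w. ln (\<sigma> * pform y\<^sub>1 y\<^sub>2 w)) z + 0 * laplacian (\<lambda>z. 0) z"
  proof (rule laplacian_combination[OF open_ball _ Ck_on_const zB])
    show "Ck_on 2 (\<lambda>w. ln (\<sigma> * pform y\<^sub>1 y\<^sub>2 w)) (ball z r)"
      using y(1) \<sigma>(2) unfolding wpair_def pform_def
      by (intro Ck_on_ln Ck_on_mult Ck_on_diff Ck_on_const Ck_on_cmod_square) auto
  qed
  also have "\<dots> = 4 * (hdens g z)\<^sup>2"
    using laplacian_ln_pform[OF y(1) \<sigma> zB] \<sigma>(1) by (simp add: eq[OF zB] power_divide power_mult_distrib)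
  finally show ?thesis .
qed

text \<open>Equal densities mean forms of equal absolute value, which on a connected disc differ by
  a constant sign \<tau>. Since \<open>pform\<close> has the sign of 1 - |g|^2, this \<tau> records
  whether g and h lie on the same side of the unit circle.\<close>

lemma hyperbolic_isometry:
  assumes g: "g holomorphic_on ball c r" "\<And>z. z \<in> ball c r \<Longrightarrow> deriv g z \<noteq> 0" "\<And>z. z \<in> ball c r \<Longrightarrow> (cmod (g z))\<^sup>2 \<noteq> 1"
    and h: "h holomorphic_on ball c r" "\<And>z. z \<in> ball c r \<Longrightarrow> deriv h z \<noteq> 0" "\<And>z. z \<in> ball c r \<Longrightarrow> (cmod (h z))\<^sup>2 \<noteq> 1"
    and eq: "\<And>z. z \<in> ball c r \<Longrightarrow> hdens g z = hdens h z" and "r > 0"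
  obtains a b where
    "(cmod a)\<^sup>2 - (cmod b)\<^sup>2 = sgn (((cmod (g c))\<^sup>2 - 1) * ((cmod (h c))\<^sup>2 - 1))"
    "moebius_related (ball c r) a b g h"
proof -
  let ?B = "ball c r"
  have cB: "c \<in> ?B" using \<open>r > 0\<close> by simp
  obtain y\<^sub>1 y\<^sub>2 where y: "wpair ?B y\<^sub>1 y\<^sub>2" "\<And>w. w \<in> ?B \<Longrightarrow> y\<^sub>2 w \<noteq> 0"
    "\<And>w. w \<in> ?B \<Longrightarrow> g w = y\<^sub>1 w / y\<^sub>2 w" "\<And>w. w \<in> ?B \<Longrightarrow> deriv g w = 1 / (y\<^sub>2 w)\<^sup>2"
    using wpair_exists[OF g(1,2)] by blast
  obtain Y\<^sub>1 Y\<^sub>2 where Y: "wpair ?B Y\<^sub>1 Y\<^sub>2" "\<And>w. w \<in> ?B \<Longrightarrow> Y\<^sub>2 w \<noteq> 0"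
    "\<And>w. w \<in> ?B \<Longrightarrow> h w = Y\<^sub>1 w / Y\<^sub>2 w" "\<And>w. w \<in> ?B \<Longrightarrow> deriv h w = 1 / (Y\<^sub>2 w)\<^sup>2"
    using wpair_exists[OF h(1,2)] by blast
  note fy = pform_quotient[of y\<^sub>2 _ g y\<^sub>1, OF y(2,3)] and fY = pform_quotient[of Y\<^sub>2 _ h Y\<^sub>1, OF Y(2,3)]
  have ney: "pform y\<^sub>1 y\<^sub>2 w \<noteq> 0" and neY: "pform Y\<^sub>1 Y\<^sub>2 w \<noteq> 0" if "w \<in> ?B" for w
    unfolding fy[OF that that] fY[OF that that] using y(2)[OF that] Y(2)[OF that] g(3)[OF that] h(3)[OF that] by auto
  have ab: "\<bar>pform Y\<^sub>1 Y\<^sub>2 w\<bar> = \<bar>pform y\<^sub>1 y\<^sub>2 w\<bar>" if "w \<in> ?B" for w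
    using eq[OF that] hdens_pform[of y\<^sub>2 w g y\<^sub>1, OF y(2-4)[OF that]] hdens_pform[of Y\<^sub>2 w h Y\<^sub>1, OF Y(2-4)[OF that]]
      ney[OF that] neY[OF that] by simp
  have cont: "continuous_on ?B (\<lambda>w. pform Y\<^sub>1 Y\<^sub>2 w * pform y\<^sub>1 y\<^sub>2 w)"
    using y(1) Y(1) unfolding pform_def wpair_def
    by (auto intro!: continuous_intros holomorphic_on_imp_continuous_on)
  have ne: "pform Y\<^sub>1 Y\<^sub>2 w * pform y\<^sub>1 y\<^sub>2 w \<noteq> 0" if "w \<in> ?B" for w
    using ney[OF that] neY[OF that] by simp
  obtain \<tau> :: real where \<tau>: "\<tau>\<^sup>2 = 1" "\<And>w. w \<in> ?B \<Longrightarrow> \<tau> * (pform Y\<^sub>1 Y\<^sub>2 w * pform y\<^sub>1 y\<^sub>2 w) > 0"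
    using constant_sign[OF connected_ball cont ne] by blast
  have \<tau>1: "\<tau> = 1 \<or> \<tau> = -1" using \<tau>(1) by (simp add: power2_eq_1_iff)
  have proportional: "pform Y\<^sub>1 Y\<^sub>2 w = \<tau> * pform y\<^sub>1 y\<^sub>2 w" if "w \<in> ?B" for w
    using \<tau>1 \<tau>(2)[OF that] ab[OF that] by (auto simp: abs_if mult_less_0_iff zero_less_mult_iff split: if_splits)
  obtain a b k where k: "k \<noteq> 0" "(cmod a)\<^sup>2 - (cmod b)\<^sup>2 = \<tau>"
    "\<And>z. z \<in> ?B \<Longrightarrow> k * Y\<^sub>1 z = a * y\<^sub>1 z + cnj b * y\<^sub>2 z"
    "\<And>z. z \<in> ?B \<Longrightarrow> k * Y\<^sub>2 z = b * y\<^sub>1 z + cnj a * y\<^sub>2 z"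
    using liouville_unique[OF y(1) Y(1) \<open>r > 0\<close> \<tau>(1) ney proportional] by blast
  have "\<tau> = sgn (((cmod (g c))\<^sup>2 - 1) * ((cmod (h c))\<^sup>2 - 1))"
  proof -
    have "\<tau> * ((cmod (Y\<^sub>2 c))\<^sup>2 * (cmod (y\<^sub>2 c))\<^sup>2 * (((cmod (g c))\<^sup>2 - 1) * ((cmod (h c))\<^sup>2 - 1))) > 0"
      using \<tau>(2)[OF cB] unfolding fy[OF cB cB] fY[OF cB cB] by (simp add: algebra_simps)
    then have "((cmod (Y\<^sub>2 c))\<^sup>2 * (cmod (y\<^sub>2 c))\<^sup>2) * (\<tau> * (((cmod (g c))\<^sup>2 - 1) * ((cmod (h c))\<^sup>2 - 1))) > 0"
      by (simp only: mult.left_commute mult.assoc)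
    moreover have "(cmod (Y\<^sub>2 c))\<^sup>2 * (cmod (y\<^sub>2 c))\<^sup>2 > 0" using y(2)[OF cB] Y(2)[OF cB] by simp
    ultimately have "\<tau> * (((cmod (g c))\<^sup>2 - 1) * ((cmod (h c))\<^sup>2 - 1)) > 0"
      by (rule zero_less_mult_pos)
    then show ?thesis using \<tau>1 by (auto simp: sgn_if)
  qed
  moreover have "moebius_related ?B a b g h"
    unfolding moebius_related_def
  proof
    fix z assume z: "z \<in> ?B"
    have d: "b * g z + cnj a = k * Y\<^sub>2 z / y\<^sub>2 z" "a * g z + cnj b = k * Y\<^sub>1 z / y\<^sub>2 z"
      unfolding k(3,4)[OF z] y(3)[OF z] using y(2)[OF z] by (simp_all add: field_simps)
    show "b * g z + cnj a \<noteq> 0 \<and> h z = (a * g z + cnj b) / (b * g z + cnj a)"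
      unfolding d using k(1) y(2)[OF z] Y(2)[OF z] Y(3)[OF z] by simp
  qed
  ultimately show ?thesis using that k(2) by simp
qed

section \<open>Moebius transformations\<close>

lemma cmod_diff_eq:
  "(cmod a)\<^sup>2 - (cmod b)\<^sup>2 = t \<longleftrightarrow> a * cnj a - b * cnj b = of_real t"
  unfolding complex_norm_square[symmetric] of_real_diff[symmetric] of_real_eq_iff ..

lemma moebius_refl: "moebius_related D 1 0 g g"
  by (simp add: moebius_related_def)

lemma moebius_mono: "moebius_related D a b g h \<Longrightarrow> E \<subseteq> D \<Longrightarrow> moebius_related E a b g h"
  by (auto simp: moebius_related_def)

text \<open>The inverse of the matrix with rows (a, cnj b) and (b, cnj a) is t times its adjugate,
  and the scalar t drops out of the quotient.\<close>

lemma moebius_sym: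
  assumes "moebius_related D a b g h" "(cmod a)\<^sup>2 - (cmod b)\<^sup>2 = t" "\<bar>t\<bar> = 1"
  shows "moebius_related D (cnj a) (- b) h g"
  unfolding moebius_related_def
proof
  fix z assume z: "z \<in> D"
  have n: "b * g z + cnj a \<noteq> 0" and h: "h z = (a * g z + cnj b) / (b * g z + cnj a)"
    using assms(1) z by (auto simp: moebius_related_def)
  have t: "a * cnj a - b * cnj b = of_real t" using assms(2) cmod_diff_eq by blast
  have hn: "h z * (b * g z + cnj a) = a * g z + cnj b" using n h by simp
  have 1: "(- b * h z + a) * (b * g z + cnj a) = of_real t" using hn t by algebra
  have 2: "(cnj a * h z - cnj b) * (b * g z + cnj a) = of_real t * g z" using hn t by algebra
  have 3: "- b * h z + a \<noteq> 0" using 1 assms(3) by auto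
  have "g z * (- b * h z + a) * (b * g z + cnj a) = (cnj a * h z - cnj b) * (b * g z + cnj a)"
    unfolding 2 mult.assoc 1 by simp
  then have "g z * (- b * h z + a) = cnj a * h z - cnj b" using n by simp
  with 3 show "- b * h z + cnj (cnj a) \<noteq> 0 \<and> g z = (cnj a * h z + cnj (- b)) / (- b * h z + cnj (cnj a))"
    by (simp add: field_simps)
qed

lemma moebius_trans:
  assumes "moebius_related D a b g h" "moebius_related D a' b' h k"
  shows "moebius_related D (a' * a + cnj b' * b) (b' * a + cnj a' * b) g k"
  unfolding moebius_related_def
proof
  fix z assume z: "z \<in> D"
  have n: "b * g z + cnj a \<noteq> 0" and h: "h z = (a * g z + cnj b) / (b * g z + cnj a)"
    and n': "b' * h z + cnj a' \<noteq> 0" and k: "k z = (a' * h z + cnj b') / (b' * h z + cnj a')"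
    using assms z by (auto simp: moebius_related_def)
  have hn: "h z * (b * g z + cnj a) = a * g z + cnj b" using n h by simp
  have 1: "(b' * a + cnj a' * b) * g z + cnj (a' * a + cnj b' * b) = (b' * h z + cnj a') * (b * g z + cnj a)"
    using hn by simp algebra
  have 2: "(a' * a + cnj b' * b) * g z + cnj (b' * a + cnj a' * b) = (a' * h z + cnj b') * (b * g z + cnj a)"
    using hn by simp algebra
  show "(b' * a + cnj a' * b) * g z + cnj (a' * a + cnj b' * b) \<noteq> 0 \<and>
      k z = ((a' * a + cnj b' * b) * g z + cnj (b' * a + cnj a' * b)) / ((b' * a + cnj a' * b) * g z + cnj (a' * a + cnj b' * b))"
    unfolding 1 2 using n n' k by simp
qed

lemma moebius_norm_mult:
  assumes "(cmod a)\<^sup>2 - (cmod b)\<^sup>2 = t" "(cmod a')\<^sup>2 - (cmod b')\<^sup>2 = t'"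
  shows "(cmod (a' * a + cnj b' * b))\<^sup>2 - (cmod (b' * a + cnj a' * b))\<^sup>2 = t * t'"
proof -
  note p = assms[unfolded cmod_diff_eq]
  show ?thesis unfolding cmod_diff_eq of_real_mult p[symmetric] by (simp add: algebra_simps)
qed

lemma moebius_deriv:
  assumes "moebius_related D a b g h" "open D" "g holomorphic_on D" "(cmod a)\<^sup>2 - (cmod b)\<^sup>2 = t" "z \<in> D"
  shows "deriv h z = of_real t * deriv g z / (b * g z + cnj a)\<^sup>2"
proof -
  have n: "b * g z + cnj a \<noteq> 0" using assms by (auto simp: moebius_related_def)
  have t: "a * cnj a - b * cnj b = of_real t" using assms(4) cmod_diff_eq by blast
  have g: "(g has_field_derivative deriv g z) (at z)" by (rule holomorphic_derivI[OF assms(3,2,5)])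
  have "((\<lambda>z. (a * g z + cnj b) / (b * g z + cnj a)) has_field_derivative
     ((a * deriv g z) * (b * g z + cnj a) - (a * g z + cnj b) * (b * deriv g z)) / ((b * g z + cnj a) * (b * g z + cnj a))) (at z)"
    using n by (auto intro!: derivative_eq_intros g)
  also have "(a * deriv g z) * (b * g z + cnj a) - (a * g z + cnj b) * (b * deriv g z) = of_real t * deriv g z"
    unfolding t[symmetric] by (simp add: algebra_simps)
  finally have *: "((\<lambda>z. (a * g z + cnj b) / (b * g z + cnj a)) has_field_derivative
      of_real t * deriv g z / (b * g z + cnj a)\<^sup>2) (at z)" by (simp add: power2_eq_square)
  have "(h has_field_derivative of_real t * deriv g z / (b * g z + cnj a)\<^sup>2) (at z)"
    by (rule has_field_derivative_transform_within_open[OF * assms(2,5)])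
       (use assms(1) in \<open>simp add: moebius_related_def\<close>)
  then show ?thesis by (rule DERIV_imp_deriv)
qed

text \<open>The factor |bg + cnj a|^2 divides both the derivative and |h|^2 - 1, and cancels. For t
  = -1 the map exchanges the disc and its exterior, which the absolute value in \<open>hdens\<close>
  does not notice.\<close>

lemma moebius_hdens:
  assumes "moebius_related D a b g h" "open D" "g holomorphic_on D" "(cmod a)\<^sup>2 - (cmod b)\<^sup>2 = t" "\<bar>t\<bar> = 1" "z \<in> D"
  shows "hdens h z = hdens g z"
proof -
  let ?n = "b * g z + cnj a"
  have n: "?n \<noteq> 0" and h: "h z = (a * g z + cnj b) / ?n" using assms by (auto simp: moebius_related_def)
  have t: "a * cnj a - b * cnj b = of_real t" using assms(4) cmod_diff_eq by blast
  have *: "(cmod (a * g z + cnj b))\<^sup>2 - (cmod ?n)\<^sup>2 = t * ((cmod (g z))\<^sup>2 - 1)"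
    unfolding cmod_diff_eq of_real_mult of_real_diff complex_norm_square t[symmetric] by (simp add: algebra_simps)
  have "(cmod (h z))\<^sup>2 - 1 = ((cmod (a * g z + cnj b))\<^sup>2 - (cmod ?n)\<^sup>2) / (cmod ?n)\<^sup>2"
    unfolding h using n by (simp add: norm_divide power_divide diff_divide_distrib)
  then have "\<bar>(cmod (h z))\<^sup>2 - 1\<bar> = \<bar>(cmod (g z))\<^sup>2 - 1\<bar> / (cmod ?n)\<^sup>2"
    unfolding * using assms(5) by (simp add: abs_mult)
  moreover have "cmod (deriv h z) = cmod (deriv g z) / (cmod ?n)\<^sup>2"
    unfolding moebius_deriv[OF assms(1-4,6)] using assms(5) by (simp add: norm_divide norm_mult norm_power)
  ultimately show ?thesis
    using n by (simp add: hdens_def)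
qed

section \<open>The two curvature functions in terms of the hyperbolic densities\<close>

lemma curvatures_hdens:
  assumes "((cmod (g\<^sub>1 z))\<^sup>2 - 1) * ((cmod (g\<^sub>2 z))\<^sup>2 - 1) > 0"
  shows "K_of g\<^sub>1 g\<^sub>2 z = 8 * (hdens g\<^sub>1 z * hdens g\<^sub>2 z) * ((hdens g\<^sub>1 z)\<^sup>2 + (hdens g\<^sub>2 z)\<^sup>2)"
    and "kappa_of g\<^sub>1 g\<^sub>2 z = 8 * (hdens g\<^sub>1 z * hdens g\<^sub>2 z) * ((hdens g\<^sub>2 z)\<^sup>2 - (hdens g\<^sub>1 z)\<^sup>2)"
proof -
  have p: "hdens g\<^sub>1 z * hdens g\<^sub>2 z = cmod (deriv g\<^sub>1 z * deriv g\<^sub>2 z) / (((cmod (g\<^sub>1 z))\<^sup>2 - 1) * ((cmod (g\<^sub>2 z))\<^sup>2 - 1))"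
    using assms by (simp add: hdens_def norm_mult abs_mult[symmetric])
  have s: "(hdens g z)\<^sup>2 = (cmod (deriv g z))\<^sup>2 / ((cmod (g z))\<^sup>2 - 1)\<^sup>2" for g
    by (simp add: hdens_def power_divide)
  show "K_of g\<^sub>1 g\<^sub>2 z = 8 * (hdens g\<^sub>1 z * hdens g\<^sub>2 z) * ((hdens g\<^sub>1 z)\<^sup>2 + (hdens g\<^sub>2 z)\<^sup>2)"
    unfolding p s K_of_def by simp
  have r: "- 8 * n / d * (x - y) = 8 * (n / d) * (y - x)" for n d x y :: real
    by (simp add: right_diff_distrib)
  show "kappa_of g\<^sub>1 g\<^sub>2 z = 8 * (hdens g\<^sub>1 z * hdens g\<^sub>2 z) * ((hdens g\<^sub>2 z)\<^sup>2 - (hdens g\<^sub>1 z)\<^sup>2)"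
    unfolding p s kappa_of_def by (rule r)
qed

text \<open>Here K + \<kappa> = 16 a b^3 and K - \<kappa> = 16 a^3 b. Hence the fourth root is 4ab,
  the square root of the quotient is b/a, and the two logarithms are ln a + ln b + ln 4 and ln b -
  ln a: the natural equations are the sum and the difference of the two Liouville equations.\<close>

lemma natural_equations_liouville:
  assumes U: "open U" "Ck_on 2 a U" "Ck_on 2 b U" "\<And>z. z \<in> U \<Longrightarrow> a z > 0" "\<And>z. z \<in> U \<Longrightarrow> b z > 0"
    and L: "laplacian (\<lambda>z. ln (a z)) z = 4 * (a z)\<^sup>2" "laplacian (\<lambda>z. ln (b z)) z = 4 * (b z)\<^sup>2"
    and K: "\<And>z. z \<in> U \<Longrightarrow> K z = 8 * (a z * b z) * ((a z)\<^sup>2 + (b z)\<^sup>2)"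
    and \<kappa>: "\<And>z. z \<in> U \<Longrightarrow> \<kappa> z = 8 * (a z * b z) * ((b z)\<^sup>2 - (a z)\<^sup>2)"
    and z: "z \<in> U"
  shows "natural_equations K \<kappa> z"
proof -
  have sq: "(K w)\<^sup>2 - (\<kappa> w)\<^sup>2 = (4 * (a w * b w)) ^ 4" if "w \<in> U" for w
    unfolding K[OF that] \<kappa>[OF that] by algebra
  have rt: "root 4 ((K w)\<^sup>2 - (\<kappa> w)\<^sup>2) = 4 * (a w * b w)" if w: "w \<in> U" for w
    unfolding sq[OF w] by (rule real_root_pos2) (use U(4,5)[OF w] in \<open>auto intro: less_imp_le mult_pos_pos\<close>)
  have l1: "ln (root 4 ((K w)\<^sup>2 - (\<kappa> w)\<^sup>2)) = 1 * ln (a w) + 1 * ln (b w) + ln 4" if w: "w \<in> U" for w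
    unfolding rt[OF w] using U(4,5)[OF w] by (simp add: ln_mult)
  have l2: "ln (sqrt ((K w + \<kappa> w) / (K w - \<kappa> w))) = (-1) * ln (a w) + 1 * ln (b w) + 0" if w: "w \<in> U" for w
  proof -
    have "K w + \<kappa> w = (b w / a w)\<^sup>2 * (K w - \<kappa> w)" "K w - \<kappa> w > 0"
      unfolding K[OF w] \<kappa>[OF w] using U(4,5)[OF w]
      by (simp_all add: field_simps power2_eq_square)
    then have "(K w + \<kappa> w) / (K w - \<kappa> w) = (b w / a w)\<^sup>2" by simp
    then show ?thesis using U(4,5)[OF w] by (simp add: ln_div)
  qed
  have C: "Ck_on 2 (\<lambda>z. ln (a z)) U" "Ck_on 2 (\<lambda>z. ln (b z)) U" using Ck_on_ln U by blast+
  have L1: "laplacian (\<lambda>w. ln (root 4 ((K w)\<^sup>2 - (\<kappa> w)\<^sup>2))) z = 4 * (a z)\<^sup>2 + 4 * (b z)\<^sup>2"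
    using laplacian_cong[OF U(1) z l1] laplacian_combination[OF U(1) C z, of 1 1 "ln 4"] L by simp
  have L2: "laplacian (\<lambda>w. ln (sqrt ((K w + \<kappa> w) / (K w - \<kappa> w)))) z = 4 * (b z)\<^sup>2 - 4 * (a z)\<^sup>2"
    using laplacian_cong[OF U(1) z l2] laplacian_combination[OF U(1) C z, of "-1" 1 0] L by simp
  have ab: "a z * b z > 0" using U(4,5)[OF z] by simp
  show ?thesis
    unfolding natural_equations_def L1 L2 rt[OF z]
  proof (intro conjI)
    show "4 * (a z * b z) * (4 * (a z)\<^sup>2 + 4 * (b z)\<^sup>2) = 2 * K z" unfolding K[OF z] by (simp add: algebra_simps)
    show "4 * (a z * b z) * (4 * (b z)\<^sup>2 - 4 * (a z)\<^sup>2) = 2 * \<kappa> z" unfolding \<kappa>[OF z] by (simp add: algebra_simps)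
    show "0 < (K z)\<^sup>2 - (\<kappa> z)\<^sup>2" unfolding sq[OF z] using U(4,5)[OF z] by simp
    have "(a z)\<^sup>2 + (b z)\<^sup>2 > 0" using U(4,5)[OF z] by (simp add: pos_add_strict)
    then show "0 < K z" unfolding K[OF z] using ab by simp
  qed
qed

lemma HH_D:
  assumes "(D, g\<^sub>1, g\<^sub>2) \<in> HH"
  shows "open D" "0 \<in> D" "g\<^sub>1 holomorphic_on D" "g\<^sub>2 holomorphic_on D"
    and "\<And>z. z \<in> D \<Longrightarrow> deriv g\<^sub>1 z \<noteq> 0" "\<And>z. z \<in> D \<Longrightarrow> deriv g\<^sub>2 z \<noteq> 0"
    and "\<And>z. z \<in> D \<Longrightarrow> ((cmod (g\<^sub>1 z))\<^sup>2 - 1) * ((cmod (g\<^sub>2 z))\<^sup>2 - 1) > 0"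
    and "\<And>z. z \<in> D \<Longrightarrow> (cmod (g\<^sub>1 z))\<^sup>2 \<noteq> 1" "\<And>z. z \<in> D \<Longrightarrow> (cmod (g\<^sub>2 z))\<^sup>2 \<noteq> 1"
  using assms by (fastforce simp: HH_def nbhd0_def)+

text \<open>K and \<kappa> need to agree with the formulas only on U. So the lemma applies to the
  formulas themselves and also to the curvatures of a surface near a given point.\<close>

lemma formula_natural:
  assumes U: "open U" "g\<^sub>1 holomorphic_on U" "g\<^sub>2 holomorphic_on U"
    and d: "\<And>z. z \<in> U \<Longrightarrow> deriv g\<^sub>1 z * deriv g\<^sub>2 z \<noteq> 0"
    and p: "\<And>z. z \<in> U \<Longrightarrow> ((cmod (g\<^sub>1 z))\<^sup>2 - 1) * ((cmod (g\<^sub>2 z))\<^sup>2 - 1) > 0"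
    and K: "\<And>z. z \<in> U \<Longrightarrow> K z = K_of g\<^sub>1 g\<^sub>2 z" and \<kappa>: "\<And>z. z \<in> U \<Longrightarrow> \<kappa> z = kappa_of g\<^sub>1 g\<^sub>2 z"
  shows "Ck_on 2 K U" "Ck_on 2 \<kappa> U" "z \<in> U \<Longrightarrow> natural_equations K \<kappa> z"
proof -
  have n: "deriv g\<^sub>1 z \<noteq> 0" "deriv g\<^sub>2 z \<noteq> 0" "(cmod (g\<^sub>1 z))\<^sup>2 \<noteq> 1" "(cmod (g\<^sub>2 z))\<^sup>2 \<noteq> 1" if "z \<in> U" for z
    using d[OF that] p[OF that] by auto
  have C: "Ck_on 2 (hdens g\<^sub>1) U" "Ck_on 2 (hdens g\<^sub>2) U"
    by (rule Ck_on_hdens; use U n in blast)+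
  have h: "hdens g\<^sub>1 z > 0" "hdens g\<^sub>2 z > 0" if "z \<in> U" for z
    using hdens_pos n[OF that] by auto
  have K': "K z = 8 * (hdens g\<^sub>1 z * hdens g\<^sub>2 z) * ((hdens g\<^sub>1 z)\<^sup>2 + (hdens g\<^sub>2 z)\<^sup>2)"
    and \<kappa>': "\<kappa> z = 8 * (hdens g\<^sub>1 z * hdens g\<^sub>2 z) * ((hdens g\<^sub>2 z)\<^sup>2 - (hdens g\<^sub>1 z)\<^sup>2)" if "z \<in> U" for z
    using K[OF that] \<kappa>[OF that] curvatures_hdens[of g\<^sub>1 z g\<^sub>2, OF p[OF that]] by auto
  show "Ck_on 2 K U"
    by (rule Ck_on_cong[OF U(1) K'[symmetric]], assumption, unfold power2_eq_square)
       (intro Ck_on_mult Ck_on_add Ck_on_const C U(1))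
  show "Ck_on 2 \<kappa> U"
    by (rule Ck_on_cong[OF U(1) \<kappa>'[symmetric]], assumption, unfold power2_eq_square)
       (intro Ck_on_mult Ck_on_diff Ck_on_const C U(1))
  assume z: "z \<in> U"
  show "natural_equations K \<kappa> z"
    by (rule natural_equations_liouville[OF U(1) C h laplacian_ln_hdens[OF U(1,2) n(1) n(3) z]
          laplacian_ln_hdens[OF U(1,3) n(2) n(4) z] K' \<kappa>' z])
qed

lemma formula_SNE:
  assumes "(D, g\<^sub>1, g\<^sub>2) \<in> HH"
  shows "(D, K_of g\<^sub>1 g\<^sub>2, kappa_of g\<^sub>1 g\<^sub>2) \<in> SNE"
  using formula_natural[OF HH_D(1,3,4)[OF assms] _ HH_D(7)[OF assms], of "K_of g\<^sub>1 g\<^sub>2" "kappa_of g\<^sub>1 g\<^sub>2"]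
    HH_D(1,2,5,6)[OF assms] by (auto simp: SNE_def nbhd0_def)

text \<open>Sum and difference of the two equations fix a^3 b and a b^3; their product (ab)^4 fixes
  ab, and division gives the squares.\<close>

lemma positive_pair_determined:
  fixes a b a' b' :: real
  assumes "a > 0" "b > 0" "a' > 0" "b' > 0"
    and "8 * (a * b) * (a\<^sup>2 + b\<^sup>2) = 8 * (a' * b') * (a'\<^sup>2 + b'\<^sup>2)"
    and "8 * (a * b) * (b\<^sup>2 - a\<^sup>2) = 8 * (a' * b') * (b'\<^sup>2 - a'\<^sup>2)"
  shows "a = a'" "b = b'"
proof -
  have 1: "a\<^sup>2 * (a * b) = a'\<^sup>2 * (a' * b')" and 2: "b\<^sup>2 * (a * b) = b'\<^sup>2 * (a' * b')"
    using assms(5,6) by (simp_all add: algebra_simps)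
  have "(a * b) ^ 4 = (a\<^sup>2 * (a * b)) * (b\<^sup>2 * (a * b))" by algebra
  also have "\<dots> = (a' * b') ^ 4" unfolding 1 2 by algebra
  finally have "(a * b) ^ 4 = (a' * b') ^ 4" .
  then have e: "a * b = a' * b'"
    by (rule power_eq_imp_eq_base) (use assms(1-4) in simp_all)
  have n: "a' * b' \<noteq> 0" using assms(3,4) by simp
  have "a\<^sup>2 = a'\<^sup>2" "b\<^sup>2 = b'\<^sup>2" 
    using 1[unfolded e] 2[unfolded e] mult_right_cancel[OF n] by blast+
  then show "a = a'" "b = b'" using power2_eq_imp_eq assms(1-4) by (meson less_imp_le)+
qed

lemma SNE_equivI:
  assumes "(D, K, \<kappa>) \<in> SNE" "(E, L, l) \<in> SNE" "nbhd0 U" "U \<subseteq> D \<inter> E"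
    "\<And>z. z \<in> U \<Longrightarrow> L z = K z \<and> l z = \<kappa> z"
  shows "((D, K, \<kappa>), (E, L, l)) \<in> SNE_equiv"
  unfolding SNE_equiv_def mem_Collect_eq prod.case
  by (intro conjI exI[of _ U] ballI) (use assms in auto)

lemma HH_equivI:
  assumes "(D, g\<^sub>1, g\<^sub>2) \<in> HH" "(E, h\<^sub>1, h\<^sub>2) \<in> HH" "nbhd0 U" "U \<subseteq> D \<inter> E"
    "(cmod a\<^sub>1)\<^sup>2 - (cmod b\<^sub>1)\<^sup>2 = 1 \<and> (cmod a\<^sub>2)\<^sup>2 - (cmod b\<^sub>2)\<^sup>2 = 1 \<or>
      (cmod a\<^sub>1)\<^sup>2 - (cmod b\<^sub>1)\<^sup>2 = -1 \<and> (cmod a\<^sub>2)\<^sup>2 - (cmod b\<^sub>2)\<^sup>2 = -1"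
    "moebius_related U a\<^sub>1 b\<^sub>1 g\<^sub>1 h\<^sub>1" "moebius_related U a\<^sub>2 b\<^sub>2 g\<^sub>2 h\<^sub>2"
  shows "((D, g\<^sub>1, g\<^sub>2), (E, h\<^sub>1, h\<^sub>2)) \<in> HH_equiv"
  unfolding HH_equiv_def mem_Collect_eq prod.case
  by (intro conjI exI[of _ U] exI[of _ a\<^sub>1] exI[of _ b\<^sub>1] exI[of _ a\<^sub>2] exI[of _ b\<^sub>2]) (fact assms)+

lemma HH_equivE:
  assumes "((D, g\<^sub>1, g\<^sub>2), (E, h\<^sub>1, h\<^sub>2)) \<in> HH_equiv"
  obtains U a\<^sub>1 b\<^sub>1 a\<^sub>2 b\<^sub>2 where "(D, g\<^sub>1, g\<^sub>2) \<in> HH" "(E, h\<^sub>1, h\<^sub>2) \<in> HH" "nbhd0 U" "U \<subseteq> D \<inter> E"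
    "(cmod a\<^sub>1)\<^sup>2 - (cmod b\<^sub>1)\<^sup>2 = 1 \<and> (cmod a\<^sub>2)\<^sup>2 - (cmod b\<^sub>2)\<^sup>2 = 1 \<or>
      (cmod a\<^sub>1)\<^sup>2 - (cmod b\<^sub>1)\<^sup>2 = -1 \<and> (cmod a\<^sub>2)\<^sup>2 - (cmod b\<^sub>2)\<^sup>2 = -1"
    "moebius_related U a\<^sub>1 b\<^sub>1 g\<^sub>1 h\<^sub>1" "moebius_related U a\<^sub>2 b\<^sub>2 g\<^sub>2 h\<^sub>2"
  using assms unfolding HH_equiv_def mem_Collect_eq prod.case by (elim conjE exE) (rule that)

text \<open>In the application p, q are |g_j|^2 - 1 and u, v are |h_j|^2 - 1. The equality of the
  two signs is the condition that \<open>HH_equiv\<close> puts on the two determinants.\<close>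

lemma sgn_cross:
  fixes p q u v :: real
  assumes "p * q > 0" "u * v > 0"
  shows "sgn (p * u) = 1 \<and> sgn (q * v) = 1 \<or> sgn (p * u) = -1 \<and> sgn (q * v) = -1"
  using assms by (auto simp: sgn_mult sgn_if zero_less_mult_iff)

section \<open>Injectivity, compatibility and surjectivity of the formula for the curvatures\<close>

lemma formula_inj:
  assumes H: "(D, g\<^sub>1, g\<^sub>2) \<in> HH" and H': "(D', h\<^sub>1, h\<^sub>2) \<in> HH"
    and e: "((D, K_of g\<^sub>1 g\<^sub>2, kappa_of g\<^sub>1 g\<^sub>2), (D', K_of h\<^sub>1 h\<^sub>2, kappa_of h\<^sub>1 h\<^sub>2)) \<in> SNE_equiv"
  shows "((D, g\<^sub>1, g\<^sub>2), (D', h\<^sub>1, h\<^sub>2)) \<in> HH_equiv"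
proof -
  note g = HH_D[OF H] and h = HH_D[OF H']
  obtain D\<^sub>0 where D0: "open D\<^sub>0" "0 \<in> D\<^sub>0" "D\<^sub>0 \<subseteq> D \<inter> D'"
    "\<And>z. z \<in> D\<^sub>0 \<Longrightarrow> K_of h\<^sub>1 h\<^sub>2 z = K_of g\<^sub>1 g\<^sub>2 z" "\<And>z. z \<in> D\<^sub>0 \<Longrightarrow> kappa_of h\<^sub>1 h\<^sub>2 z = kappa_of g\<^sub>1 g\<^sub>2 z"
    using e unfolding SNE_equiv_def nbhd0_def by auto
  obtain r where r: "r > 0" "ball 0 r \<subseteq> D\<^sub>0" using D0(1,2) open_contains_ball by blast
  let ?B = "ball (0::complex) r"
  have B: "?B \<subseteq> D" "?B \<subseteq> D'" using r(2) D0(3) by auto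
  have eq: "hdens g\<^sub>1 z = hdens h\<^sub>1 z" "hdens g\<^sub>2 z = hdens h\<^sub>2 z" if z: "z \<in> ?B" for z
  proof -
    have zD: "z \<in> D" "z \<in> D'" "z \<in> D\<^sub>0" using z B r by auto
    show "hdens g\<^sub>1 z = hdens h\<^sub>1 z" "hdens g\<^sub>2 z = hdens h\<^sub>2 z"
      using positive_pair_determined[OF hdens_pos[OF g(5,8)] hdens_pos[OF g(6,9)] hdens_pos[OF h(5,8)] hdens_pos[OF h(6,9)], of z z z z]
        zD D0(4,5)[OF zD(3)] curvatures_hdens[of g\<^sub>1 z g\<^sub>2, OF g(7)[OF zD(1)]] curvatures_hdens[of h\<^sub>1 z h\<^sub>2, OF h(7)[OF zD(2)]] by auto
  qed
  have hg: "g\<^sub>1 holomorphic_on ?B" "g\<^sub>2 holomorphic_on ?B" "h\<^sub>1 holomorphic_on ?B" "h\<^sub>2 holomorphic_on ?B"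
    using g(3,4) h(3,4) B holomorphic_on_subset by blast+
  note BD = subsetD[OF B(1)] and BD' = subsetD[OF B(2)]
  obtain a\<^sub>1 b\<^sub>1 where m1: "(cmod a\<^sub>1)\<^sup>2 - (cmod b\<^sub>1)\<^sup>2 = sgn (((cmod (g\<^sub>1 0))\<^sup>2 - 1) * ((cmod (h\<^sub>1 0))\<^sup>2 - 1))"
    "moebius_related ?B a\<^sub>1 b\<^sub>1 g\<^sub>1 h\<^sub>1"
    by (rule hyperbolic_isometry[OF hg(1) g(5)[OF BD] g(8)[OF BD] hg(3) h(5)[OF BD'] h(8)[OF BD'] eq(1) r(1)])
  obtain a\<^sub>2 b\<^sub>2 where m2: "(cmod a\<^sub>2)\<^sup>2 - (cmod b\<^sub>2)\<^sup>2 = sgn (((cmod (g\<^sub>2 0))\<^sup>2 - 1) * ((cmod (h\<^sub>2 0))\<^sup>2 - 1))"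
    "moebius_related ?B a\<^sub>2 b\<^sub>2 g\<^sub>2 h\<^sub>2"
    by (rule hyperbolic_isometry[OF hg(2) g(6)[OF BD] g(9)[OF BD] hg(4) h(6)[OF BD'] h(9)[OF BD'] eq(2) r(1)])
  have s: "(cmod a\<^sub>1)\<^sup>2 - (cmod b\<^sub>1)\<^sup>2 = 1 \<and> (cmod a\<^sub>2)\<^sup>2 - (cmod b\<^sub>2)\<^sup>2 = 1 \<or>
      (cmod a\<^sub>1)\<^sup>2 - (cmod b\<^sub>1)\<^sup>2 = -1 \<and> (cmod a\<^sub>2)\<^sup>2 - (cmod b\<^sub>2)\<^sup>2 = -1"
    using g(7)[OF g(2)] h(7)[OF h(2)] unfolding m1(1) m2(1)
    by (rule sgn_cross)
  have "nbhd0 ?B" using r by (simp add: nbhd0_def)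
  moreover have "?B \<subseteq> D \<inter> D'" using B by auto
  ultimately show ?thesis
    by (rule HH_equivI[OF H H' _ _ s m1(2) m2(2)])
qed

lemma formula_compat:
  assumes e: "((D, g\<^sub>1, g\<^sub>2), (D', h\<^sub>1, h\<^sub>2)) \<in> HH_equiv"
  shows "((D, K_of g\<^sub>1 g\<^sub>2, kappa_of g\<^sub>1 g\<^sub>2), (D', K_of h\<^sub>1 h\<^sub>2, kappa_of h\<^sub>1 h\<^sub>2)) \<in> SNE_equiv"
proof -
  obtain D\<^sub>0 a\<^sub>1 b\<^sub>1 a\<^sub>2 b\<^sub>2 where H: "(D, g\<^sub>1, g\<^sub>2) \<in> HH" "(D', h\<^sub>1, h\<^sub>2) \<in> HH"
    and D0: "nbhd0 D\<^sub>0" "D\<^sub>0 \<subseteq> D \<inter> D'"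
    and s: "(cmod a\<^sub>1)\<^sup>2 - (cmod b\<^sub>1)\<^sup>2 = 1 \<and> (cmod a\<^sub>2)\<^sup>2 - (cmod b\<^sub>2)\<^sup>2 = 1 \<or>
      (cmod a\<^sub>1)\<^sup>2 - (cmod b\<^sub>1)\<^sup>2 = -1 \<and> (cmod a\<^sub>2)\<^sup>2 - (cmod b\<^sub>2)\<^sup>2 = -1"
    and m: "moebius_related D\<^sub>0 a\<^sub>1 b\<^sub>1 g\<^sub>1 h\<^sub>1" "moebius_related D\<^sub>0 a\<^sub>2 b\<^sub>2 g\<^sub>2 h\<^sub>2"
    by (rule HH_equivE[OF e])
  note g = HH_D[OF H(1)] and h = HH_D[OF H(2)]
  have o: "open D\<^sub>0" and hol: "g\<^sub>1 holomorphic_on D\<^sub>0" "g\<^sub>2 holomorphic_on D\<^sub>0"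
    using D0 g(3,4) holomorphic_on_subset by (auto simp: nbhd0_def)
  have s': "\<bar>(cmod a\<^sub>1)\<^sup>2 - (cmod b\<^sub>1)\<^sup>2\<bar> = 1" "\<bar>(cmod a\<^sub>2)\<^sup>2 - (cmod b\<^sub>2)\<^sup>2\<bar> = 1" using s by auto
  have "hdens h\<^sub>1 z = hdens g\<^sub>1 z" "hdens h\<^sub>2 z = hdens g\<^sub>2 z" if "z \<in> D\<^sub>0" for z
    using moebius_hdens[OF m(1) o hol(1) refl s'(1) that] moebius_hdens[OF m(2) o hol(2) refl s'(2) that] by auto
  note hd = this
  have "K_of h\<^sub>1 h\<^sub>2 z = K_of g\<^sub>1 g\<^sub>2 z \<and> kappa_of h\<^sub>1 h\<^sub>2 z = kappa_of g\<^sub>1 g\<^sub>2 z" if "z \<in> D\<^sub>0" for z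
    using hd[OF that] curvatures_hdens[of g\<^sub>1 z g\<^sub>2, OF g(7)] curvatures_hdens[of h\<^sub>1 z h\<^sub>2, OF h(7)] subsetD[OF D0(2) that] by simp
  then show ?thesis
    by (rule SNE_equivI[OF formula_SNE[OF H(1)] formula_SNE[OF H(2)] D0])
qed

lemma formula_surj:
  assumes S: "(D, K, \<kappa>) \<in> SNE"
  obtains E g\<^sub>1 g\<^sub>2 where "(E, g\<^sub>1, g\<^sub>2) \<in> HH" "((E, K_of g\<^sub>1 g\<^sub>2, kappa_of g\<^sub>1 g\<^sub>2), (D, K, \<kappa>)) \<in> SNE_equiv"
proof -
  have D: "open D" "0 \<in> D" and C: "Ck_on 2 K D" "Ck_on 2 \<kappa> D" and N: "\<And>z. z \<in> D \<Longrightarrow> natural_equations K \<kappa> z"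
    using S by (auto simp: SNE_def nbhd0_def)
  have pos: "K z + \<kappa> z > 0" "K z - \<kappa> z > 0" if "z \<in> D" for z
  proof -
    have "\<bar>\<kappa> z\<bar> < \<bar>K z\<bar>" "K z > 0"
      using N[OF that] unfolding natural_equations_def by (auto simp: abs_less_iff power2_less_imp_less intro: power2_less_imp_less)
    then show "K z + \<kappa> z > 0" "K z - \<kappa> z > 0" by auto
  qed
  define P where "P = (\<lambda>z. ln (K z - \<kappa> z))"
  define Q where "Q = (\<lambda>z. ln (K z + \<kappa> z))"
  have CP: "Ck_on 2 P D" and CQ: "Ck_on 2 Q D"
    unfolding P_def Q_def using pos by (intro Ck_on_ln Ck_on_add Ck_on_diff D C; blast)+
  have eP: "exp (P z) = K z - \<kappa> z" and eQ: "exp (Q z) = K z + \<kappa> z" if "z \<in> D" for z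
    using pos[OF that] by (simp_all add: P_def Q_def)
  have R: "root 4 ((K z)\<^sup>2 - (\<kappa> z)\<^sup>2) = exp ((P z + Q z) / 4)" if z: "z \<in> D" for z
  proof -
    have "(K z)\<^sup>2 - (\<kappa> z)\<^sup>2 = exp (P z) * exp (Q z)" unfolding eP[OF z] eQ[OF z] by algebra
    also have "\<dots> = exp ((P z + Q z) / 4) ^ 4" by (simp add: exp_add[symmetric] exp_of_nat_mult[symmetric])
    finally show ?thesis by (simp add: real_root_pos2)
  qed
  have l1: "ln (root 4 ((K z)\<^sup>2 - (\<kappa> z)\<^sup>2)) = (1/4) * P z + (1/4) * Q z + 0" if z: "z \<in> D" for z
    unfolding R[OF z] by simp
  have l2: "ln (sqrt ((K z + \<kappa> z) / (K z - \<kappa> z))) = (-1/2) * P z + (1/2) * Q z + 0" if z: "z \<in> D" for z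
    using pos[OF z] by (simp add: ln_sqrt ln_div P_def Q_def)
  have LP: "exp ((P z + Q z) / 4) * ((1/4) * laplacian P z + (1/4) * laplacian Q z) = 2 * K z"
    and LQ: "exp ((P z + Q z) / 4) * ((-1/2) * laplacian P z + (1/2) * laplacian Q z) = 2 * \<kappa> z" if z: "z \<in> D" for z
    using N[OF z] laplacian_cong[OF D(1) z l1] laplacian_cong[OF D(1) z l2]
      laplacian_combination[OF D(1) CP CQ z, of "1/4" "1/4" 0] laplacian_combination[OF D(1) CP CQ z, of "-1/2" "1/2" 0]
    unfolding natural_equations_def R[OF z] by simp_all
  \<comment> \<open>Logarithms of the sought densities: solving K - \<kappa> = 16 a^3 b and K +
    \<kappa> = 16 a b^3 gives a^8 = (K - \<kappa>)^3 / (256 (K + \<kappa>)), and symmetrically for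
    b; 256 = 2^8 is the origin of ln 2.\<close>
  define wa where "wa = (\<lambda>z. (3/8) * P z + (-1/8) * Q z + - ln 2)"
  define wb where "wb = (\<lambda>z. (-1/8) * P z + (3/8) * Q z + - ln 2)"
  have four: "exp (- (2 * ln 2)) * 4 = (1::real)"
    by (simp add: exp_minus exp_double power2_eq_square)
  have e1: "exp ((P z + Q z) / 4) * (4 * exp (2 * wa z)) = K z - \<kappa> z"
    and e2: "exp ((P z + Q z) / 4) * (4 * exp (2 * wb z)) = K z + \<kappa> z" if z: "z \<in> D" for z
  proof -
    have "exp ((P z + Q z) / 4) * (4 * exp (2 * wa z)) = (exp (- (2 * ln 2)) * 4) * exp (P z)"
      by (simp add: mult_ac wa_def algebra_simps add_divide_distrib flip: exp_add)
    then show "exp ((P z + Q z) / 4) * (4 * exp (2 * wa z)) = K z - \<kappa> z" using four eP[OF z] by simp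
    have "exp ((P z + Q z) / 4) * (4 * exp (2 * wb z)) = (exp (- (2 * ln 2)) * 4) * exp (Q z)"
      by (simp add: mult_ac wb_def algebra_simps add_divide_distrib flip: exp_add)
    then show "exp ((P z + Q z) / 4) * (4 * exp (2 * wb z)) = K z + \<kappa> z" using four eQ[OF z] by simp
  qed
  have La: "laplacian wa z = 4 * exp (2 * wa z)" and Lb: "laplacian wb z = 4 * exp (2 * wb z)" if z: "z \<in> D" for z
  proof -
    let ?e = "exp ((P z + Q z) / 4)"
    have lwa: "laplacian wa z = (3/8) * laplacian P z + (-1/8) * laplacian Q z"
      and lwb: "laplacian wb z = (-1/8) * laplacian P z + (3/8) * laplacian Q z"
      unfolding wa_def wb_def by (rule laplacian_combination[OF D(1) CP CQ z])+
    have "?e * laplacian wa z = (1/2) * (?e * ((1/4) * laplacian P z + (1/4) * laplacian Q z))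
        - (1/2) * (?e * ((-1/2) * laplacian P z + (1/2) * laplacian Q z))"
      unfolding lwa by (simp add: algebra_simps)
    also have "\<dots> = ?e * (4 * exp (2 * wa z))" unfolding LP[OF z] LQ[OF z] e1[OF z] by simp
    finally show "laplacian wa z = 4 * exp (2 * wa z)" by simp
    have "?e * laplacian wb z = (1/2) * (?e * ((1/4) * laplacian P z + (1/4) * laplacian Q z))
        + (1/2) * (?e * ((-1/2) * laplacian P z + (1/2) * laplacian Q z))"
      unfolding lwb by (simp add: algebra_simps)
    also have "\<dots> = ?e * (4 * exp (2 * wb z))" unfolding LP[OF z] LQ[OF z] e2[OF z] by simp
    finally show "laplacian wb z = 4 * exp (2 * wb z)" by simp
  qed
  have Cw: "Ck_on 2 wa D" "Ck_on 2 wb D"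
    unfolding wa_def wb_def by (intro Ck_on_add Ck_on_mult Ck_on_const D CP CQ)+
  obtain r\<^sub>1 y\<^sub>1 y\<^sub>2 where y: "r\<^sub>1 > 0" "ball 0 r\<^sub>1 \<subseteq> D" "wpair (ball 0 r\<^sub>1) y\<^sub>1 y\<^sub>2"
    "\<And>z. z \<in> ball 0 r\<^sub>1 \<Longrightarrow> exp (- wa z) = pform y\<^sub>1 y\<^sub>2 z"
    using liouville_exists[OF D Cw(1) La] by blast
  obtain r\<^sub>2 x\<^sub>1 x\<^sub>2 where x: "r\<^sub>2 > 0" "ball 0 r\<^sub>2 \<subseteq> D" "wpair (ball 0 r\<^sub>2) x\<^sub>1 x\<^sub>2"
    "\<And>z. z \<in> ball 0 r\<^sub>2 \<Longrightarrow> exp (- wb z) = pform x\<^sub>1 x\<^sub>2 z"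
    using liouville_exists[OF D Cw(2) Lb] by blast
  \<comment> \<open>The form produced by the existence theorem is positive, so the denominator has
    no zeros and the quotient maps into the open unit disc. This being so for both functions, the
    sign condition of \<open>HH\<close> holds.\<close>
  have quot: "u\<^sub>2 z \<noteq> 0 \<and> (cmod (u\<^sub>1 z / u\<^sub>2 z))\<^sup>2 < 1 \<and> deriv (\<lambda>z. u\<^sub>1 z / u\<^sub>2 z) z \<noteq> 0
      \<and> hdens (\<lambda>z. u\<^sub>1 z / u\<^sub>2 z) z = exp (w z) \<and> (\<lambda>z. u\<^sub>1 z / u\<^sub>2 z) holomorphic_on ball 0 r"
    if u: "wpair (ball 0 r) u\<^sub>1 u\<^sub>2" "\<And>z. z \<in> ball 0 r \<Longrightarrow> exp (- w z) = pform u\<^sub>1 u\<^sub>2 z" and z: "z \<in> ball 0 r"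
    for u\<^sub>1 u\<^sub>2 w r z
  proof -
    have u0: "u\<^sub>2 z \<noteq> 0" if "z \<in> ball 0 r" for z
    proof
      assume "u\<^sub>2 z = 0"
      then have "pform u\<^sub>1 u\<^sub>2 z \<le> 0" by (simp add: pform_def)
      then show False using u(2)[OF that] exp_gt_zero[of "- w z"] by linarith
    qed
    note q = wpair_quotient[OF u(1) u0]
    have pf: "pform u\<^sub>1 u\<^sub>2 z = (cmod (u\<^sub>2 z))\<^sup>2 * (1 - (cmod (u\<^sub>1 z / u\<^sub>2 z))\<^sup>2)"
      by (rule pform_quotient[of u\<^sub>2 z "\<lambda>z. u\<^sub>1 z / u\<^sub>2 z" u\<^sub>1, OF u0[OF z] refl])
    have "pform u\<^sub>1 u\<^sub>2 z > 0" using u(2)[OF z] exp_gt_zero[of "- w z"] by linarith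
    then have "(cmod (u\<^sub>1 z / u\<^sub>2 z))\<^sup>2 < 1" unfolding pf by (simp add: zero_less_mult_iff)
    moreover have "hdens (\<lambda>z. u\<^sub>1 z / u\<^sub>2 z) z = 1 / \<bar>pform u\<^sub>1 u\<^sub>2 z\<bar>"
      by (rule hdens_pform[of u\<^sub>2 z "\<lambda>z. u\<^sub>1 z / u\<^sub>2 z" u\<^sub>1, OF u0[OF z] refl q(2)[OF _ z]])
    then have "hdens (\<lambda>z. u\<^sub>1 z / u\<^sub>2 z) z = exp (w z)"
      unfolding u(2)[OF z, symmetric] by (simp add: exp_minus field_simps)
    ultimately show ?thesis using u0[OF z] q z by simp
  qed
  define g\<^sub>1 where "g\<^sub>1 = (\<lambda>z. y\<^sub>1 z / y\<^sub>2 z)"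
  define g\<^sub>2 where "g\<^sub>2 = (\<lambda>z. x\<^sub>1 z / x\<^sub>2 z)"
  note q1 = quot[OF y(3,4), folded g\<^sub>1_def] and q2 = quot[OF x(3,4), folded g\<^sub>2_def]
  define E where "E = ball (0::complex) (min r\<^sub>1 r\<^sub>2)"
  have E: "nbhd0 E" "E \<subseteq> ball 0 r\<^sub>1" "E \<subseteq> ball 0 r\<^sub>2" "E \<subseteq> D"
    using y(1,2) x(1,2) by (auto simp: E_def nbhd0_def)
  have g1: "(cmod (g\<^sub>1 z))\<^sup>2 < 1" "deriv g\<^sub>1 z \<noteq> 0" "hdens g\<^sub>1 z = exp (wa z)"
    and g2: "(cmod (g\<^sub>2 z))\<^sup>2 < 1" "deriv g\<^sub>2 z \<noteq> 0" "hdens g\<^sub>2 z = exp (wb z)" if "z \<in> E" for z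
    using q1[of z] q2[of z] E that by (auto simp: g\<^sub>1_def g\<^sub>2_def)
  have hol: "g\<^sub>1 holomorphic_on E" "g\<^sub>2 holomorphic_on E"
    using q1[of 0] q2[of 0] y(1) x(1) holomorphic_on_subset E(2,3) by auto
  have pr: "((cmod (g\<^sub>1 z))\<^sup>2 - 1) * ((cmod (g\<^sub>2 z))\<^sup>2 - 1) > 0" if "z \<in> E" for z
    using g1(1)[OF that] g2(1)[OF that] by (intro mult_neg_neg) auto
  have H: "(E, g\<^sub>1, g\<^sub>2) \<in> HH" using E(1) hol g1(2) g2(2) pr by (auto simp: HH_def)
  have "K z = K_of g\<^sub>1 g\<^sub>2 z \<and> \<kappa> z = kappa_of g\<^sub>1 g\<^sub>2 z" if z: "z \<in> E" for z
  proof -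
    have zD: "z \<in> D" using z E by auto
    let ?a = "exp (wa z)" and ?b = "exp (wb z)"
    have "?a * ?b = exp ((P z + Q z) / 4) * exp (- (2 * ln 2))"
      by (simp add: wa_def wb_def algebra_simps add_divide_distrib flip: exp_add)
    then have ab: "4 * (?a * ?b) = exp ((P z + Q z) / 4)" using four by simp
    have "K z - \<kappa> z = 4 * (?a * ?b) * (4 * ?a\<^sup>2)" "K z + \<kappa> z = 4 * (?a * ?b) * (4 * ?b\<^sup>2)"
      unfolding ab exp_double[symmetric] using e1[OF zD] e2[OF zD] by simp_all
    then show ?thesis
      unfolding curvatures_hdens[of g\<^sub>1 z g\<^sub>2, OF pr[OF z]] g1(3)[OF z] g2(3)[OF z] by (simp add: algebra_simps)
  qed
  from SNE_equivI[OF formula_SNE[OF H] S E(1) _ this] E(4)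
  have "((E, K_of g\<^sub>1 g\<^sub>2, kappa_of g\<^sub>1 g\<^sub>2), (D, K, \<kappa>)) \<in> SNE_equiv" by simp
  with H show ?thesis by (rule that)
qed

section \<open>The equivalence relations and the induced maps\<close>

lemma nbhd0_inter: "nbhd0 D \<Longrightarrow> nbhd0 E \<Longrightarrow> nbhd0 (D \<inter> E)"
  by (auto simp: nbhd0_def)

lemma equiv_SNE: "equiv SNE SNE_equiv"
proof (rule equivI)
  show "SNE_equiv \<subseteq> SNE \<times> SNE" by (auto simp: SNE_equiv_def)
  show "refl_on SNE SNE_equiv"
    unfolding refl_on_def by (auto simp: SNE_equiv_def) (auto simp: SNE_def)
  show "sym SNE_equiv"
    unfolding sym_def SNE_equiv_def by (fastforce simp: Int_commute)
  show "trans SNE_equiv"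
  proof (rule transI, clarify)
    fix D K k D' K' k' D'' K'' k''
    assume "((D, K, k), (D', K', k')) \<in> SNE_equiv" "((D', K', k'), (D'', K'', k'')) \<in> SNE_equiv"
    then obtain U V where "(D, K, k) \<in> SNE" "(D'', K'', k'') \<in> SNE" "nbhd0 U" "nbhd0 V"
      "U \<subseteq> D \<inter> D'" "V \<subseteq> D' \<inter> D''" "\<forall>z\<in>U. K' z = K z \<and> k' z = k z" "\<forall>z\<in>V. K'' z = K' z \<and> k'' z = k' z"
      unfolding SNE_equiv_def by blast
    then show "((D, K, k), (D'', K'', k'')) \<in> SNE_equiv"
      unfolding SNE_equiv_def by (auto intro!: exI[of _ "U \<inter> V"] nbhd0_inter)
  qed
qed

lemma equiv_HH: "equiv HH HH_equiv"
proof (rule equivI)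
  show "HH_equiv \<subseteq> HH \<times> HH" by (auto simp: HH_equiv_def)
  show "refl_on HH HH_equiv"
    unfolding refl_on_def
  proof clarify
    fix D g1 g2 assume H: "(D, g1, g2) \<in> HH"
    have "nbhd0 D" using H by (simp add: HH_def)
    moreover have "(cmod 1)\<^sup>2 - (cmod 0)\<^sup>2 = 1" by simp
    ultimately show "((D, g1, g2), (D, g1, g2)) \<in> HH_equiv"
      using HH_equivI[OF H H _ _ _ moebius_refl moebius_refl] by simp
  qed
  show "sym HH_equiv"
  proof (rule symI, clarify)
    fix D g1 g2 E h1 h2 assume "((D, g1, g2), (E, h1, h2)) \<in> HH_equiv"
    then obtain U a1 b1 a2 b2 where H: "(D, g1, g2) \<in> HH" "(E, h1, h2) \<in> HH" "nbhd0 U" "U \<subseteq> E \<inter> D"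
      and s: "(cmod a1)\<^sup>2 - (cmod b1)\<^sup>2 = 1 \<and> (cmod a2)\<^sup>2 - (cmod b2)\<^sup>2 = 1 \<or>
         (cmod a1)\<^sup>2 - (cmod b1)\<^sup>2 = -1 \<and> (cmod a2)\<^sup>2 - (cmod b2)\<^sup>2 = -1"
      and m: "moebius_related U a1 b1 g1 h1" "moebius_related U a2 b2 g2 h2"
      by (rule HH_equivE) (auto simp: Int_commute)
    have s': "\<bar>(cmod a1)\<^sup>2 - (cmod b1)\<^sup>2\<bar> = 1" "\<bar>(cmod a2)\<^sup>2 - (cmod b2)\<^sup>2\<bar> = 1" using s by auto
    have "moebius_related U (cnj a1) (- b1) h1 g1" "moebius_related U (cnj a2) (- b2) h2 g2"
      using moebius_sym[OF m(1) refl s'(1)] moebius_sym[OF m(2) refl s'(2)] by auto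
    moreover have "(cmod (cnj a1))\<^sup>2 - (cmod (- b1))\<^sup>2 = 1 \<and> (cmod (cnj a2))\<^sup>2 - (cmod (- b2))\<^sup>2 = 1 \<or>
         (cmod (cnj a1))\<^sup>2 - (cmod (- b1))\<^sup>2 = -1 \<and> (cmod (cnj a2))\<^sup>2 - (cmod (- b2))\<^sup>2 = -1"
      using s by simp
    ultimately show "((E, h1, h2), (D, g1, g2)) \<in> HH_equiv"
      using HH_equivI[OF H(2,1,3,4)] by blast
  qed
  show "trans HH_equiv"
  proof (rule transI, clarify)
    fix D g1 g2 E h1 h2 F k1 k2
    assume 1: "((D, g1, g2), (E, h1, h2)) \<in> HH_equiv" and 2: "((E, h1, h2), (F, k1, k2)) \<in> HH_equiv"
    obtain U a1 b1 a2 b2 where U: "(D, g1, g2) \<in> HH" "(E, h1, h2) \<in> HH" "nbhd0 U" "U \<subseteq> D \<inter> E"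
      and s: "(cmod a1)\<^sup>2 - (cmod b1)\<^sup>2 = 1 \<and> (cmod a2)\<^sup>2 - (cmod b2)\<^sup>2 = 1 \<or>
         (cmod a1)\<^sup>2 - (cmod b1)\<^sup>2 = -1 \<and> (cmod a2)\<^sup>2 - (cmod b2)\<^sup>2 = -1"
      and m: "moebius_related U a1 b1 g1 h1" "moebius_related U a2 b2 g2 h2"
      by (rule HH_equivE[OF 1])
    obtain V c1 d1 c2 d2 where V: "(E, h1, h2) \<in> HH" "(F, k1, k2) \<in> HH" "nbhd0 V" "V \<subseteq> E \<inter> F"
      and s': "(cmod c1)\<^sup>2 - (cmod d1)\<^sup>2 = 1 \<and> (cmod c2)\<^sup>2 - (cmod d2)\<^sup>2 = 1 \<or>
         (cmod c1)\<^sup>2 - (cmod d1)\<^sup>2 = -1 \<and> (cmod c2)\<^sup>2 - (cmod d2)\<^sup>2 = -1"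
      and m': "moebius_related V c1 d1 h1 k1" "moebius_related V c2 d2 h2 k2"
      by (rule HH_equivE[OF 2])
    have t: "(cmod (c1 * a1 + cnj d1 * b1))\<^sup>2 - (cmod (d1 * a1 + cnj c1 * b1))\<^sup>2 = 1 \<and>
          (cmod (c2 * a2 + cnj d2 * b2))\<^sup>2 - (cmod (d2 * a2 + cnj c2 * b2))\<^sup>2 = 1 \<or>
       (cmod (c1 * a1 + cnj d1 * b1))\<^sup>2 - (cmod (d1 * a1 + cnj c1 * b1))\<^sup>2 = -1 \<and>
          (cmod (c2 * a2 + cnj d2 * b2))\<^sup>2 - (cmod (d2 * a2 + cnj c2 * b2))\<^sup>2 = -1"
      unfolding moebius_norm_mult[OF refl refl] using s s' by (elim disjE conjE) simp_all
    show "((D, g1, g2), (F, k1, k2)) \<in> HH_equiv"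
      by (rule HH_equivI[OF U(1) V(2) nbhd0_inter[OF U(3) V(3)] _ t
            moebius_trans[OF moebius_mono[OF m(1)] moebius_mono[OF m'(1)]]
            moebius_trans[OF moebius_mono[OF m(2)] moebius_mono[OF m'(2)]]])
         (use U(4) V(4) in auto)
  qed
qed

text \<open>A class is sent to the saturation of all C-images of its members. By
  \<open>compat\<close> these images are all equivalent; taken at a = a' it also covers the many
  images of one representative under the Weierstrass formula.\<close>

lemma induces_exists:
  assumes "equiv A r" "equiv B s" and total: "\<And>a. a \<in> A \<Longrightarrow> \<exists>b. (a, b) \<in> C"
    and maps: "\<And>a b. a \<in> A \<Longrightarrow> (a, b) \<in> C \<Longrightarrow> b \<in> B"
    and compat: "\<And>a a' b b'. (a, a') \<in> r \<Longrightarrow> (a, b) \<in> C \<Longrightarrow> (a', b') \<in> C \<Longrightarrow> (b, b') \<in> s"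
  obtains F where "induces C A r B s F"
proof
  show "induces C A r B s (\<lambda>c. s `` {b. \<exists>a\<in>c. (a, b) \<in> C})"
    unfolding induces_def
  proof (intro ballI conjI allI impI)
    fix a b assume a: "a \<in> A" "(a, b) \<in> C"
    have "(a, a) \<in> r" using assms(1) a(1) by (meson equivE refl_onD)
    then show "s `` {b. \<exists>a\<in>r `` {a}. (a, b) \<in> C} = s `` {b}"
      using compat a assms(2) by (auto simp: Image_iff) (meson equivE transE)
  qed (use total maps in auto)
qed

text \<open>Both conditions concern representatives, and surjectivity is asked only up to s, since
  the constructions shrink domains and move surfaces.\<close>

lemma induces_bij:
  assumes "equiv A r" "equiv B s" and F: "induces C A r B s F"
    and inj: "\<And>a a' b b'. a \<in> A \<Longrightarrow> a' \<in> A \<Longrightarrow> (a, b) \<in> C \<Longrightarrow> (a', b') \<in> C \<Longrightarrow> (b, b') \<in> s \<Longrightarrow> (a, a') \<in> r"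
    and surj: "\<And>b. b \<in> B \<Longrightarrow> \<exists>a b'. a \<in> A \<and> (a, b') \<in> C \<and> (b', b) \<in> s"
  shows "bij_betw F (A // r) (B // s)"
proof -
  have F': "b \<in> B" "F (r `` {a}) = s `` {b}" if "a \<in> A" "(a, b) \<in> C" for a b
    using F that unfolding induces_def by auto
  have tot: "\<exists>b. (a, b) \<in> C" if "a \<in> A" for a using F that unfolding induces_def by auto
  show ?thesis
    unfolding bij_betw_def
  proof
    show "inj_on F (A // r)"
    proof (rule inj_onI)
      fix c d assume "c \<in> A // r" "d \<in> A // r" and e: "F c = F d"
      then obtain a a' where a: "a \<in> A" "a' \<in> A" "c = r `` {a}" "d = r `` {a'}" by (meson quotientE)
      obtain b b' where b: "(a, b) \<in> C" "(a', b') \<in> C" using tot a by blast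
      have "(b, b') \<in> s"
        by (rule eq_equiv_class[OF _ assms(2)]) (use e F'[OF a(1) b(1)] F'[OF a(2) b(2)] a in simp_all)
      then have "(a, a') \<in> r" using inj a b by blast
      then show "c = d" using a equiv_class_eq[OF assms(1)] by simp
    qed
    show "F ` (A // r) = B // s"
    proof
      show "F ` (A // r) \<subseteq> B // s"
      proof
        fix c assume "c \<in> F ` (A // r)"
        then obtain a where a: "a \<in> A" "c = F (r `` {a})" by (auto elim!: quotientE)
        obtain b where "(a, b) \<in> C" using tot[OF a(1)] by blast
        from F'[OF a(1) this] show "c \<in> B // s" using a(2) quotientI[of b B s] by simp
      qed
      show "B // s \<subseteq> F ` (A // r)"
      proof
        fix c assume "c \<in> B // s"
        then obtain b where b: "b \<in> B" "c = s `` {b}" by (meson quotientE)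
        then obtain a b' where a: "a \<in> A" "(a, b') \<in> C" "(b', b) \<in> s" using surj by blast
        then have "F (r `` {a}) = c" using F'[OF a(1,2)] equiv_class_eq[OF assms(2) a(3)] b by simp
        then show "c \<in> F ` (A // r)" using quotientI[OF a(1), of r] by blast
      qed
    qed
  qed
qed

lemma formula_corr_iff: "(a, b) \<in> formula_corr \<longleftrightarrow> (\<exists>D g\<^sub>1 g\<^sub>2. a = (D, g\<^sub>1, g\<^sub>2) \<and> b = (D, K_of g\<^sub>1 g\<^sub>2, kappa_of g\<^sub>1 g\<^sub>2))"
  by (auto simp: formula_corr_def)

lemma formula_induces_bij:
  obtains F where "induces formula_corr HH HH_equiv SNE SNE_equiv F" "bij_betw F (HH // HH_equiv) (SNE // SNE_equiv)"
proof -
  obtain F where F: "induces formula_corr HH HH_equiv SNE SNE_equiv F"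
  proof (rule induces_exists[OF equiv_HH equiv_SNE])
    show "\<exists>b. (a, b) \<in> formula_corr" for a by (cases a) (auto simp: formula_corr_iff)
    show "b \<in> SNE" if "a \<in> HH" "(a, b) \<in> formula_corr" for a b
      using that formula_SNE by (auto simp: formula_corr_iff)
    show "(b, b') \<in> SNE_equiv" if "(a, a') \<in> HH_equiv" "(a, b) \<in> formula_corr" "(a', b') \<in> formula_corr" for a a' b b'
      using that formula_compat by (auto simp: formula_corr_iff)
  qed blast
  have "bij_betw F (HH // HH_equiv) (SNE // SNE_equiv)"
  proof (rule induces_bij[OF equiv_HH equiv_SNE F])
    show "(a, a') \<in> HH_equiv" if "a \<in> HH" "a' \<in> HH" "(a, b) \<in> formula_corr" "(a', b') \<in> formula_corr"
      "(b, b') \<in> SNE_equiv" for a a' b b'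
      using that formula_inj by (auto simp: formula_corr_iff)
    show "\<exists>a b'. a \<in> HH \<and> (a, b') \<in> formula_corr \<and> (b', b) \<in> SNE_equiv" if bS: "b \<in> SNE" for b
    proof -
      obtain D K k where b: "b = (D, K, k)" by (cases b)
      obtain E g\<^sub>1 g\<^sub>2 where "(E, g\<^sub>1, g\<^sub>2) \<in> HH" "((E, K_of g\<^sub>1 g\<^sub>2, kappa_of g\<^sub>1 g\<^sub>2), (D, K, k)) \<in> SNE_equiv"
        using formula_surj[OF bS[unfolded b]] by blast
      then show ?thesis unfolding b formula_corr_iff by blast
    qed
  qed
  with F show ?thesis using that by blast
qed

section \<open>Linear algebra of \<open>\<real>\<^sup>4\<^sub>2\<close>\<close>

lemma sign_transpose2:
  "a \<noteq> b \<Longrightarrow> c \<noteq> d \<Longrightarrow> sign (Transposition.transpose a b \<circ> Transposition.transpose c d) = 1"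
  by (simp add: sign_compose permutation_swap_id sign_swap_id)

lemma sign_transpose3:
  "a \<noteq> b \<Longrightarrow> c \<noteq> d \<Longrightarrow> e \<noteq> f \<Longrightarrow>
    sign (Transposition.transpose a b \<circ> (Transposition.transpose c d \<circ> Transposition.transpose e f)) = -1"
  by (simp add: sign_compose permutation_swap_id sign_swap_id permutation_compose)

lemma det_4:
  "det (A::'a::comm_ring_1^4^4) =
    A$1$1 * (A$2$2 * (A$3$3 * A$4$4 - A$3$4 * A$4$3) - A$2$3 * (A$3$2 * A$4$4 - A$3$4 * A$4$2) + A$2$4 * (A$3$2 * A$4$3 - A$3$3 * A$4$2))
  - A$1$2 * (A$2$1 * (A$3$3 * A$4$4 - A$3$4 * A$4$3) - A$2$3 * (A$3$1 * A$4$4 - A$3$4 * A$4$1) + A$2$4 * (A$3$1 * A$4$3 - A$3$3 * A$4$1))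
  + A$1$3 * (A$2$1 * (A$3$2 * A$4$4 - A$3$4 * A$4$2) - A$2$2 * (A$3$1 * A$4$4 - A$3$4 * A$4$1) + A$2$4 * (A$3$1 * A$4$2 - A$3$2 * A$4$1))
  - A$1$4 * (A$2$1 * (A$3$2 * A$4$3 - A$3$3 * A$4$2) - A$2$2 * (A$3$1 * A$4$3 - A$3$3 * A$4$1) + A$2$3 * (A$3$1 * A$4$2 - A$3$2 * A$4$1))"
proof -
  have f1234: "finite {2::4, 3, 4}" "1 \<notin> {2::4, 3, 4}" by auto
  have f234: "finite {3::4, 4}" "2 \<notin> {3::4, 4}" by auto
  have f34: "finite {4::4}" "3 \<notin> {4::4}" by auto
  show ?thesis
    unfolding det_def UNIV_4
    unfolding sum_over_permutations_insert[OF f1234]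
    unfolding sum_over_permutations_insert[OF f234]
    unfolding sum_over_permutations_insert[OF f34]
    unfolding permutes_sing
    by (simp add: sign_swap_id sign_transpose2 sign_transpose3) (simp add: algebra_simps)
qed

lemma sp_simps:
  "sp (a + b) c = sp a c + sp b c" "sp a (b + c) = sp a b + sp a c"
  "sp (a - b) c = sp a c - sp b c" "sp a (b - c) = sp a b - sp a c"
  "sp (k *s a) c = k * sp a c" "sp a (k *s c) = k * sp a c"
  "sp (- a) c = - sp a c" "sp a (- c) = - sp a c"
  by (simp_all add: sp_def algebra_simps)

lemma sp_commute: "sp a b = sp b a"
  by (simp add: sp_def mult.commute)

lemma sp_scaleR:
  fixes a b :: "real^4"
  shows "sp (k *\<^sub>R a) b = k * sp a b" "sp a (k *\<^sub>R b) = k * sp a b"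
  by (simp_all add: sp_def algebra_simps)

lemma bounded_bilinear_sp: "bounded_bilinear (sp :: real^4 \<Rightarrow> real^4 \<Rightarrow> real)"
proof -
  define J where "J = (vector [vector [1,0,0,0], vector [0,1,0,0], vector [0,0,-1,0], vector [0,0,0,-1]] :: real^4^4)"
  have "sp a b = a \<bullet> (J *v b)" for a b :: "real^4"
    by (simp add: sp_def J_def inner_vec_def matrix_vector_mult_def sum_4)
  then have "(sp :: real^4 \<Rightarrow> real^4 \<Rightarrow> real) = (\<lambda>a b. a \<bullet> (J *v b))" by auto
  then show ?thesis
    using bounded_bilinear.comp[OF bounded_bilinear_inner bounded_linear_ident matrix_vector_mul_bounded_linear[of J]] by simp
qed

lemma sp_cvec: "sp (cvec a) (cvec b) = complex_of_real (sp a b)"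
  by (simp add: sp_def cvec_def)

text \<open>Orthogonal projection along a plane with an orthogonal basis of equal squares. Over an
  arbitrary field it serves the real normal space and its complexification alike.\<close>

lemma normal_part_formula:
  fixes p q w :: "'a::field^4"
  assumes "sp p p = E" "sp q q = E" "sp p q = 0" "E \<noteq> 0"
  shows "normal_part p q w = w - (sp w p / E) *s p - (sp w q / E) *s q"
  unfolding normal_part_def
proof (rule the_equality)
  have qp: "sp q p = 0" using assms(3) sp_commute[of q p] by simp
  let ?n = "w - (sp w p / E) *s p - (sp w q / E) *s q"
  have "w = (sp w p / E) *s p + (sp w q / E) *s q + ?n" by simp
  moreover have "sp ?n p = 0" "sp ?n q = 0" using assms(4) by (simp_all add: sp_simps assms(1-3) qp)
  ultimately show "sp ?n p = 0 \<and> sp ?n q = 0 \<and> (\<exists>\<alpha> \<beta>. w = \<alpha> *s p + \<beta> *s q + ?n)" by blast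
  fix n assume n: "sp n p = 0 \<and> sp n q = 0 \<and> (\<exists>\<alpha> \<beta>. w = \<alpha> *s p + \<beta> *s q + n)"
  then obtain \<alpha> \<beta> where w: "w = \<alpha> *s p + \<beta> *s q + n" by blast
  have "sp w p = \<alpha> * E" "sp w q = \<beta> * E" using n by (simp_all add: w sp_simps assms qp)
  then show "n = ?n" using w assms(4) by simp
qed

text \<open>\<open>matrix_inv\<close> is a choice among two-sided inverses; the explicit inverse
  shows that there is only one.\<close>

lemma matrix_inv_mat:
  fixes c :: real
  assumes "c \<noteq> 0"
  shows "matrix_inv (mat c :: real^'n^'n) = mat (1 / c)"
proof -
  have m: "mat a ** mat b = (mat (a * b) :: real^'n^'n)" for a b
    by (auto simp: matrix_matrix_mult_def mat_def vec_eq_iff if_distrib[where f = "\<lambda>x. x * _"] cong: if_cong)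
  have "mat c ** mat (1 / c) = (mat 1 :: real^'n^'n) \<and> mat (1 / c) ** mat c = (mat 1 :: real^'n^'n)"
    using assms by (simp add: m)
  then have inv: "mat c ** matrix_inv (mat c :: real^'n^'n) = mat 1"
    unfolding matrix_inv_def by (rule someI2) simp
  have "matrix_inv (mat c :: real^'n^'n) = (mat (1 / c) ** mat c) ** matrix_inv (mat c)"
    using assms by (simp add: m)
  also have "\<dots> = mat (1 / c)" unfolding matrix_mul_assoc[symmetric] inv by simp
  finally show ?thesis .
qed

text \<open>Gram determinants: A J B^T has the scalar products of the rows as entries, and det J =
  1. For the frame itself the Gram matrix is diag(E, E, -1, -1); in the mixed case it is block
  triangular.\<close>

lemma det_vector_sq:
  fixes p q n m :: "real^4"
  assumes "sp p p = E" "sp q q = E" "sp p q = 0" "sp n n = -1" "sp m m = -1" "sp n m = 0"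
    "sp n p = 0" "sp n q = 0" "sp m p = 0" "sp m q = 0"
  shows "det (vector [p, q, n, m] :: real^4^4) ^ 2 = E ^ 2"
    and "det (vector [p, q, u, v] :: real^4^4) * det (vector [p, q, n, m] :: real^4^4) =
      E ^ 2 * (sp u n * sp v m - sp u m * sp v n)"
proof -
  define J where "J = (vector [vector [1,0,0,0], vector [0,1,0,0], vector [0,0,-1,0], vector [0,0,0,-1]] :: real^4^4)"
  have dJ: "det J = 1" by (simp add: det_4 J_def)
  have e: "(A ** J ** transpose B) $ i $ j = sp (A $ i) (B $ j)" for A B :: "real^4^4" and i j
    by (simp add: matrix_matrix_mult_def transpose_def J_def sum_4 sp_def)
  have d: "det (A ** J ** transpose B) = det A * det B" for A B :: "real^4^4"
    by (simp add: det_mul det_transpose dJ)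
  have comm: "sp q p = 0" "sp m n = 0" "sp p n = 0" "sp q n = 0" "sp p m = 0" "sp q m = 0"
    using assms by (simp_all add: sp_commute)
  show "det (vector [p, q, n, m] :: real^4^4) ^ 2 = E ^ 2"
    unfolding power2_eq_square d[symmetric] by (simp add: det_4 e assms comm)
  show "det (vector [p, q, u, v] :: real^4^4) * det (vector [p, q, n, m] :: real^4^4) =
      E ^ 2 * (sp u n * sp v m - sp u m * sp v n)"
    unfolding d[symmetric] by (simp add: det_4 e assms comm power2_eq_square)
qed

section \<open>Surfaces with holomorphic \<open>\<Phi>\<close>\<close>

lemma pd_const [simp]: "pd i (\<lambda>z. c) z = 0"
  by (rule pd_unique[OF has_derivative_const])

lemma pd_nth:
  "f differentiable (at z) \<Longrightarrow> pd i f z $ k = pd i (\<lambda>w. f w $ k) z"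
  by (simp add: pd_linear[OF bounded_linear_vec_nth])

lemma differentiable_nth: "f differentiable (at z) \<Longrightarrow> (\<lambda>w. f w $ k) differentiable (at z)"
  by (rule differentiable_linear[OF bounded_linear_vec_nth])

lemma Phi_nth: "Phi x z $ k = of_real (pd 1 x z $ k) - \<i> * of_real (pd 2 x z $ k)"
  by (simp add: Phi_def cvec_def)

lemma pd_Phi: "pd 1 x z $ k = Re (Phi x z $ k)" "pd 2 x z $ k = - Im (Phi x z $ k)"
  by (simp_all add: Phi_nth)

text \<open>Only differentiability is asked of x itself: its partial derivatives are the real part
  and the negative imaginary part of \<Phi>, so smoothness comes with holomorphy.\<close>

definition hol_phi :: "complex set \<Rightarrow> (complex \<Rightarrow> real^4) \<Rightarrow> bool" where
  "hol_phi U x \<longleftrightarrow> open U \<and> (\<forall>z\<in>U. x differentiable (at z)) \<and> (\<forall>k. (\<lambda>z. Phi x z $ k) holomorphic_on U)"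

lemma hol_phi_Ck_pd:
  assumes "hol_phi U x"
  shows "Ck_on n (pd i x) U"
proof -
  have U: "open U" and h: "(\<lambda>z. Phi x z $ k) holomorphic_on U" for k using assms by (auto simp: hol_phi_def)
  have "Ck_on n (\<lambda>z. Re (Phi x z $ k)) U" "Ck_on n (\<lambda>z. - Im (Phi x z $ k)) U" for k
    by (intro Ck_on_minus U Ck_on_linear[OF bounded_linear_Re] Ck_on_linear[OF bounded_linear_Im] Ck_on_holomorphic h)+
  then have "Ck_on n (pd 1 x) U" "Ck_on n (pd 2 x) U"
    by (intro Ck_on_vec U; simp add: pd_Phi)+
  then show ?thesis using exhaust_2[of i] by auto
qed

lemma hol_phi_Ck:
  assumes "hol_phi U x"
  shows "Ck_on n x U"
proof -
  have "Ck_on (Suc n) x U" using hol_phi_Ck_pd[OF assms] assms by (simp add: hol_phi_def)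
  then show ?thesis by (rule Ck_on_SucD)
qed

lemma hol_phi_pd_differentiable:
  assumes "hol_phi U x" "z \<in> U"
  shows "pd i x differentiable (at z)"
  using hol_phi_Ck_pd[OF assms(1), of "Suc 0" i] assms(2) by simp

lemma hol_phi_second:
  assumes "hol_phi U x" "z \<in> U"
  shows "pd 1 (pd 1 x) z $ k = Re (Phi' x z $ k)" "pd 2 (pd 1 x) z $ k = - Im (Phi' x z $ k)"
    "pd 1 (pd 2 x) z $ k = - Im (Phi' x z $ k)" "pd 2 (pd 2 x) z $ k = - Re (Phi' x z $ k)"
proof -
  have U: "open U" and h: "(\<lambda>z. Phi x z $ k) holomorphic_on U" using assms by (auto simp: hol_phi_def)
  note p = pd_holomorphic[OF h U assms(2)]
  have "pd i (pd 1 x) z $ k = Re (Phi' x z $ k * coord_dir i)" "pd i (pd 2 x) z $ k = - Im (Phi' x z $ k * coord_dir i)" for i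
    using pd_linear[OF bounded_linear_Re p(1), of i] pd_linear[OF bounded_linear_minus[OF bounded_linear_Im] p(1), of i]
    by (simp_all add: pd_nth[OF hol_phi_pd_differentiable[OF assms]] pd_Phi p(2) Phi'_def)
  from this[of 1] this[of 2] show "pd 1 (pd 1 x) z $ k = Re (Phi' x z $ k)" "pd 2 (pd 1 x) z $ k = - Im (Phi' x z $ k)"
    "pd 1 (pd 2 x) z $ k = - Im (Phi' x z $ k)" "pd 2 (pd 2 x) z $ k = - Re (Phi' x z $ k)" by simp_all
qed

lemma hol_phi_second_vec:
  assumes "hol_phi U x" "z \<in> U"
  shows "pd 2 (pd 2 x) z = - pd 1 (pd 1 x) z" "pd 1 (pd 2 x) z = pd 2 (pd 1 x) z"
    "Phi' x z = cvec (pd 1 (pd 1 x) z) - \<i> *s cvec (pd 2 (pd 1 x) z)"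
  by (simp_all add: vec_eq_iff hol_phi_second[OF assms] cvec_def complex_eq_iff)

lemma sp_Phi:
  "sp (Phi x z) (Phi x z) = of_real (sp (pd 1 x z) (pd 1 x z) - sp (pd 2 x z) (pd 2 x z)) - 2 * \<i> * of_real (sp (pd 1 x z) (pd 2 x z))"
  unfolding Phi_def sp_simps sp_cvec by (simp add: sp_commute[of "pd 2 x z" "pd 1 x z"] algebra_simps)

lemma isothermal_iff: "isothermal D x \<longleftrightarrow> (\<forall>z\<in>D. sp (Phi x z) (Phi x z) = 0)"
  unfolding isothermal_def sp_Phi by (simp add: complex_eq_iff)

lemma pd_sp:
  fixes f g :: "complex \<Rightarrow> real^4"
  assumes "f differentiable (at z)" "g differentiable (at z)"
  shows "pd i (\<lambda>z. sp (f z) (g z)) z = sp (f z) (pd i g z) + sp (pd i f z) (g z)"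
  by (rule pd_bilinear[OF bounded_bilinear_sp assms])

lemma isothermal_derivatives:
  assumes "open D" "isothermal D x" "z \<in> D" "\<And>i. pd i x differentiable (at z)"
  shows "sp (pd 1 x z) (pd i (pd 1 x) z) = sp (pd 2 x z) (pd i (pd 2 x) z)"
    "sp (pd 1 x z) (pd i (pd 2 x) z) = - sp (pd 2 x z) (pd i (pd 1 x) z)"
proof -
  have "pd i (\<lambda>z. sp (pd 1 x z) (pd 1 x z)) z = pd i (\<lambda>z. sp (pd 2 x z) (pd 2 x z)) z"
    by (rule pd_cong_open[OF assms(1,3)]) (use assms(2) in \<open>simp add: isothermal_def\<close>)
  then show "sp (pd 1 x z) (pd i (pd 1 x) z) = sp (pd 2 x z) (pd i (pd 2 x) z)"
    by (simp add: pd_sp assms(4) sp_commute)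
  have "pd i (\<lambda>z. sp (pd 1 x z) (pd 2 x z)) z = pd i (\<lambda>z. 0) z"
    by (rule pd_cong_open[OF assms(1,3)]) (use assms(2) in \<open>simp add: isothermal_def\<close>)
  then show "sp (pd 1 x z) (pd i (pd 2 x) z) = - sp (pd 2 x z) (pd i (pd 1 x) z)"
    by (simp add: pd_sp assms(4) sp_commute)
qed

section \<open>Maximal space-like surfaces in isothermal coordinates\<close>

lemma induced_metric_isothermal:
  assumes "isothermal D x" "z \<in> D"
  shows "induced_metric x z = mat (sp (pd 1 x z) (pd 1 x z))"
  using assms unfolding isothermal_def
  by (simp add: induced_metric_def mat_def vec_eq_iff forall_2 sp_commute)

lemma mean_curvature_isothermal:
  assumes "isothermal D x" "z \<in> D" "sp (pd 1 x z) (pd 1 x z) > 0"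
  shows "mean_curvature_vector x z = (1 / (2 * sp (pd 1 x z) (pd 1 x z))) *\<^sub>R
    (normal_part (pd 1 x z) (pd 2 x z) (pd 1 (pd 1 x) z) + normal_part (pd 1 x z) (pd 2 x z) (pd 2 (pd 2 x) z))"
proof -
  have inv: "matrix_inv (induced_metric x z) = mat (1 / sp (pd 1 x z) (pd 1 x z))"
    unfolding induced_metric_isothermal[OF assms(1,2)] by (rule matrix_inv_mat) (use assms(3) in simp)
  show ?thesis
    unfolding mean_curvature_vector_def inv second_fundamental_form_def sum_2
    by (simp add: mat_def scaleR_right_distrib)
qed

text \<open>The differentiated isothermal conditions give \<Phi>'.x_u = i \<Phi>'.x_v, so the
  tangential part of \<Phi>' is a multiple of \<Phi>. This vector is null and orthogonal to the
  normal part, and removing it does not change the square.\<close>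

lemma Phi'_normal_square:
  assumes h: "hol_phi D x" and iso: "isothermal D x" and z: "z \<in> D" and E: "sp (pd 1 x z) (pd 1 x z) > 0"
  shows "sp (Phi'_normal x z) (Phi'_normal x z) = sp (Phi' x z) (Phi' x z)"
proof -
  let ?p = "cvec (pd 1 x z)" and ?q = "cvec (pd 2 x z)" and ?w = "Phi' x z"
  define e where "e = complex_of_real (sp (pd 1 x z) (pd 1 x z))"
  have e: "e \<noteq> 0" using E by (simp add: e_def)
  have pq: "sp ?p ?p = e" "sp ?q ?q = e" "sp ?p ?q = 0" "sp ?q ?p = 0"
    using iso z sp_commute[of ?q ?p] by (simp_all add: sp_cvec e_def isothermal_def)
  note d = isothermal_derivatives[OF _ iso z hol_phi_pd_differentiable[OF h z], of 1]
  note s = hol_phi_second_vec[OF h z]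
  have D: "open D" using h by (simp add: hol_phi_def)
  have "sp ?w ?p = \<i> * sp ?w ?q"
    using d[OF D] unfolding s sp_simps sp_cvec
    by (simp add: complex_eq_iff sp_commute)
  then have 0: "(sp ?w ?p)\<^sup>2 + (sp ?w ?q)\<^sup>2 = 0" by (simp add: power_mult_distrib)
  have "sp (Phi'_normal x z) (Phi'_normal x z) = sp ?w ?w - ((sp ?w ?p)\<^sup>2 + (sp ?w ?q)\<^sup>2) / e"
  proof -
    have c: "sp ?p ?w = sp ?w ?p" "sp ?q ?w = sp ?w ?q" by (simp_all add: sp_commute)
    have a: "W - U / e * U - V / e * V - U / e * (U - U / e * e - V / e * 0) - V / e * (V - U / e * 0 - V / e * e) = W - (U\<^sup>2 + V\<^sup>2) / e"
      for U V W using e by (simp add: field_simps power2_eq_square)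
    show ?thesis
      unfolding Phi'_normal_def normal_part_formula[OF pq(1-3) e] sp_simps pq c
      using a[of "sp ?w ?w" "sp ?w ?p" "sp ?w ?q"] by simp
  qed
  then show ?thesis using 0 by simp
qed

lemma frechet_sp:
  assumes "x differentiable (at z)" "sp (pd 1 x z) (pd 1 x z) = sp (pd 2 x z) (pd 2 x z)" "sp (pd 1 x z) (pd 2 x z) = 0"
  shows "sp (frechet_derivative x (at z) h) (frechet_derivative x (at z) h) = (cmod h)\<^sup>2 * sp (pd 1 x z) (pd 1 x z)"
  using assms(2,3) sp_commute[of "pd 2 x z" "pd 1 x z"]
  unfolding frechet_derivative_pd[OF assms(1)] sp_simps sp_scaleR cmod_power2
  by (simp add: power2_eq_square algebra_simps)

text \<open>Everything is expressed by \<Phi>: null means isothermal, x_u^2 > 0 means space-like,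
  \<Phi>'^2 = -1 means canonical and implies general type, and maximality is the holomorphy of
  \<Phi>.\<close>

theorem MSurf_iff:
  "(D, x) \<in> MSurf \<longleftrightarrow> nbhd0 D \<and> hol_phi D x \<and>
     (\<forall>z\<in>D. sp (Phi x z) (Phi x z) = 0 \<and> sp (pd 1 x z) (pd 1 x z) > 0 \<and> sp (Phi' x z) (Phi' x z) = -1)"
  (is "?L \<longleftrightarrow> ?R")
proof
  assume L: ?L
  then have D: "nbhd0 D" "open D" and sm: "smooth_on x D" and spl: "space_like D x" and mx: "maximal D x"
    and iso: "isothermal D x" and can: "\<And>z. z \<in> D \<Longrightarrow> sp (Phi'_normal x z) (Phi'_normal x z) = -1"
    by (auto simp: MSurf_def nbhd0_def surface_def canonical_def)
  have Ck: "Ck_on k x D" for k using sm by (simp add: smooth_on_def)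
  have d0: "x differentiable (at z)" and d1: "pd i x differentiable (at z)" if "z \<in> D" for z i
    using Ck[of 2] that unfolding numeral_2_eq_2 by auto
  have E: "sp (pd 1 x z) (pd 1 x z) > 0" if z: "z \<in> D" for z
    using spl z unfolding space_like_def by (force simp: pd_def coord_dir_def)
  have harm: "pd 2 (pd 2 x) z = - pd 1 (pd 1 x) z" if z: "z \<in> D" for z
  proof -
    let ?p = "pd 1 x z" and ?q = "pd 2 x z" and ?E = "sp (pd 1 x z) (pd 1 x z)"
    have pq: "sp ?p ?p = ?E" "sp ?q ?q = ?E" "sp ?p ?q = 0" using iso z by (auto simp: isothermal_def)
    note n = normal_part_formula[OF pq less_imp_neq[OF E[OF z], symmetric]]
    have "mean_curvature_vector x z = (1 / (2 * ?E)) *\<^sub>R (normal_part ?p ?q (pd 1 (pd 1 x) z) + normal_part ?p ?q (pd 2 (pd 2 x) z))"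
      by (rule mean_curvature_isothermal[OF iso z E[OF z]])
    \<comment> \<open>In isothermal coordinates x_uu + x_vv is already normal, so the two
      projections add up to it, and vanishing mean curvature means that x is harmonic.\<close>
    moreover have "normal_part ?p ?q (pd 1 (pd 1 x) z) + normal_part ?p ?q (pd 2 (pd 2 x) z) = pd 1 (pd 1 x) z + pd 2 (pd 2 x) z"
    proof -
      note d = isothermal_derivatives[OF D(2) iso z d1[OF z]]
      have c: "pd 2 (pd 1 x) z = pd 1 (pd 2 x) z" by (rule pd_commute[OF D(2) Ck z])
      have "sp (pd 2 (pd 2 x) z) ?p = - sp (pd 1 (pd 1 x) z) ?p" "sp (pd 2 (pd 2 x) z) ?q = - sp (pd 1 (pd 1 x) z) ?q"
        using d[of 1] d[of 2] unfolding c by (simp_all add: sp_commute)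
      then show ?thesis unfolding n by (simp add: vec_eq_iff)
    qed
    ultimately have "pd 1 (pd 1 x) z + pd 2 (pd 2 x) z = 0"
      using mx z E[OF z] by (simp add: maximal_def)
    then show ?thesis by (simp add: eq_neg_iff_add_eq_0 add.commute)
  qed
  have h: "hol_phi D x"
    unfolding hol_phi_def
  proof (intro conjI ballI allI D(2) d0)
    fix k
    show "(\<lambda>z. Phi x z $ k) holomorphic_on D"
    proof (rule holomorphic_wirt(1))
      fix z assume z: "z \<in> D"
      have r1: "wirt (\<lambda>z. of_real (pd 1 x z $ k)) (Complex (pd 1 (pd 1 x) z $ k / 2) (- (pd 2 (pd 1 x) z $ k) / 2))
          (Complex (pd 1 (pd 1 x) z $ k / 2) (pd 2 (pd 1 x) z $ k / 2)) z"
        and r2: "wirt (\<lambda>z. of_real (pd 2 x z $ k)) (Complex (pd 1 (pd 2 x) z $ k / 2) (- (pd 2 (pd 2 x) z $ k) / 2))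
          (Complex (pd 1 (pd 2 x) z $ k / 2) (pd 2 (pd 2 x) z $ k / 2)) z"
        using real_wirt[OF differentiable_nth[OF d1[OF z, of 1]]] real_wirt[OF differentiable_nth[OF d1[OF z, of 2]]]
        by (simp_all add: pd_nth[OF d1[OF z]])
      have c: "pd 2 (pd 1 x) z = pd 1 (pd 2 x) z" by (rule pd_commute[OF D(2) Ck z])
      \<comment> \<open>The conjugate derivative of \<Phi> is (x_uu + x_vv)/2, once the mixed
        derivatives are identified.\<close>
      show "wirt (\<lambda>z. Phi x z $ k) (of_real (pd 1 (pd 1 x) z $ k) - \<i> * of_real (pd 2 (pd 1 x) z $ k)) 0 z"
        unfolding Phi_nth
        by (rule wirt_rewrite[OF wirt_diff[OF r1 wirt_cmult[OF r2]]])
           (simp_all add: complex_eq_iff harm[OF z] c)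
    qed
  qed
  show ?R
    using D(1) h E iso can Phi'_normal_square[OF h iso _ E] by (auto simp: isothermal_iff)
next
  assume R: ?R
  then have D: "nbhd0 D" "open D" and h: "hol_phi D x" and E: "\<And>z. z \<in> D \<Longrightarrow> sp (pd 1 x z) (pd 1 x z) > 0"
    and iso: "isothermal D x" and P: "\<And>z. z \<in> D \<Longrightarrow> sp (Phi' x z) (Phi' x z) = -1"
    by (auto simp: nbhd0_def isothermal_iff)
  have d0: "x differentiable (at z)" if "z \<in> D" for z using h that by (auto simp: hol_phi_def)
  have spf: "sp (frechet_derivative x (at z) v) (frechet_derivative x (at z) v) = (cmod v)\<^sup>2 * sp (pd 1 x z) (pd 1 x z)"
    if z: "z \<in> D" for z v
    by (rule frechet_sp) (use d0[OF z] iso z in \<open>auto simp: isothermal_def\<close>)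
  have "space_like D x" unfolding space_like_def using spf E by simp
  moreover have "surface D x"
    unfolding surface_def
  proof (intro conjI ballI)
    show "smooth_on x D" unfolding smooth_on_def using hol_phi_Ck[OF h] by blast
    fix z assume z: "z \<in> D"
    have lin: "linear (frechet_derivative x (at z))" by (rule linear_frechet_derivative[OF d0[OF z]])
    show "inj (frechet_derivative x (at z))"
      unfolding linear_injective_0[OF lin]
    proof (intro allI impI)
      fix v assume "frechet_derivative x (at z) v = 0"
      then have "(cmod v)\<^sup>2 * sp (pd 1 x z) (pd 1 x z) = 0" using spf[OF z, of v] by (simp add: sp_def)
      then show "v = 0" using E[OF z] by simp
    qed
  qed
  moreover have "maximal D x"
    unfolding maximal_def
  proof
    fix z assume z: "z \<in> D"
    let ?p = "pd 1 x z" and ?q = "pd 2 x z" and ?E = "sp (pd 1 x z) (pd 1 x z)"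
    have pq: "sp ?p ?p = ?E" "sp ?q ?q = ?E" "sp ?p ?q = 0" using iso z by (auto simp: isothermal_def)
    note n = normal_part_formula[OF pq less_imp_neq[OF E[OF z], symmetric]]
    have "mean_curvature_vector x z = (1 / (2 * ?E)) *\<^sub>R (normal_part ?p ?q (pd 1 (pd 1 x) z) + normal_part ?p ?q (pd 2 (pd 2 x) z))"
      by (rule mean_curvature_isothermal[OF iso z E[OF z]])
    also have "normal_part ?p ?q (pd 1 (pd 1 x) z) + normal_part ?p ?q (pd 2 (pd 2 x) z) = 0"
      unfolding n hol_phi_second_vec(1)[OF h z] sp_simps by (simp add: vec_eq_iff)
    finally show "mean_curvature_vector x z = 0" by simp
  qed
  moreover have "sp (Phi'_normal x z) (Phi'_normal x z) = -1" if "z \<in> D" for z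
    using Phi'_normal_square[OF h iso that E[OF that]] P[OF that] by simp
  ultimately show ?L unfolding MSurf_def general_type_def canonical_def using D(1) iso by simp
qed

section \<open>Curvatures in isothermal coordinates\<close>

text \<open>With the conformal factor written as e^L the Christoffel symbols are linear in the first
  derivatives of L, and the quadratic terms of the Riemann tensor cancel.\<close>

lemma gauss_curvature_isothermal:
  assumes U: "open U" and g: "\<And>w. w \<in> U \<Longrightarrow> g w = mat (exp (L w))" and L: "Ck_on 2 L U" and z: "z \<in> U"
  shows "gauss_curvature g z = - laplacian L z / (2 * exp (L z))"
proof -
  have d: "L differentiable (at w)" "pd i L differentiable (at w)" if "w \<in> U" for w i
    using L that unfolding numeral_2_eq_2 by auto
  have pg: "pd i (\<lambda>w. g w $ j $ l) w = (if j = l then exp (L w) * pd i L w else 0)" if w: "w \<in> U" for i j l w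
  proof -
    have "pd i (\<lambda>w. g w $ j $ l) w = pd i (\<lambda>w. if j = l then exp (L w) else 0) w"
      by (rule pd_cong_open[OF U w]) (simp add: g mat_def)
    also have "\<dots> = (if j = l then exp (L w) * pd i L w else 0)"
      using pd_chain(2)[OF d(1)[OF w] DERIV_exp] by simp
    finally show ?thesis .
  qed
  have ch: "christoffel g k i j w = ((if j = k then pd i L w else 0) + (if i = k then pd j L w else 0) - (if i = j then pd k L w else 0)) / 2"
    if w: "w \<in> U" for k i j w
  proof -
    have inv: "matrix_inv (g w) $ k $ l = (if k = l then 1 / exp (L w) else 0)" for l
      unfolding g[OF w] matrix_inv_mat[OF exp_not_eq_zero] by (simp add: mat_def)
    show ?thesis
      unfolding christoffel_def inv pg[OF w] using exhaust_2[of k]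
      by (auto simp: sum_2 field_simps)
  qed
  have pdc: "pd m (christoffel g k i j) z = ((if j = k then pd m (pd i L) z else 0) + (if i = k then pd m (pd j L) z else 0) - (if i = j then pd m (pd k L) z else 0)) / 2"
    for m k i j
  proof -
    have "pd m (christoffel g k i j) z = pd m (\<lambda>w. (if j = k then 1/2 else 0) * pd i L w + ((if i = k then 1/2 else 0) * pd j L w + (if i = j then -1/2 else 0) * pd k L w)) z"
      by (rule pd_cong_open[OF U z]) (simp add: ch)
    also have "\<dots> = (if j = k then 1/2 else 0) * pd m (pd i L) z + ((if i = k then 1/2 else 0) * pd m (pd j L) z + (if i = j then -1/2 else 0) * pd m (pd k L) z)"
      using d(2)[OF z] by (simp add: pd_add pd_linear[OF bounded_linear_mult_right] differentiable_linear[OF bounded_linear_mult_right])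
    finally show ?thesis by simp
  qed
  have r: "riemann g 1 1 2 2 z = - (pd 1 (pd 1 L) z + pd 2 (pd 2 L) z) / 2"
    unfolding riemann_def pdc ch[OF z] sum_2 by simp
  have "gauss_curvature g z = exp (L z) * riemann g 1 1 2 2 z / (exp (L z) * exp (L z))"
    unfolding gauss_curvature_def g[OF z] by (simp add: sum_2 det_2 mat_def)
  then show ?thesis unfolding r laplacian_def by simp
qed

section \<open>The curvature of the normal connection\<close>

text \<open>Pairing with a vector m normal at z removes all tangential terms. The inner projection
  is then felt only through the derivatives of x_u and x_v, multiplied by the tangential
  coefficients of the derivative of n. This yields the last two summands, products of second
  fundamental forms in which x_vv = -x_uu has been inserted.\<close>

lemma second_normal_derivative:
  assumes W: "open W" and h: "hol_phi W x" and iso: "isothermal W x" and E: "\<And>w. w \<in> W \<Longrightarrow> sp (pd 1 x w) (pd 1 x w) > 0"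
    and Y: "Ck_on 2 Y W" and n: "Ck_on 2 n W" and perp: "\<And>w i. w \<in> W \<Longrightarrow> sp (n w) (pd i x w) = 0"
    and z: "z \<in> W" and m: "\<And>i. sp m (pd i x z) = 0"
  shows "sp (normal_connection x X (normal_connection x Y n) z) m =
    Re (X z) * (Re (pd 1 Y z) * sp (pd 1 n z) m + Re (Y z) * sp (pd 1 (pd 1 n) z) m
        + Im (pd 1 Y z) * sp (pd 2 n z) m + Im (Y z) * sp (pd 1 (pd 2 n) z) m)
    + Im (X z) * (Re (pd 2 Y z) * sp (pd 1 n z) m + Re (Y z) * sp (pd 2 (pd 1 n) z) m
        + Im (pd 2 Y z) * sp (pd 2 n z) m + Im (Y z) * sp (pd 2 (pd 2 n) z) m)
    + (Re (Y z) * sp (n z) (pd 1 (pd 1 x) z) + Im (Y z) * sp (n z) (pd 2 (pd 1 x) z)) / sp (pd 1 x z) (pd 1 x z)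
      * (Re (X z) * sp (pd 1 (pd 1 x) z) m + Im (X z) * sp (pd 2 (pd 1 x) z) m)
    + (Re (Y z) * sp (n z) (pd 2 (pd 1 x) z) - Im (Y z) * sp (n z) (pd 1 (pd 1 x) z)) / sp (pd 1 x z) (pd 1 x z)
      * (Re (X z) * sp (pd 2 (pd 1 x) z) m - Im (X z) * sp (pd 1 (pd 1 x) z) m)"
proof -
  let ?p = "pd 1 x" and ?q = "pd 2 x"
  define e where "e = (\<lambda>w. sp (?p w) (?p w))"
  have pq: "sp (?p w) (?p w) = e w" "sp (?q w) (?q w) = e w" "sp (?p w) (?q w) = 0" "e w \<noteq> 0" if "w \<in> W" for w
    using iso that E[OF that] by (auto simp: isothermal_def e_def)
  have d: "Y differentiable (at w)" "n differentiable (at w)" "pd i n differentiable (at w)" "pd i x differentiable (at w)"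
    if "w \<in> W" for w i
    using Y n that hol_phi_pd_differentiable[OF h that] unfolding numeral_2_eq_2 by auto
  note dRe = differentiable_linear[OF bounded_linear_Re] and dIm = differentiable_linear[OF bounded_linear_Im]
  have dsp: "(\<lambda>w. sp (f w) (g w)) differentiable (at w)" if "f differentiable (at w)" "g differentiable (at w)"
    for f g :: "complex \<Rightarrow> real^4" and w
    using bounded_bilinear.FDERIV[OF bounded_bilinear_sp] that unfolding differentiable_def by blast
  have dsc: "(\<lambda>w. f w *\<^sub>R g w) differentiable (at w)" if "f differentiable (at w)" "g differentiable (at w)"
    for f :: "complex \<Rightarrow> real" and g :: "complex \<Rightarrow> real^4" and w
    using that by (rule differentiable_scaleR)
  define V where "V = (\<lambda>w. Re (Y w) *\<^sub>R pd 1 n w + Im (Y w) *\<^sub>R pd 2 n w)"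
  have DV: "dir_deriv Y n w = V w" if "w \<in> W" for w
    unfolding dir_deriv_def V_def by (rule frechet_derivative_pd[OF d(2)[OF that]])
  have dV: "V differentiable (at z)"
    unfolding V_def by (intro differentiable_add dsc dRe dIm d z)
  \<comment> \<open>\<open>c\<close> and \<open>b\<close> are the tangential coefficients of the
    derivative of n along Y.\<close>
  define c where "c = (\<lambda>w. sp (V w) (?p w) / e w)"
  define b where "b = (\<lambda>w. sp (V w) (?q w) / e w)"
  have dcb: "c differentiable (at z)" "b differentiable (at z)"
    unfolding c_def b_def e_def
    by (intro differentiable_divide dsp dV d z; use pq(4)[OF z] in \<open>simp add: e_def\<close>)+
  have nc: "normal_connection x Y n w = V w - c w *\<^sub>R ?p w - b w *\<^sub>R ?q w" if w: "w \<in> W" for w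
    unfolding normal_connection_def DV[OF w] normal_part_formula[OF pq[OF w]] c_def b_def scalar_mult_eq_scaleR ..
  have pdnc: "pd i (normal_connection x Y n) z = pd i (\<lambda>w. V w - c w *\<^sub>R ?p w - b w *\<^sub>R ?q w) z" for i
    by (rule pd_cong_open[OF W z nc])
  have dG: "(\<lambda>w. V w - c w *\<^sub>R ?p w - b w *\<^sub>R ?q w) differentiable (at z)"
    by (intro differentiable_diff dV dsc dcb d z)
  have dnc: "normal_connection x Y n differentiable (at z)"
    by (rule differentiable_cong_open[OF W z _ dG]) (rule nc[symmetric])
  have pdV: "pd i V z = Re (Y z) *\<^sub>R pd i (pd 1 n) z + Re (pd i Y z) *\<^sub>R pd 1 n z
       + (Im (Y z) *\<^sub>R pd i (pd 2 n) z + Im (pd i Y z) *\<^sub>R pd 2 n z)" for i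
    unfolding V_def
    using pd_add[OF dsc[OF dRe[OF d(1)[OF z]] d(3)[OF z, of 1]] dsc[OF dIm[OF d(1)[OF z]] d(3)[OF z, of 2]], of i]
      pd_bilinear[OF bounded_bilinear_scaleR dRe[OF d(1)[OF z]] d(3)[OF z, of 1], of i]
      pd_bilinear[OF bounded_bilinear_scaleR dIm[OF d(1)[OF z]] d(3)[OF z, of 2], of i]
      pd_linear[OF bounded_linear_Re d(1)[OF z], of i] pd_linear[OF bounded_linear_Im d(1)[OF z], of i]
    by simp
  have pdG: "pd i (\<lambda>w. V w - c w *\<^sub>R ?p w - b w *\<^sub>R ?q w) z = pd i V z - (c z *\<^sub>R pd i ?p z + pd i c z *\<^sub>R ?p z)
      - (b z *\<^sub>R pd i ?q z + pd i b z *\<^sub>R ?q z)" for i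
  proof -
    have s: "pd i (\<lambda>w. f w - g w) z = pd i f z - pd i g z" if "f differentiable (at z)" "g differentiable (at z)"
      for f g :: "complex \<Rightarrow> real^4"
      using pd_unique[OF has_derivative_diff[OF has_derivative_pd[OF that(1)] has_derivative_pd[OF that(2)]], of i]
        pd_unique[OF has_derivative_pd[OF that(1)], of i] pd_unique[OF has_derivative_pd[OF that(2)], of i] by simp
    have d1: "(\<lambda>w. c w *\<^sub>R ?p w) differentiable (at z)" "(\<lambda>w. b w *\<^sub>R ?q w) differentiable (at z)"
      by (intro dsc dcb d z)+
    show ?thesis
      using s[OF differentiable_diff[OF dV d1(1)] d1(2)] s[OF dV d1(1)]
        pd_bilinear[OF bounded_bilinear_scaleR dcb(1) d(4)[OF z, of 1], of i]
        pd_bilinear[OF bounded_bilinear_scaleR dcb(2) d(4)[OF z, of 2], of i] by simp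
  qed
  have m': "sp (pd i x z) m = 0" for i using m[of i] by (simp add: sp_commute)
  have S: "sp (pd i (normal_connection x Y n) z) m =
      Re (Y z) * sp (pd i (pd 1 n) z) m + Re (pd i Y z) * sp (pd 1 n z) m
       + (Im (Y z) * sp (pd i (pd 2 n) z) m + Im (pd i Y z) * sp (pd 2 n z) m)
       - c z * sp (pd i ?p z) m - b z * sp (pd i ?q z) m" for i
    unfolding pdnc pdG pdV sp_simps sp_scaleR m' by simp
  \<comment> \<open>Differentiating the orthogonality of n to the tangent plane trades derivatives
    of n for second derivatives of x.\<close>
  have perp': "sp (pd i n z) (pd j x z) = - sp (n z) (pd i (pd j x) z)" for i j
  proof -
    have "pd i (\<lambda>w. sp (n w) (pd j x w)) z = pd i (\<lambda>w. 0) z"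
      by (rule pd_cong_open[OF W z]) (rule perp)
    then show ?thesis using pd_sp[OF d(2)[OF z] d(4)[OF z, of j], of i] by simp
  qed
  note s2 = hol_phi_second_vec(1,2)[OF h z]
  have cz: "c z = - (Re (Y z) * sp (n z) (pd 1 ?p z) + Im (Y z) * sp (n z) (pd 2 ?p z)) / e z"
    and bz: "b z = - (Re (Y z) * sp (n z) (pd 2 ?p z) - Im (Y z) * sp (n z) (pd 1 ?p z)) / e z"
    unfolding c_def b_def V_def sp_simps sp_scaleR perp' s2 by (simp_all add: algebra_simps)
  have N: "normal_connection x X (normal_connection x Y n) z = normal_part (?p z) (?q z)
      (Re (X z) *\<^sub>R pd 1 (normal_connection x Y n) z + Im (X z) *\<^sub>R pd 2 (normal_connection x Y n) z)"
    unfolding normal_connection_def[of x X] dir_deriv_def frechet_derivative_pd[OF dnc] ..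
  have "sp (normal_connection x X (normal_connection x Y n) z) m =
      Re (X z) * sp (pd 1 (normal_connection x Y n) z) m + Im (X z) * sp (pd 2 (normal_connection x Y n) z) m"
    unfolding N normal_part_formula[OF pq[OF z]] sp_simps sp_scaleR m' by simp
  then show ?thesis
    unfolding S cz bz s2 pq(1)[OF z] sp_simps by (simp add: divide_inverse algebra_simps)
qed

text \<open>Ricci equation. Derivatives of X1 and X2 cancel against the Lie bracket, second
  derivatives of n2 cancel by symmetry, and only products of second fundamental forms remain. The
  second formula contains no frame, which proves the independence of the choice.\<close>

lemma normal_riemann_frame:
  assumes W: "open W" and h: "hol_phi W x" and iso: "isothermal W x" and E: "\<And>w. w \<in> W \<Longrightarrow> sp (pd 1 x w) (pd 1 x w) > 0"
    and z: "z \<in> W" and U: "open U" "z \<in> U" and fr: "adapted_frame x U X\<^sub>1 X\<^sub>2 n\<^sub>1 n\<^sub>2"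
  shows "sp (normal_riemann x X\<^sub>1 X\<^sub>2 n\<^sub>2 z) (n\<^sub>1 z) = 2 * (Re (X\<^sub>1 z) * Im (X\<^sub>2 z) - Im (X\<^sub>1 z) * Re (X\<^sub>2 z)) / sp (pd 1 x z) (pd 1 x z)
      * (sp (pd 1 (pd 1 x) z) (n\<^sub>1 z) * sp (pd 2 (pd 1 x) z) (n\<^sub>2 z) - sp (pd 1 (pd 1 x) z) (n\<^sub>2 z) * sp (pd 2 (pd 1 x) z) (n\<^sub>1 z))"
    and "sp (normal_riemann x X\<^sub>1 X\<^sub>2 n\<^sub>2 z) (n\<^sub>1 z) = 2 / (sp (pd 1 x z) (pd 1 x z)) ^ 3 *
      det (vector [pd 1 x z, pd 2 x z, pd 1 (pd 1 x) z, pd 2 (pd 1 x) z] :: real^4^4)"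
proof -
  let ?O = "W \<inter> U"
  let ?p = "pd 1 x z" and ?q = "pd 2 x z" and ?e = "sp (pd 1 x z) (pd 1 x z)"
  have O: "open ?O" "z \<in> ?O" using W U z by auto
  have hO: "hol_phi ?O x" using h O(1) unfolding hol_phi_def by (auto intro: holomorphic_on_subset)
  have isoO: "isothermal ?O x" using iso by (auto simp: isothermal_def)
  have EO: "sp (pd 1 x w) (pd 1 x w) > 0" if "w \<in> ?O" for w using E that by auto
  have CU: "Ck_on 2 X\<^sub>1 U" "Ck_on 2 X\<^sub>2 U" "Ck_on 2 n\<^sub>1 U" "Ck_on 2 n\<^sub>2 U"
    using fr by (auto simp: adapted_frame_def smooth_on_def)
  have C: "Ck_on 2 X\<^sub>1 ?O" "Ck_on 2 X\<^sub>2 ?O" "Ck_on 2 n\<^sub>1 ?O" "Ck_on 2 n\<^sub>2 ?O"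
    using CU Ck_on_subset by blast+
  have perp: "sp (n\<^sub>1 w) (pd i x w) = 0" "sp (n\<^sub>2 w) (pd i x w) = 0" if "w \<in> U" for w i
    using fr that by (auto simp: adapted_frame_def Let_def)
  define a where "a = Re (X\<^sub>1 z)"
  define b where "b = Im (X\<^sub>1 z)"
  define c where "c = Re (X\<^sub>2 z)"
  define d where "d = Im (X\<^sub>2 z)"
  have dx: "x differentiable (at z)" using h z by (auto simp: hol_phi_def)
  have T: "dir_deriv X\<^sub>1 x z = a *\<^sub>R ?p + b *\<^sub>R ?q" "dir_deriv X\<^sub>2 x z = c *\<^sub>R ?p + d *\<^sub>R ?q"
    unfolding dir_deriv_def frechet_derivative_pd[OF dx] a_def b_def c_def d_def by auto
  have f: "sp (a *\<^sub>R ?p + b *\<^sub>R ?q) (a *\<^sub>R ?p + b *\<^sub>R ?q) = 1" "sp (c *\<^sub>R ?p + d *\<^sub>R ?q) (c *\<^sub>R ?p + d *\<^sub>R ?q) = 1"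
    "sp (a *\<^sub>R ?p + b *\<^sub>R ?q) (c *\<^sub>R ?p + d *\<^sub>R ?q) = 0"
    "sp (n\<^sub>1 z) (n\<^sub>1 z) = -1" "sp (n\<^sub>2 z) (n\<^sub>2 z) = -1" "sp (n\<^sub>1 z) (n\<^sub>2 z) = 0"
    "det (vector [a *\<^sub>R ?p + b *\<^sub>R ?q, c *\<^sub>R ?p + d *\<^sub>R ?q, n\<^sub>1 z, n\<^sub>2 z] :: real^4^4) > 0"
    using fr U(2) by (auto simp: adapted_frame_def Let_def T)
  have pq: "sp ?q ?q = ?e" "sp ?p ?q = 0" "sp ?q ?p = 0"
    using iso z by (auto simp: isothermal_def sp_commute[of ?q ?p])
  define e where "e = ?e"
  have e: "e > 0" using E[OF z] by (simp add: e_def)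
  have g: "e * (a * a + b * b) = 1" "e * (c * c + d * d) = 1" "e * (a * c + b * d) = 0"
    using f(1-3) unfolding sp_simps sp_scaleR pq e_def by (simp_all add: algebra_simps)
  \<comment> \<open>Determinant of (X1, X2) in the coordinate basis; orthonormality makes it 1/e up
    to sign.\<close>
  define \<delta> where "\<delta> = a * d - b * c"
  have \<delta>2: "(e * \<delta>)\<^sup>2 = 1"
  proof -
    have "(e * \<delta>)\<^sup>2 = (e * (a * a + b * b)) * (e * (c * c + d * d)) - (e * (a * c + b * d))\<^sup>2"
      unfolding \<delta>_def by algebra
    then show ?thesis unfolding g by simp
  qed
  define B where "B = det (vector [?p, ?q, n\<^sub>1 z, n\<^sub>2 z] :: real^4^4)"
  define A1 where "A1 = sp (pd 1 (pd 1 x) z) (n\<^sub>1 z)"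
  define B1 where "B1 = sp (pd 2 (pd 1 x) z) (n\<^sub>1 z)"
  define A2 where "A2 = sp (pd 1 (pd 1 x) z) (n\<^sub>2 z)"
  define B2 where "B2 = sp (pd 2 (pd 1 x) z) (n\<^sub>2 z)"
  define C4 where "C4 = det (vector [?p, ?q, pd 1 (pd 1 x) z, pd 2 (pd 1 x) z] :: real^4^4)"
  note gram = det_vector_sq[of ?p e ?q "n\<^sub>1 z" "n\<^sub>2 z", OF e_def[symmetric] pq(1)[folded e_def] pq(2) f(4-6) perp(1)[OF U(2), of 1] perp(1)[OF U(2), of 2]
    perp(2)[OF U(2), of 1] perp(2)[OF U(2), of 2]]
  have B2': "B\<^sup>2 = e\<^sup>2" using gram(1) by (simp add: B_def)
  have CB: "C4 * B = e\<^sup>2 * (A1 * B2 - A2 * B1)" using gram(2) by (simp add: B_def C4_def A1_def A2_def B1_def B2_def)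
  have "det (vector [a *\<^sub>R ?p + b *\<^sub>R ?q, c *\<^sub>R ?p + d *\<^sub>R ?q, n\<^sub>1 z, n\<^sub>2 z] :: real^4^4) = \<delta> * B"
    unfolding B_def \<delta>_def det_4 by simp algebra
  then have dB: "\<delta> * B > 0" using f(7) by simp
  have "(\<delta> * B)\<^sup>2 = 1" using \<delta>2 B2' by algebra
  \<comment> \<open>The orientation enters here: it ties the sign of \<delta> to that of
    \<open>B\<close>, so both disappear from the final formula.\<close>
  then have dB1: "\<delta> * B = 1" using dB by (simp add: power2_eq_1_iff)
  have lie: "lie_bracket X\<^sub>1 X\<^sub>2 z = (of_real a * pd 1 X\<^sub>2 z + of_real b * pd 2 X\<^sub>2 z) - (of_real c * pd 1 X\<^sub>1 z + of_real d * pd 2 X\<^sub>1 z)"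
  proof -
    have "X\<^sub>1 differentiable (at z)" "X\<^sub>2 differentiable (at z)" using C O(2) unfolding numeral_2_eq_2 by auto
    then show ?thesis
      unfolding lie_bracket_def dir_deriv_def by (simp add: frechet_derivative_pd a_def b_def c_def d_def scaleR_conv_of_real)
  qed
  have dn: "n\<^sub>2 differentiable (at z)" using C O(2) unfolding numeral_2_eq_2 by auto
  have perp1: "sp (pd i x z) (n\<^sub>1 z) = 0" for i using perp(1)[OF U(2), of i] by (simp add: sp_commute)
  have L: "sp (normal_connection x (lie_bracket X\<^sub>1 X\<^sub>2) n\<^sub>2 z) (n\<^sub>1 z) =
     (a * Re (pd 1 X\<^sub>2 z) + b * Re (pd 2 X\<^sub>2 z) - c * Re (pd 1 X\<^sub>1 z) - d * Re (pd 2 X\<^sub>1 z)) * sp (pd 1 n\<^sub>2 z) (n\<^sub>1 z)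
     + (a * Im (pd 1 X\<^sub>2 z) + b * Im (pd 2 X\<^sub>2 z) - c * Im (pd 1 X\<^sub>1 z) - d * Im (pd 2 X\<^sub>1 z)) * sp (pd 2 n\<^sub>2 z) (n\<^sub>1 z)"
    unfolding normal_connection_def dir_deriv_def frechet_derivative_pd[OF dn] lie
      normal_part_formula[OF e_def[symmetric] pq(1)[folded e_def] pq(2) less_imp_neq[OF e, symmetric]] sp_simps sp_scaleR perp1
    by (simp add: algebra_simps)
  have sym: "pd 1 (pd 2 n\<^sub>2) z = pd 2 (pd 1 n\<^sub>2) z" by (rule pd_commute[OF O(1) C(4) O(2)])
  have comm: "sp (n\<^sub>2 z) v = sp v (n\<^sub>2 z)" for v by (rule sp_commute)
  have e1: "sp (normal_connection x X\<^sub>1 (normal_connection x X\<^sub>2 n\<^sub>2) z) (n\<^sub>1 z) =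
    a * (Re (pd 1 X\<^sub>2 z) * sp (pd 1 n\<^sub>2 z) (n\<^sub>1 z) + c * sp (pd 1 (pd 1 n\<^sub>2) z) (n\<^sub>1 z)
        + Im (pd 1 X\<^sub>2 z) * sp (pd 2 n\<^sub>2 z) (n\<^sub>1 z) + d * sp (pd 2 (pd 1 n\<^sub>2) z) (n\<^sub>1 z))
    + b * (Re (pd 2 X\<^sub>2 z) * sp (pd 1 n\<^sub>2 z) (n\<^sub>1 z) + c * sp (pd 2 (pd 1 n\<^sub>2) z) (n\<^sub>1 z)
        + Im (pd 2 X\<^sub>2 z) * sp (pd 2 n\<^sub>2 z) (n\<^sub>1 z) + d * sp (pd 2 (pd 2 n\<^sub>2) z) (n\<^sub>1 z))
    + (c * A2 + d * B2) / e * (a * A1 + b * B1) + (c * B2 - d * A2) / e * (a * B1 - b * A1)"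
    using second_normal_derivative[OF O(1) hO isoO EO C(2) C(4) perp(2) O(2) perp(1)[OF U(2)], of X\<^sub>1]
    unfolding sym comm a_def b_def c_def d_def e_def A1_def A2_def B1_def B2_def by simp
  have e2: "sp (normal_connection x X\<^sub>2 (normal_connection x X\<^sub>1 n\<^sub>2) z) (n\<^sub>1 z) =
    c * (Re (pd 1 X\<^sub>1 z) * sp (pd 1 n\<^sub>2 z) (n\<^sub>1 z) + a * sp (pd 1 (pd 1 n\<^sub>2) z) (n\<^sub>1 z)
        + Im (pd 1 X\<^sub>1 z) * sp (pd 2 n\<^sub>2 z) (n\<^sub>1 z) + b * sp (pd 2 (pd 1 n\<^sub>2) z) (n\<^sub>1 z))
    + d * (Re (pd 2 X\<^sub>1 z) * sp (pd 1 n\<^sub>2 z) (n\<^sub>1 z) + a * sp (pd 2 (pd 1 n\<^sub>2) z) (n\<^sub>1 z)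
        + Im (pd 2 X\<^sub>1 z) * sp (pd 2 n\<^sub>2 z) (n\<^sub>1 z) + b * sp (pd 2 (pd 2 n\<^sub>2) z) (n\<^sub>1 z))
    + (a * A2 + b * B2) / e * (c * A1 + d * B1) + (a * B2 - b * A2) / e * (c * B1 - d * A1)"
    using second_normal_derivative[OF O(1) hO isoO EO C(1) C(4) perp(2) O(2) perp(1)[OF U(2)], of X\<^sub>2]
    unfolding sym comm a_def b_def c_def d_def e_def A1_def A2_def B1_def B2_def by simp
  have "sp (normal_riemann x X\<^sub>1 X\<^sub>2 n\<^sub>2 z) (n\<^sub>1 z) =
    ((c * A2 + d * B2) / e * (a * A1 + b * B1) + (c * B2 - d * A2) / e * (a * B1 - b * A1))
    - ((a * A2 + b * B2) / e * (c * A1 + d * B1) + (a * B2 - b * A2) / e * (c * B1 - d * A1))"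
    unfolding normal_riemann_def sp_simps e1 e2 L by (simp add: algebra_simps)
  also have "\<dots> = 2 * \<delta> / e * (A1 * B2 - A2 * B1)"
    unfolding \<delta>_def using e by (simp add: field_simps)
  finally have R: "sp (normal_riemann x X\<^sub>1 X\<^sub>2 n\<^sub>2 z) (n\<^sub>1 z) = 2 * \<delta> / e * (A1 * B2 - A2 * B1)" .
  then show "sp (normal_riemann x X\<^sub>1 X\<^sub>2 n\<^sub>2 z) (n\<^sub>1 z) = 2 * (Re (X\<^sub>1 z) * Im (X\<^sub>2 z) - Im (X\<^sub>1 z) * Re (X\<^sub>2 z)) / sp (pd 1 x z) (pd 1 x z)
      * (sp (pd 1 (pd 1 x) z) (n\<^sub>1 z) * sp (pd 2 (pd 1 x) z) (n\<^sub>2 z) - sp (pd 1 (pd 1 x) z) (n\<^sub>2 z) * sp (pd 2 (pd 1 x) z) (n\<^sub>1 z))"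
    unfolding \<delta>_def a_def b_def c_def d_def e_def A1_def A2_def B1_def B2_def .
  have D: "A1 * B2 - A2 * B1 = C4 * B / e\<^sup>2" using CB e by simp
  have "sp (normal_riemann x X\<^sub>1 X\<^sub>2 n\<^sub>2 z) (n\<^sub>1 z) = 2 * (\<delta> * B) * C4 / e ^ 3"
    unfolding R D by (simp add: power2_eq_square power3_eq_cube mult_ac)
  then show "sp (normal_riemann x X\<^sub>1 X\<^sub>2 n\<^sub>2 z) (n\<^sub>1 z) = 2 / (sp (pd 1 x z) (pd 1 x z)) ^ 3 *
      det (vector [pd 1 x z, pd 2 x z, pd 1 (pd 1 x) z, pd 2 (pd 1 x) z] :: real^4^4)"
    unfolding dB1 e_def C4_def by simp
qed

text \<open>All frames give the frame-free value, which settles uniqueness in the definite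
  description; the given frame settles existence.\<close>

lemma normal_curvature_frame:
  assumes W: "open W" and h: "hol_phi W x" and iso: "isothermal W x" and E: "\<And>w. w \<in> W \<Longrightarrow> sp (pd 1 x w) (pd 1 x w) > 0"
    and z: "z \<in> W" and U: "open U" "z \<in> U" and fr: "adapted_frame x U X\<^sub>1 X\<^sub>2 n\<^sub>1 n\<^sub>2"
  shows "normal_curvature x z = sp (normal_riemann x X\<^sub>1 X\<^sub>2 n\<^sub>2 z) (n\<^sub>1 z)"
  unfolding normal_curvature_def
proof (rule the_equality)
  show "\<exists>U Y\<^sub>1 Y\<^sub>2 m\<^sub>1 m\<^sub>2. open U \<and> z \<in> U \<and> adapted_frame x U Y\<^sub>1 Y\<^sub>2 m\<^sub>1 m\<^sub>2 \<and>
      sp (normal_riemann x X\<^sub>1 X\<^sub>2 n\<^sub>2 z) (n\<^sub>1 z) = sp (normal_riemann x Y\<^sub>1 Y\<^sub>2 m\<^sub>2 z) (m\<^sub>1 z)"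
    using U fr by blast
  fix \<kappa> assume "\<exists>U Y\<^sub>1 Y\<^sub>2 m\<^sub>1 m\<^sub>2. open U \<and> z \<in> U \<and> adapted_frame x U Y\<^sub>1 Y\<^sub>2 m\<^sub>1 m\<^sub>2 \<and>
      \<kappa> = sp (normal_riemann x Y\<^sub>1 Y\<^sub>2 m\<^sub>2 z) (m\<^sub>1 z)"
  then obtain V Y\<^sub>1 Y\<^sub>2 m\<^sub>1 m\<^sub>2 where V: "open V" "z \<in> V" "adapted_frame x V Y\<^sub>1 Y\<^sub>2 m\<^sub>1 m\<^sub>2"
      "\<kappa> = sp (normal_riemann x Y\<^sub>1 Y\<^sub>2 m\<^sub>2 z) (m\<^sub>1 z)" by blast
  show "\<kappa> = sp (normal_riemann x X\<^sub>1 X\<^sub>2 n\<^sub>2 z) (n\<^sub>1 z)"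
    using V(4) normal_riemann_frame(2)[OF W h iso E z V(1-3)] normal_riemann_frame(2)[OF W h iso E z U fr] by simp
qed

section \<open>The Weierstrass representation\<close>

text \<open>A vector of \<open>\<complex>\<^sup>4\<close> is encoded by a \<open>2 \<times> 2\<close> matrix whose determinant is the scalar square; null
  vectors are the matrices of rank one. The sign \<open>\<epsilon> = -1\<close> reflects the second and fourth coordinates.\<close>

definition mvec :: "real \<Rightarrow> complex \<Rightarrow> complex \<Rightarrow> complex \<Rightarrow> complex \<Rightarrow> complex^4" where
  "mvec \<epsilon> a b c d = vector [(a + d) / 2, of_real \<epsilon> * (\<i> * (a - d) / 2), (b + c) / 2, of_real \<epsilon> * (\<i> * (b - c) / 2)]"

definition cnjv :: "complex^4 \<Rightarrow> complex^4" where
  "cnjv v = (\<chi> k. cnj (v $ k))"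

lemma cnjv_mvec: "cnjv (mvec \<epsilon> a b c d) = mvec \<epsilon> (cnj d) (cnj c) (cnj b) (cnj a)"
  by (simp add: cnjv_def mvec_def vec_eq_iff forall_4) (simp add: algebra_simps diff_divide_distrib)

text \<open>The scalar product is the polarised determinant. In particular two matrices of rank one
  that share a column or a row factor are orthogonal, and this is how normal vectors are found
  below.\<close>

lemma sp_mvec:
  assumes "\<epsilon>\<^sup>2 = 1"
  shows "sp (mvec \<epsilon> a b c d) (mvec \<epsilon> a' b' c' d') = (a * d' + d * a' - b * c' - c * b') / 2"
proof -
  have e: "of_real \<epsilon> * of_real \<epsilon> = (1::complex)" using assms by (metis of_real_1 of_real_mult power2_eq_square)
  have r: "of_real \<epsilon> * (\<i> * u / 2) * (of_real \<epsilon> * (\<i> * v / 2)) = - (u * v) / 4" for u v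
    using e by (simp add: mult_ac)
  show ?thesis unfolding sp_def mvec_def vector_4 r by (simp add: field_simps)
qed

lemma has_field_derivative_mvec:
  assumes "(a has_field_derivative a') (at z)" "(b has_field_derivative b') (at z)"
    "(c has_field_derivative c') (at z)" "(d has_field_derivative d') (at z)"
  shows "((\<lambda>z. mvec \<epsilon> (a z) (b z) (c z) (d z) $ k) has_field_derivative mvec \<epsilon> a' b' c' d' $ k) (at z)"
proof -
  have "\<forall>k. ((\<lambda>z. mvec \<epsilon> (a z) (b z) (c z) (d z) $ k) has_field_derivative mvec \<epsilon> a' b' c' d' $ k) (at z)"
    unfolding forall_4 mvec_def vector_4
    by (intro conjI) (auto intro!: derivative_eq_intros assms)
  then show ?thesis ..
qed

lemma Ck_on_mvec:
  assumes U: "open U" and C: "Ck_on n a U" "Ck_on n b U" "Ck_on n c U" "Ck_on n d U"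
  shows "Ck_on n (\<lambda>z. mvec \<epsilon> (a z) (b z) (c z) (d z) $ j) U"
proof -
  have add: "Ck_on n (\<lambda>z. (f z + g z) / 2) U" and diff: "Ck_on n (\<lambda>z. of_real \<epsilon> * (\<i> * (f z - g z) / 2)) U"
    if "Ck_on n f U" "Ck_on n g U" for f g :: "complex \<Rightarrow> complex"
  proof -
    show "Ck_on n (\<lambda>z. (f z + g z) / 2) U"
      by (rule Ck_on_linear[OF bounded_linear_divide U Ck_on_add[OF U that]])
    show "Ck_on n (\<lambda>z. of_real \<epsilon> * (\<i> * (f z - g z) / 2)) U"
      by (rule Ck_on_mult[OF U Ck_on_const Ck_on_linear[OF bounded_linear_divide U Ck_on_mult[OF U Ck_on_const Ck_on_diff[OF U that]]]])
  qed
  have "\<forall>j. Ck_on n (\<lambda>z. mvec \<epsilon> (a z) (b z) (c z) (d z) $ j) U"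
    unfolding forall_4 mvec_def vector_4 by (intro conjI add diff C)
  then show ?thesis ..
qed

lemma sp_complex_pairs:
  "sp (cvec a - \<i> *s cvec b) (cvec c - \<i> *s cvec d) = of_real (sp a c - sp b d) - \<i> * of_real (sp b c + sp a d)"
  "sp (cvec a + \<i> *s cvec b) (cvec c - \<i> *s cvec d) = of_real (sp a c + sp b d) + \<i> * of_real (sp b c - sp a d)"
  "sp (cvec a - \<i> *s cvec b) (cvec c + \<i> *s cvec d) = of_real (sp a c + sp b d) + \<i> * of_real (sp a d - sp b c)"
  unfolding sp_simps sp_cvec by (simp_all add: algebra_simps)

lemma cnjv_pair: "cnjv (cvec a - \<i> *s cvec b) = cvec a + \<i> *s cvec b"
  by (simp add: cnjv_def cvec_def vec_eq_iff)

text \<open>Each block with rows (1, -i) and (1, i) has determinant 2i, whence the factor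
  -4.\<close>

lemma det_complex_pairs:
  fixes p q n m :: "real^4"
  shows "det (vector [cvec p - \<i> *s cvec q, cvec p + \<i> *s cvec q, cvec n - \<i> *s cvec m, cvec n + \<i> *s cvec m] :: complex^4^4)
    = - 4 * of_real (det (vector [p, q, n, m] :: real^4^4))"
proof -
  define S where "S = (vector [vector [1, - \<i>, 0, 0], vector [1, \<i>, 0, 0], vector [0, 0, 1, - \<i>], vector [0, 0, 1, \<i>]] :: complex^4^4)"
  have "(vector [cvec p - \<i> *s cvec q, cvec p + \<i> *s cvec q, cvec n - \<i> *s cvec m, cvec n + \<i> *s cvec m] :: complex^4^4)
     = S ** vector [cvec p, cvec q, cvec n, cvec m]"
    by (simp add: vec_eq_iff matrix_matrix_mult_def S_def sum_4 forall_4)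
  moreover have "det S = - 4" by (simp add: det_4 S_def)
  moreover have "det (vector [cvec p, cvec q, cvec n, cvec m] :: complex^4^4) = of_real (det (vector [p, q, n, m] :: real^4^4))"
    by (simp add: det_4 cvec_def)
  ultimately show ?thesis by (simp add: det_mul)
qed

lemma det_mvec:
  assumes "\<epsilon>\<^sup>2 = 1"
  shows "det (vector [mvec \<epsilon> a1 b1 c1 d1, mvec \<epsilon> a2 b2 c2 d2, mvec \<epsilon> a3 b3 c3 d3, mvec \<epsilon> a4 b4 c4 d4] :: complex^4^4)
    = - det (vector [vector [a1, b1, c1, d1], vector [a2, b2, c2, d2], vector [a3, b3, c3, d3], vector [a4, b4, c4, d4]] :: complex^4^4) / 4"
proof -
  let ?e = "of_real \<epsilon> * (\<i> / 2)"
  define T where "T = (vector [vector [1/2, ?e, 0, 0], vector [0, 0, 1/2, ?e], vector [0, 0, 1/2, - ?e], vector [1/2, - ?e, 0, 0]] :: complex^4^4)"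
  have e: "of_real \<epsilon> * of_real \<epsilon> = (1::complex)" using assms by (metis of_real_1 of_real_mult power2_eq_square)
  have "(vector [mvec \<epsilon> a1 b1 c1 d1, mvec \<epsilon> a2 b2 c2 d2, mvec \<epsilon> a3 b3 c3 d3, mvec \<epsilon> a4 b4 c4 d4] :: complex^4^4)
    = vector [vector [a1, b1, c1, d1], vector [a2, b2, c2, d2], vector [a3, b3, c3, d3], vector [a4, b4, c4, d4]] ** T"
    by (simp add: vec_eq_iff matrix_matrix_mult_def T_def sum_4 forall_4 mvec_def) (simp add: field_simps)
  moreover have "det T = - 1 / 4" using e by (simp add: det_4 T_def mult_ac)
  ultimately show ?thesis by (simp add: det_mul)
qed

text \<open>\<Phi> is c times the product of the column (g1, 1) and the row (g2, 1), where c is a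
  branch of 1/sqrt(g1' g2'). The chart \<epsilon> = -1 serves points at which the lower right entry
  of the matrix for \<epsilon> = 1 vanishes.\<close>

definition wrep ::
  "real \<Rightarrow> complex set \<Rightarrow> (complex \<Rightarrow> complex) \<Rightarrow> (complex \<Rightarrow> complex) \<Rightarrow> (complex \<Rightarrow> complex) \<Rightarrow> (complex \<Rightarrow> real^4) \<Rightarrow> bool"
  where
  "wrep \<epsilon> U g\<^sub>1 g\<^sub>2 c x \<longleftrightarrow> \<epsilon>\<^sup>2 = 1 \<and> open U \<and> g\<^sub>1 holomorphic_on U \<and> g\<^sub>2 holomorphic_on U \<and> c holomorphic_on U \<and>
     (\<forall>z\<in>U. x differentiable (at z) \<and> (c z)\<^sup>2 * (deriv g\<^sub>1 z * deriv g\<^sub>2 z) = 1 \<and>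
        ((cmod (g\<^sub>1 z))\<^sup>2 - 1) * ((cmod (g\<^sub>2 z))\<^sup>2 - 1) > 0 \<and>
        Phi x z = mvec \<epsilon> (c z * (g\<^sub>1 z * g\<^sub>2 z)) (c z * g\<^sub>1 z) (c z * g\<^sub>2 z) (c z))"

section \<open>Metric and curvatures of a represented surface\<close>

lemma wrep_Phi':
  assumes w: "wrep \<epsilon> U g\<^sub>1 g\<^sub>2 c x"
  shows "z \<in> U \<Longrightarrow> Phi' x z = mvec \<epsilon> (deriv c z * (g\<^sub>1 z * g\<^sub>2 z) + c z * (deriv g\<^sub>1 z * g\<^sub>2 z + g\<^sub>1 z * deriv g\<^sub>2 z))
    (deriv c z * g\<^sub>1 z + c z * deriv g\<^sub>1 z) (deriv c z * g\<^sub>2 z + c z * deriv g\<^sub>2 z) (deriv c z)"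
    (is "_ \<Longrightarrow> _ = mvec \<epsilon> ?a ?b ?c ?d")
    and "hol_phi U x"
proof -
  have U: "open U" "g\<^sub>1 holomorphic_on U" "g\<^sub>2 holomorphic_on U" "c holomorphic_on U"
    and P: "\<And>z. z \<in> U \<Longrightarrow> Phi x z = mvec \<epsilon> (c z * (g\<^sub>1 z * g\<^sub>2 z)) (c z * g\<^sub>1 z) (c z * g\<^sub>2 z) (c z)"
    using w by (auto simp: wrep_def)
  have D: "((\<lambda>z. Phi x z $ k) has_field_derivative
     mvec \<epsilon> (deriv c z * (g\<^sub>1 z * g\<^sub>2 z) + c z * (deriv g\<^sub>1 z * g\<^sub>2 z + g\<^sub>1 z * deriv g\<^sub>2 z))
    (deriv c z * g\<^sub>1 z + c z * deriv g\<^sub>1 z) (deriv c z * g\<^sub>2 z + c z * deriv g\<^sub>2 z) (deriv c z) $ k) (at z)" if z: "z \<in> U" for z k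
  proof -
    note d = holomorphic_derivI[OF U(2,1) z] holomorphic_derivI[OF U(3,1) z] holomorphic_derivI[OF U(4,1) z]
    have "((\<lambda>z. mvec \<epsilon> (c z * (g\<^sub>1 z * g\<^sub>2 z)) (c z * g\<^sub>1 z) (c z * g\<^sub>2 z) (c z) $ k) has_field_derivative
      mvec \<epsilon> (deriv c z * (g\<^sub>1 z * g\<^sub>2 z) + c z * (deriv g\<^sub>1 z * g\<^sub>2 z + g\<^sub>1 z * deriv g\<^sub>2 z))
      (deriv c z * g\<^sub>1 z + c z * deriv g\<^sub>1 z) (deriv c z * g\<^sub>2 z + c z * deriv g\<^sub>2 z) (deriv c z) $ k) (at z)"
      by (rule has_field_derivative_mvec) (auto intro!: derivative_eq_intros d simp: algebra_simps)
    then show ?thesis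
      by (rule has_field_derivative_transform_within_open[OF _ U(1) z]) (simp add: P)
  qed
  show "Phi' x z = mvec \<epsilon> ?a ?b ?c ?d" if "z \<in> U"
    using DERIV_imp_deriv[OF D[OF that]] by (simp add: Phi'_def vec_eq_iff)
  show "hol_phi U x"
    unfolding hol_phi_def holomorphic_on_open[OF U(1)] using D U(1) w by (auto simp: wrep_def)
qed

text \<open>\<Phi> is null as a matrix of rank one. In the determinant of \<Phi>' everything but
  -c^2 g1' g2' cancels. Finally x_u^2 is half of \<Phi> paired with its conjugate, whose matrix is
  again of rank one, so the pairing factors.\<close>

lemma wrep_facts:
  assumes w: "wrep \<epsilon> U g\<^sub>1 g\<^sub>2 c x" and z: "z \<in> U"
  shows "sp (Phi x z) (Phi x z) = 0" "sp (Phi' x z) (Phi' x z) = -1"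
    "sp (pd 1 x z) (pd 1 x z) = (cmod (c z))\<^sup>2 * (((cmod (g\<^sub>1 z))\<^sup>2 - 1) * ((cmod (g\<^sub>2 z))\<^sup>2 - 1)) / 4"
    "sp (pd 1 x z) (pd 1 x z) > 0"
proof -
  have e: "\<epsilon>\<^sup>2 = 1" and c: "(c z)\<^sup>2 * (deriv g\<^sub>1 z * deriv g\<^sub>2 z) = 1"
    and AB: "((cmod (g\<^sub>1 z))\<^sup>2 - 1) * ((cmod (g\<^sub>2 z))\<^sup>2 - 1) > 0"
    and P: "Phi x z = mvec \<epsilon> (c z * (g\<^sub>1 z * g\<^sub>2 z)) (c z * g\<^sub>1 z) (c z * g\<^sub>2 z) (c z)"
    using w z by (auto simp: wrep_def)
  show 0: "sp (Phi x z) (Phi x z) = 0" unfolding P sp_mvec[OF e] by simp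
  have "sp (Phi' x z) (Phi' x z) = - ((c z)\<^sup>2 * (deriv g\<^sub>1 z * deriv g\<^sub>2 z))"
    unfolding wrep_Phi'(1)[OF w z] sp_mvec[OF e] by (simp add: field_simps power2_eq_square)
  then show "sp (Phi' x z) (Phi' x z) = -1" using c by simp
  have iso: "sp (pd 2 x z) (pd 2 x z) = sp (pd 1 x z) (pd 1 x z)" using 0 unfolding sp_Phi by (simp add: complex_eq_iff)
  have "of_real (sp (pd 1 x z) (pd 1 x z) + sp (pd 2 x z) (pd 2 x z)) = sp (Phi x z) (cnjv (Phi x z))"
    unfolding Phi_def cnjv_pair sp_complex_pairs by (simp add: sp_commute)
  also have "\<dots> = of_real ((cmod (c z))\<^sup>2 * (((cmod (g\<^sub>1 z))\<^sup>2 - 1) * ((cmod (g\<^sub>2 z))\<^sup>2 - 1)) / 2)"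
    unfolding P cnjv_mvec sp_mvec[OF e] of_real_mult of_real_diff of_real_divide complex_norm_square
    by (simp add: field_simps)
  finally have "sp (pd 1 x z) (pd 1 x z) + sp (pd 1 x z) (pd 1 x z) = (cmod (c z))\<^sup>2 * (((cmod (g\<^sub>1 z))\<^sup>2 - 1) * ((cmod (g\<^sub>2 z))\<^sup>2 - 1)) / 2"
    unfolding iso of_real_eq_iff .
  then show E: "sp (pd 1 x z) (pd 1 x z) = (cmod (c z))\<^sup>2 * (((cmod (g\<^sub>1 z))\<^sup>2 - 1) * ((cmod (g\<^sub>2 z))\<^sup>2 - 1)) / 4"
    by linarith
  have "c z \<noteq> 0" using c by auto
  then show "sp (pd 1 x z) (pd 1 x z) > 0" unfolding E using AB by simp
qed

lemma wrep_isothermal: "wrep \<epsilon> U g\<^sub>1 g\<^sub>2 c x \<Longrightarrow> isothermal U x"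
  using wrep_facts(1) by (auto simp: isothermal_iff)

lemma wrep_MSurf: "wrep \<epsilon> U g\<^sub>1 g\<^sub>2 c x \<Longrightarrow> 0 \<in> U \<Longrightarrow> (U, x) \<in> MSurf"
  unfolding MSurf_iff nbhd0_def
  by (intro conjI ballI wrep_facts wrep_Phi'(2)) (assumption | simp add: wrep_def)+

lemma wrep_nonzero:
  assumes "wrep \<epsilon> U g\<^sub>1 g\<^sub>2 c x" "z \<in> U"
  shows "c z \<noteq> 0" "deriv g\<^sub>1 z \<noteq> 0" "deriv g\<^sub>2 z \<noteq> 0" "(cmod (g\<^sub>1 z))\<^sup>2 \<noteq> 1" "(cmod (g\<^sub>2 z))\<^sup>2 \<noteq> 1"
    "((cmod (g\<^sub>1 z))\<^sup>2 - 1) * ((cmod (g\<^sub>2 z))\<^sup>2 - 1) > 0"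
    "(cmod (c z))\<^sup>2 * cmod (deriv g\<^sub>1 z * deriv g\<^sub>2 z) = 1"
proof -
  have c: "(c z)\<^sup>2 * (deriv g\<^sub>1 z * deriv g\<^sub>2 z) = 1"
    and AB: "((cmod (g\<^sub>1 z))\<^sup>2 - 1) * ((cmod (g\<^sub>2 z))\<^sup>2 - 1) > 0" using assms by (auto simp: wrep_def)
  show "c z \<noteq> 0" "deriv g\<^sub>1 z \<noteq> 0" "deriv g\<^sub>2 z \<noteq> 0" using c by auto
  show "((cmod (g\<^sub>1 z))\<^sup>2 - 1) * ((cmod (g\<^sub>2 z))\<^sup>2 - 1) > 0" by (fact AB)
  then show "(cmod (g\<^sub>1 z))\<^sup>2 \<noteq> 1" "(cmod (g\<^sub>2 z))\<^sup>2 \<noteq> 1" by auto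
  show "(cmod (c z))\<^sup>2 * cmod (deriv g\<^sub>1 z * deriv g\<^sub>2 z) = 1"
    using arg_cong[OF c, of cmod] by (simp add: norm_mult norm_power)
qed

text \<open>The conformal factor is 1/(4ab) with the densities a and b. So L = -ln a - ln b - ln 4,
  and the two Liouville equations give the Laplacian -4(a^2 + b^2) of L.\<close>

lemma wrep_gauss:
  assumes w: "wrep \<epsilon> U g\<^sub>1 g\<^sub>2 c x" and z: "z \<in> U"
  shows "gauss_curvature (induced_metric x) z = K_of g\<^sub>1 g\<^sub>2 z"
proof -
  have U: "open U" "g\<^sub>1 holomorphic_on U" "g\<^sub>2 holomorphic_on U" using w by (auto simp: wrep_def)
  note n = wrep_nonzero[OF w]
  let ?a = "hdens g\<^sub>1" and ?b = "hdens g\<^sub>2"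
  have pos: "?a u > 0" "?b u > 0" if "u \<in> U" for u using hdens_pos n[OF that] by auto
  have E: "sp (pd 1 x u) (pd 1 x u) = 1 / (4 * (?a u * ?b u))" if u: "u \<in> U" for u
  proof -
    have "?a u * ?b u = cmod (deriv g\<^sub>1 u * deriv g\<^sub>2 u) / (((cmod (g\<^sub>1 u))\<^sup>2 - 1) * ((cmod (g\<^sub>2 u))\<^sup>2 - 1))"
      using n(6)[OF u] by (simp add: hdens_def norm_mult abs_mult[symmetric])
    moreover have "(cmod (c u))\<^sup>2 = 1 / cmod (deriv g\<^sub>1 u * deriv g\<^sub>2 u)"
      using n(2,3,7)[OF u] by (simp add: field_simps)
    ultimately show ?thesis unfolding wrep_facts(3)[OF w u] by simp
  qed
  define L where "L = (\<lambda>u. (-1) * ln (?a u) + (-1) * ln (?b u) + - ln 4)"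
  have eL: "exp (L u) = 1 / (4 * (?a u * ?b u))" if u: "u \<in> U" for u
  proof -
    have Lu: "L u = - (ln (?a u) + ln (?b u) + ln 4)" by (simp add: L_def)
    show ?thesis unfolding Lu exp_minus exp_add using pos[OF u] by (simp add: field_simps)
  qed
  have C: "Ck_on 2 (\<lambda>u. ln (?a u)) U" "Ck_on 2 (\<lambda>u. ln (?b u)) U"
    by (rule Ck_on_ln[OF U(1) Ck_on_hdens]; use U n pos in blast)+
  have CL: "Ck_on 2 L U" unfolding L_def by (intro Ck_on_add Ck_on_mult Ck_on_const C U(1))
  have g: "induced_metric x u = mat (exp (L u))" if u: "u \<in> U" for u
    unfolding induced_metric_isothermal[OF wrep_isothermal[OF w] u] E[OF u] eL[OF u] ..
  have lap: "laplacian L z = - (4 * (?a z)\<^sup>2) - 4 * (?b z)\<^sup>2"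
    using laplacian_combination[OF U(1) C z, of "-1" "-1" "- ln 4"]
      laplacian_ln_hdens[OF U(1,2) n(2) n(4) z] laplacian_ln_hdens[OF U(1,3) n(3) n(5) z] by (simp add: L_def)
  have G: "gauss_curvature (induced_metric x) z = - laplacian L z / (2 * exp (L z))"
    by (rule gauss_curvature_isothermal[OF U(1) g CL z])
  show ?thesis
    unfolding G lap eL[OF z] curvatures_hdens(1)[of g\<^sub>1 z g\<^sub>2, OF n(6)[OF z]]
    by (simp add: algebra_simps)
qed

text \<open>The matrix \<nu> is k times the product of the column (g1, 1) and the row (1, cnj g2).
  It shares the column with \<Phi> and the row with the conjugate of \<Phi>, hence it is normal. It
  is null, and k is chosen so that its real part and its negative imaginary part have square
  -1.\<close>

lemma wrep_frame:
  assumes w: "wrep \<epsilon> U g\<^sub>1 g\<^sub>2 c x"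
    and k_def: "k = (\<lambda>z. 2 * (((cmod (g\<^sub>1 z))\<^sup>2 - 1) * ((cmod (g\<^sub>2 z))\<^sup>2 - 1)) powr (- (1/2)))"
    and t_def: "t = (\<lambda>z. (sp (pd 1 x z) (pd 1 x z)) powr (- (1/2)))"
    and \<nu>_def: "\<nu> = (\<lambda>z. mvec \<epsilon> (of_real (k z) * g\<^sub>1 z) (of_real (k z) * (g\<^sub>1 z * cnj (g\<^sub>2 z))) (of_real (k z)) (of_real (k z) * cnj (g\<^sub>2 z)))"
    and n\<^sub>1_def: "n\<^sub>1 = (\<lambda>z. (\<chi> j. Re (\<nu> z $ j)))" and n\<^sub>2_def: "n\<^sub>2 = (\<lambda>z. (\<chi> j. - Im (\<nu> z $ j)))"
  shows "adapted_frame x U (\<lambda>z. of_real (t z)) (\<lambda>z. \<i> * of_real (t z)) n\<^sub>1 n\<^sub>2"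
    and "z \<in> U \<Longrightarrow> (k z)\<^sup>2 * (((cmod (g\<^sub>1 z))\<^sup>2 - 1) * ((cmod (g\<^sub>2 z))\<^sup>2 - 1)) = 4"
    and "z \<in> U \<Longrightarrow> (t z)\<^sup>2 * sp (pd 1 x z) (pd 1 x z) = 1"
    and "\<nu> z = cvec (n\<^sub>1 z) - \<i> *s cvec (n\<^sub>2 z)"
proof -
  have U: "open U" "g\<^sub>1 holomorphic_on U" "g\<^sub>2 holomorphic_on U" and e: "\<epsilon>\<^sup>2 = 1"
    and P: "\<And>z. z \<in> U \<Longrightarrow> Phi x z = mvec \<epsilon> (c z * (g\<^sub>1 z * g\<^sub>2 z)) (c z * g\<^sub>1 z) (c z * g\<^sub>2 z) (c z)"
    and dx: "\<And>z. z \<in> U \<Longrightarrow> x differentiable (at z)"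
    using w by (auto simp: wrep_def)
  note nz = wrep_nonzero[OF w] and hp = wrep_Phi'(2)[OF w] and iso = wrep_isothermal[OF w]
  have half: "(y powr (- (1/2)))\<^sup>2 * y = 1" if "y > 0" for y :: real
  proof -
    have "(y powr (- (1/2)))\<^sup>2 = y powr (- 1)" using that by (simp add: power2_eq_square flip: powr_add)
    then show ?thesis using that by (simp add: powr_minus)
  qed
  show k2: "(k z)\<^sup>2 * (((cmod (g\<^sub>1 z))\<^sup>2 - 1) * ((cmod (g\<^sub>2 z))\<^sup>2 - 1)) = 4" if "z \<in> U" for z
    using half[OF nz(6)[OF that]] unfolding k_def power_mult_distrib by simp
  show t2: "(t z)\<^sup>2 * sp (pd 1 x z) (pd 1 x z) = 1" if "z \<in> U" for z
    unfolding t_def by (rule half[OF wrep_facts(4)[OF w that]])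
  show \<nu>: "\<nu> z = cvec (n\<^sub>1 z) - \<i> *s cvec (n\<^sub>2 z)" for z
    by (simp add: n\<^sub>1_def n\<^sub>2_def cvec_def vec_eq_iff complex_eq_iff)
  have Ckk: "Ck_on l k U" for l
    unfolding k_def
    by (intro Ck_on_mult Ck_on_const Ck_on_powr U(1) Ck_on_diff Ck_on_cmod_square U) (rule nz(6))
  have Ckt: "Ck_on l t U" for l
    unfolding t_def
    by (rule Ck_on_powr[OF U(1) Ck_on_bilinear[OF bounded_bilinear_sp U(1) hol_phi_Ck_pd[OF hp] hol_phi_Ck_pd[OF hp]]])
       (rule wrep_facts(4)[OF w])
  note Ck = Ckk Ckt
  have Ck': "Ck_on l (\<lambda>z. complex_of_real (k z)) U" "Ck_on l (\<lambda>z. complex_of_real (t z)) U" for l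
    by (rule Ck_on_linear[OF bounded_linear_of_real U(1) Ck(1)], rule Ck_on_linear[OF bounded_linear_of_real U(1) Ck(2)])
  have "Ck_on l (\<lambda>z. \<nu> z $ j) U" for l j
  proof -
    have g: "Ck_on l g\<^sub>1 U" "Ck_on l (\<lambda>z. cnj (g\<^sub>2 z)) U"
      by (rule Ck_on_holomorphic[OF U(1,2)], rule Ck_on_linear[OF bounded_linear_cnj U(1) Ck_on_holomorphic[OF U(1,3)]])
    show ?thesis
      unfolding \<nu>_def
      by (rule Ck_on_mvec[OF U(1) Ck_on_mult[OF U(1) Ck'(1) g(1)] Ck_on_mult[OF U(1) Ck'(1) Ck_on_mult[OF U(1) g]]
            Ck'(1) Ck_on_mult[OF U(1) Ck'(1) g(2)]])
  qed
  note C\<nu> = this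
  have "Ck_on l n\<^sub>1 U" "Ck_on l n\<^sub>2 U" for l
  proof -
    show "Ck_on l n\<^sub>1 U"
      by (rule Ck_on_vec[OF U(1)]) (simp add: n\<^sub>1_def Ck_on_linear[OF bounded_linear_Re U(1) C\<nu>])
    show "Ck_on l n\<^sub>2 U"
      by (rule Ck_on_vec[OF U(1)]) (simp add: n\<^sub>2_def Ck_on_minus[OF U(1) Ck_on_linear[OF bounded_linear_Im U(1) C\<nu>]])
  qed
  then have sm: "smooth_on n\<^sub>1 U" "smooth_on n\<^sub>2 U" "smooth_on (\<lambda>z. complex_of_real (t z)) U" "smooth_on (\<lambda>z. \<i> * complex_of_real (t z)) U"
    using Ck'(2) Ck_on_mult[OF U(1) Ck_on_const Ck'(2)] by (auto simp: smooth_on_def)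
  have fr: "sp (n\<^sub>1 z) (n\<^sub>1 z) = -1" "sp (n\<^sub>2 z) (n\<^sub>2 z) = -1" "sp (n\<^sub>1 z) (n\<^sub>2 z) = 0"
    "sp (n\<^sub>1 z) (pd i x z) = 0" "sp (n\<^sub>2 z) (pd i x z) = 0"
    "det (vector [pd 1 x z, pd 2 x z, n\<^sub>1 z, n\<^sub>2 z] :: real^4^4) > 0" if z: "z \<in> U" for z i
  proof -
    let ?k = "complex_of_real (k z)"
    have "sp (\<nu> z) (\<nu> z) = 0" unfolding \<nu>_def sp_mvec[OF e] by (simp add: algebra_simps)
    then have 1: "sp (n\<^sub>1 z) (n\<^sub>1 z) = sp (n\<^sub>2 z) (n\<^sub>2 z)" "sp (n\<^sub>1 z) (n\<^sub>2 z) = 0"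
      unfolding \<nu> sp_complex_pairs by (simp_all add: complex_eq_iff sp_commute[of "n\<^sub>2 z" "n\<^sub>1 z"])
    have "of_real (sp (n\<^sub>1 z) (n\<^sub>1 z) + sp (n\<^sub>2 z) (n\<^sub>2 z)) = sp (\<nu> z) (cnjv (\<nu> z))"
      unfolding \<nu> cnjv_pair sp_complex_pairs by (simp add: sp_commute)
    also have "\<dots> = - of_real ((k z)\<^sup>2 * (((cmod (g\<^sub>1 z))\<^sup>2 - 1) * ((cmod (g\<^sub>2 z))\<^sup>2 - 1))) / 2"
      unfolding \<nu>_def cnjv_mvec sp_mvec[OF e] of_real_mult of_real_diff complex_norm_square
      by (simp add: field_simps power2_eq_square)
    finally have "complex_of_real (sp (n\<^sub>1 z) (n\<^sub>1 z) + sp (n\<^sub>2 z) (n\<^sub>2 z)) = of_real (- 2)" unfolding k2[OF z] by simp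
    then have "sp (n\<^sub>1 z) (n\<^sub>1 z) + sp (n\<^sub>2 z) (n\<^sub>2 z) = - 2" unfolding of_real_eq_iff .
    with 1 show "sp (n\<^sub>1 z) (n\<^sub>1 z) = -1" "sp (n\<^sub>2 z) (n\<^sub>2 z) = -1" "sp (n\<^sub>1 z) (n\<^sub>2 z) = 0" by auto
    have "sp (\<nu> z) (Phi x z) = 0" "sp (cnjv (\<nu> z)) (Phi x z) = 0"
      unfolding \<nu>_def P[OF z] cnjv_mvec sp_mvec[OF e] by (simp_all add: algebra_simps)
    then have "sp (n\<^sub>1 z) (pd 1 x z) = 0 \<and> sp (n\<^sub>2 z) (pd 1 x z) = 0 \<and> sp (n\<^sub>1 z) (pd 2 x z) = 0 \<and> sp (n\<^sub>2 z) (pd 2 x z) = 0"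
      unfolding \<nu> Phi_def cnjv_pair sp_complex_pairs by (simp add: complex_eq_iff)
    then show "sp (n\<^sub>1 z) (pd i x z) = 0" "sp (n\<^sub>2 z) (pd i x z) = 0" using exhaust_2[of i] by auto
    \<comment> \<open>Orientation: the determinant of \<Phi>, \<nu> and their conjugates is
      evaluated in matrix coordinates. It is negative, and so is the factor -4.\<close>
    have "- 4 * of_real (det (vector [pd 1 x z, pd 2 x z, n\<^sub>1 z, n\<^sub>2 z] :: real^4^4)) =
      det (vector [Phi x z, cnjv (Phi x z), \<nu> z, cnjv (\<nu> z)] :: complex^4^4)"
      unfolding \<nu> Phi_def cnjv_pair det_complex_pairs ..
    also have "\<dots> = - of_real ((cmod (c z))\<^sup>2 * (k z)\<^sup>2 * (((cmod (g\<^sub>1 z))\<^sup>2 - 1) * ((cmod (g\<^sub>2 z))\<^sup>2 - 1))\<^sup>2) / 4"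
      unfolding \<nu>_def P[OF z] cnjv_mvec det_mvec[OF e] of_real_mult of_real_diff of_real_power[of "_ * _"] complex_norm_square
      by (simp add: det_4 power2_eq_square) algebra
    finally have "of_real (- 4 * det (vector [pd 1 x z, pd 2 x z, n\<^sub>1 z, n\<^sub>2 z] :: real^4^4)) =
       complex_of_real (- ((cmod (c z))\<^sup>2 * (k z)\<^sup>2 * (((cmod (g\<^sub>1 z))\<^sup>2 - 1) * ((cmod (g\<^sub>2 z))\<^sup>2 - 1))\<^sup>2) / 4)" by simp
    then have d: "- 4 * det (vector [pd 1 x z, pd 2 x z, n\<^sub>1 z, n\<^sub>2 z] :: real^4^4) =
       - ((cmod (c z))\<^sup>2 * (k z)\<^sup>2 * (((cmod (g\<^sub>1 z))\<^sup>2 - 1) * ((cmod (g\<^sub>2 z))\<^sup>2 - 1))\<^sup>2) / 4" unfolding of_real_eq_iff .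
    have "(k z)\<^sup>2 > 0" using k2[OF z] by auto
    then have "(cmod (c z))\<^sup>2 * (k z)\<^sup>2 * (((cmod (g\<^sub>1 z))\<^sup>2 - 1) * ((cmod (g\<^sub>2 z))\<^sup>2 - 1))\<^sup>2 > 0"
      using nz(1)[OF z] zero_less_power[OF nz(6)[OF z], of 2] by (intro mult_pos_pos) simp_all
    with d show "det (vector [pd 1 x z, pd 2 x z, n\<^sub>1 z, n\<^sub>2 z] :: real^4^4) > 0" by linarith
  qed
  show "adapted_frame x U (\<lambda>z. of_real (t z)) (\<lambda>z. \<i> * of_real (t z)) n\<^sub>1 n\<^sub>2"
    unfolding adapted_frame_def Let_def
  proof (intro conjI ballI allI sm)
    fix z i assume z: "z \<in> U"
    have T: "dir_deriv (\<lambda>z. of_real (t z)) x z = t z *\<^sub>R pd 1 x z" "dir_deriv (\<lambda>z. \<i> * of_real (t z)) x z = t z *\<^sub>R pd 2 x z"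
      unfolding dir_deriv_def frechet_derivative_pd[OF dx[OF z]] by simp_all
    have pq: "sp (pd 2 x z) (pd 2 x z) = sp (pd 1 x z) (pd 1 x z)" "sp (pd 1 x z) (pd 2 x z) = 0"
      using iso z by (auto simp: isothermal_def)
    show "sp (dir_deriv (\<lambda>z. of_real (t z)) x z) (dir_deriv (\<lambda>z. of_real (t z)) x z) = 1"
      "sp (dir_deriv (\<lambda>z. \<i> * of_real (t z)) x z) (dir_deriv (\<lambda>z. \<i> * of_real (t z)) x z) = 1"
      "sp (dir_deriv (\<lambda>z. of_real (t z)) x z) (dir_deriv (\<lambda>z. \<i> * of_real (t z)) x z) = 0"
      unfolding T sp_scaleR pq using t2[OF z] by (simp_all add: power2_eq_square mult_ac)
    show "sp (n\<^sub>1 z) (n\<^sub>1 z) = -1" "sp (n\<^sub>2 z) (n\<^sub>2 z) = -1" "sp (n\<^sub>1 z) (n\<^sub>2 z) = 0"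
      "sp (n\<^sub>1 z) (pd i x z) = 0" "sp (n\<^sub>2 z) (pd i x z) = 0" using fr[OF z] by auto
    have "det (vector [t z *\<^sub>R pd 1 x z, t z *\<^sub>R pd 2 x z, n\<^sub>1 z, n\<^sub>2 z] :: real^4^4) =
      (t z)\<^sup>2 * det (vector [pd 1 x z, pd 2 x z, n\<^sub>1 z, n\<^sub>2 z] :: real^4^4)"
      by (simp add: det_4 power2_eq_square) algebra
    moreover have "(t z)\<^sup>2 > 0" using t2[OF z] by auto
    ultimately show "det (vector [dir_deriv (\<lambda>z. of_real (t z)) x z, dir_deriv (\<lambda>z. \<i> * of_real (t z)) x z, n\<^sub>1 z, n\<^sub>2 z] :: real^4^4) > 0"
      unfolding T using fr(6)[OF z] by simp
  qed
qed

text \<open>\<nu> shares the column factor with \<Phi>, so its product with \<Phi>' sees only g1'.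
  The conjugate of \<nu> shares the row factor and sees only g2'. The determinant of second
  fundamental forms is a quarter of the difference of the two squared moduli.\<close>

lemma wrep_normal_curvature:
  assumes w: "wrep \<epsilon> U g\<^sub>1 g\<^sub>2 c x" and z: "z \<in> U"
  shows "normal_curvature x z = kappa_of g\<^sub>1 g\<^sub>2 z"
    and "normal_curvature x z = 2 / (sp (pd 1 x z) (pd 1 x z)) ^ 3 *
      det (vector [pd 1 x z, pd 2 x z, pd 1 (pd 1 x) z, pd 2 (pd 1 x) z] :: real^4^4)"
proof -
  have U: "open U" and e: "\<epsilon>\<^sup>2 = 1" using w by (auto simp: wrep_def)
  note nz = wrep_nonzero[OF w z] and hp = wrep_Phi'(2)[OF w] and iso = wrep_isothermal[OF w]
  let ?A = "(cmod (g\<^sub>1 z))\<^sup>2 - 1" and ?B = "(cmod (g\<^sub>2 z))\<^sup>2 - 1" and ?e = "sp (pd 1 x z) (pd 1 x z)"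
  define k where "k = (\<lambda>z. 2 * (((cmod (g\<^sub>1 z))\<^sup>2 - 1) * ((cmod (g\<^sub>2 z))\<^sup>2 - 1)) powr (- (1/2)))"
  define t where "t = (\<lambda>z. (sp (pd 1 x z) (pd 1 x z)) powr (- (1/2)))"
  define \<nu> where "\<nu> = (\<lambda>z. mvec \<epsilon> (of_real (k z) * g\<^sub>1 z) (of_real (k z) * (g\<^sub>1 z * cnj (g\<^sub>2 z))) (of_real (k z)) (of_real (k z) * cnj (g\<^sub>2 z)))"
  define n\<^sub>1 where "n\<^sub>1 = (\<lambda>z. (\<chi> j. Re (\<nu> z $ j)))"
  define n\<^sub>2 where "n\<^sub>2 = (\<lambda>z. (\<chi> j. - Im (\<nu> z $ j)))"
  note F = wrep_frame[OF w k_def t_def \<nu>_def n\<^sub>1_def n\<^sub>2_def]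
  note k2 = F(2)[OF z] and t2 = F(3)[OF z]
  have E: "sp (pd 1 x u) (pd 1 x u) > 0" if "u \<in> U" for u by (rule wrep_facts(4)[OF w that])
  note nc = normal_curvature_frame[OF U hp iso E z U z F(1)]
    and nr = normal_riemann_frame[OF U hp iso E z U z F(1)]
  show "normal_curvature x z = 2 / ?e ^ 3 * det (vector [pd 1 x z, pd 2 x z, pd 1 (pd 1 x) z, pd 2 (pd 1 x) z] :: real^4^4)"
    using nc nr(2) by simp
  let ?P = "pd 1 (pd 1 x) z" and ?Q = "pd 2 (pd 1 x) z"
  let ?d = "sp ?P (n\<^sub>1 z) * sp ?Q (n\<^sub>2 z) - sp ?P (n\<^sub>2 z) * sp ?Q (n\<^sub>1 z)"
  have v: "normal_curvature x z = 2 * (t z)\<^sup>2 / ?e * ?d"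
    using nc nr(1) by (simp add: power2_eq_square)
  have u1: "sp (\<nu> z) (Phi' x z) = of_real (k z) * c z * deriv g\<^sub>1 z * of_real ?B / 2"
    and u2: "sp (cnjv (\<nu> z)) (Phi' x z) = of_real (k z) * c z * deriv g\<^sub>2 z * of_real ?A / 2"
    unfolding \<nu>_def wrep_Phi'(1)[OF w z] cnjv_mvec sp_mvec[OF e] of_real_diff complex_norm_square
    by (simp_all add: field_simps)
  have "(cmod (sp (cnjv (\<nu> z)) (Phi' x z)))\<^sup>2 - (cmod (sp (\<nu> z) (Phi' x z)))\<^sup>2 = 4 * ?d"
    unfolding F(4) cnjv_pair hol_phi_second_vec(3)[OF hp z] sp_complex_pairs cmod_power2
    by (simp add: sp_commute[of _ "n\<^sub>1 z"] sp_commute[of _ "n\<^sub>2 z"] power2_eq_square algebra_simps)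
  then have d: "4 * ?d = (k z)\<^sup>2 * (cmod (c z))\<^sup>2 * ((cmod (deriv g\<^sub>2 z))\<^sup>2 * ?A\<^sup>2 - (cmod (deriv g\<^sub>1 z))\<^sup>2 * ?B\<^sup>2) / 4"
    unfolding u1 u2 norm_mult norm_divide norm_of_real by (simp add: power_mult_distrib power_divide algebra_simps)
  define N where "N = cmod (deriv g\<^sub>1 z * deriv g\<^sub>2 z)"
  define M where "M = ?A * ?B"
  have NM: "N > 0" "M > 0" using nz by (auto simp: N_def M_def)
  have c2: "(cmod (c z))\<^sup>2 = 1 / N" using nz(7) NM by (simp add: N_def field_simps)
  have e': "?e = M / (4 * N)" unfolding wrep_facts(3)[OF w z] c2 M_def by simp
  have k': "(k z)\<^sup>2 = 4 / M" using k2 NM by (simp add: M_def field_simps)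
  have t': "(t z)\<^sup>2 = 4 * N / M" using t2 NM unfolding e' by (simp add: field_simps)
  have "normal_curvature x z = 8 * N / M ^ 3 * ((cmod (deriv g\<^sub>2 z))\<^sup>2 * ?A\<^sup>2 - (cmod (deriv g\<^sub>1 z))\<^sup>2 * ?B\<^sup>2)"
  proof -
    have d': "?d = (4 / M) * (1 / N) * ((cmod (deriv g\<^sub>2 z))\<^sup>2 * ?A\<^sup>2 - (cmod (deriv g\<^sub>1 z))\<^sup>2 * ?B\<^sup>2) / 16"
      using d unfolding k' c2 by simp
    have r: "2 * (4 * n / m) / (m / (4 * n)) * ((4 / m) * (1 / n) * y / 16) = 8 * n / m ^ 3 * y"
      if "n > 0" "m > 0" for n m y :: real
      using that by (simp add: power3_eq_cube field_simps)
    show ?thesis unfolding v t' e' d' by (rule r[OF NM])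
  qed
  also have "\<dots> = - 8 * N / M * ((cmod (deriv g\<^sub>1 z))\<^sup>2 / ?A\<^sup>2 - (cmod (deriv g\<^sub>2 z))\<^sup>2 / ?B\<^sup>2)"
  proof -
    have r: "8 * n / (a * b) ^ 3 * (y * a\<^sup>2 - x * b\<^sup>2) = - 8 * n / (a * b) * (x / a\<^sup>2 - y / b\<^sup>2)"
      if "a \<noteq> 0" "b \<noteq> 0" for n a b x y :: real
      using that by (simp add: field_simps power2_eq_square power3_eq_cube)
    show ?thesis unfolding M_def by (rule r) (use nz in auto)
  qed
  finally show "normal_curvature x z = kappa_of g\<^sub>1 g\<^sub>2 z" unfolding kappa_of_def N_def M_def .
qed

lemma MSurf_local_representation:
  assumes M: "(D, x) \<in> MSurf" and z0: "z\<^sub>0 \<in> D"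
  obtains \<epsilon> U g\<^sub>1 g\<^sub>2 c where "z\<^sub>0 \<in> U" "U \<subseteq> D" "\<epsilon> = 1 \<or> \<epsilon> = -1" "wrep \<epsilon> U g\<^sub>1 g\<^sub>2 c x"
proof -
  have D: "open D" and h: "hol_phi D x"
    and F: "\<And>z. z \<in> D \<Longrightarrow> sp (Phi x z) (Phi x z) = 0" "\<And>z. z \<in> D \<Longrightarrow> sp (pd 1 x z) (pd 1 x z) > 0"
      "\<And>z. z \<in> D \<Longrightarrow> sp (Phi' x z) (Phi' x z) = -1"
    using M unfolding MSurf_iff nbhd0_def by auto
  have hol: "(\<lambda>z. Phi x z $ k) holomorphic_on D" and dx: "z \<in> D \<Longrightarrow> x differentiable (at z)" for k z
    using h by (auto simp: hol_phi_def)
  \<comment> \<open>If the entry vanished for both signs, the first two components of x_u would be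
    zero and x_u^2 could not be positive.\<close>
  obtain \<epsilon> :: real where \<epsilon>: "\<epsilon> = 1 \<or> \<epsilon> = -1" and nz: "Phi x z\<^sub>0 $ 1 + \<i> * of_real \<epsilon> * Phi x z\<^sub>0 $ 2 \<noteq> 0"
  proof (cases "Phi x z\<^sub>0 $ 1 + \<i> * Phi x z\<^sub>0 $ 2 = 0 \<and> Phi x z\<^sub>0 $ 1 - \<i> * Phi x z\<^sub>0 $ 2 = 0")
    case True
    then have "2 * Phi x z\<^sub>0 $ 1 = 0" "2 * (\<i> * Phi x z\<^sub>0 $ 2) = 0" by algebra+
    then have "pd 1 x z\<^sub>0 $ 1 = 0" "pd 1 x z\<^sub>0 $ 2 = 0" by (simp_all add: pd_Phi)
    then have "sp (pd 1 x z\<^sub>0) (pd 1 x z\<^sub>0) \<le> 0" by (simp add: sp_def)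
    then show ?thesis using F(2)[OF z0] by simp
  next
    case False
    then show ?thesis using that[of 1] that[of "-1"] by auto
  qed
  have e2: "\<epsilon>\<^sup>2 = 1" and ee: "complex_of_real \<epsilon> * of_real \<epsilon> = 1" using \<epsilon> by auto
  define c where "c = (\<lambda>z. Phi x z $ 1 + \<i> * of_real \<epsilon> * Phi x z $ 2)"
  have hc: "c holomorphic_on D" unfolding c_def by (intro holomorphic_intros hol)
  define U where "U = {z \<in> D. c z \<noteq> 0}"
  have U: "open U" "z\<^sub>0 \<in> U" "U \<subseteq> D"
  proof -
    have "U = D \<inter> c -` (- {0})" by (auto simp: U_def)
    then show "open U"
      using continuous_open_preimage[OF holomorphic_on_imp_continuous_on[OF hc] D open_Compl[OF closed_singleton[of 0]]] by simp
    show "z\<^sub>0 \<in> U" "U \<subseteq> D" using z0 nz by (auto simp: U_def c_def)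
  qed
  define g\<^sub>1 where "g\<^sub>1 = (\<lambda>z. (Phi x z $ 3 - \<i> * of_real \<epsilon> * Phi x z $ 4) / c z)"
  define g\<^sub>2 where "g\<^sub>2 = (\<lambda>z. (Phi x z $ 3 + \<i> * of_real \<epsilon> * Phi x z $ 4) / c z)"
  have holU: "(\<lambda>z. Phi x z $ k) holomorphic_on U" "c holomorphic_on U" for k
    using hol hc holomorphic_on_subset U(3) by blast+
  have hg: "g\<^sub>1 holomorphic_on U" "g\<^sub>2 holomorphic_on U"
    unfolding g\<^sub>1_def g\<^sub>2_def by (intro holomorphic_intros holU; simp add: U_def)+
  have P: "Phi x z = mvec \<epsilon> (c z * (g\<^sub>1 z * g\<^sub>2 z)) (c z * g\<^sub>1 z) (c z * g\<^sub>2 z) (c z)" if z: "z \<in> U" for z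
  proof -
    let ?f = "Phi x z"
    have cz: "c z \<noteq> 0" and zD: "z \<in> D" using z by (auto simp: U_def)
    have g: "c z * g\<^sub>1 z = ?f $ 3 - \<i> * of_real \<epsilon> * ?f $ 4" "c z * g\<^sub>2 z = ?f $ 3 + \<i> * of_real \<epsilon> * ?f $ 4"
      using cz by (simp_all add: g\<^sub>1_def g\<^sub>2_def)
    have n: "?f $ 1 * ?f $ 1 + ?f $ 2 * ?f $ 2 = ?f $ 3 * ?f $ 3 + ?f $ 4 * ?f $ 4"
      using F(1)[OF zD] by (simp add: sp_def algebra_simps)
    have i2: "(\<i> * of_real \<epsilon>) * (\<i> * of_real \<epsilon>) = -1" using ee by (simp add: mult_ac)
    \<comment> \<open>The null condition is the vanishing of the determinant, which yields the upper
      left entry.\<close>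
    have "c z * (c z * (g\<^sub>1 z * g\<^sub>2 z)) = (c z * g\<^sub>1 z) * (c z * g\<^sub>2 z)" by simp
    also have "\<dots> = c z * (?f $ 1 - \<i> * of_real \<epsilon> * ?f $ 2)"
      unfolding g using n i2 unfolding c_def by algebra
    finally have a: "c z * (g\<^sub>1 z * g\<^sub>2 z) = ?f $ 1 - \<i> * of_real \<epsilon> * ?f $ 2" using cz by simp
    have s: "of_real \<epsilon> * (\<i> * ((u - \<i> * of_real \<epsilon> * v) - (u + \<i> * of_real \<epsilon> * v)) / 2) = v" for u v
    proof -
      have "of_real \<epsilon> * (\<i> * ((u - \<i> * of_real \<epsilon> * v) - (u + \<i> * of_real \<epsilon> * v)) / 2) = (of_real \<epsilon> * of_real \<epsilon>) * v"
        by (simp add: algebra_simps)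
      then show ?thesis using ee by simp
    qed
    have "mvec \<epsilon> (?f $ 1 - \<i> * of_real \<epsilon> * ?f $ 2) (?f $ 3 - \<i> * of_real \<epsilon> * ?f $ 4)
        (?f $ 3 + \<i> * of_real \<epsilon> * ?f $ 4) (?f $ 1 + \<i> * of_real \<epsilon> * ?f $ 2) = ?f"
      unfolding mvec_def vec_eq_iff forall_4 vector_4 s by simp
    moreover have "c z = ?f $ 1 + \<i> * of_real \<epsilon> * ?f $ 2" by (simp add: c_def)
    ultimately show ?thesis unfolding a g by simp
  qed
  have "wrep \<epsilon> U g\<^sub>1 g\<^sub>2 c x"
    unfolding wrep_def
  proof (intro conjI ballI e2 U(1) hg holU(2))
    fix z assume z: "z \<in> U"
    then have zD: "z \<in> D" and cz: "c z \<noteq> 0" by (auto simp: U_def)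
    show "x differentiable (at z)" by (rule dx[OF zD])
    show "Phi x z = mvec \<epsilon> (c z * (g\<^sub>1 z * g\<^sub>2 z)) (c z * g\<^sub>1 z) (c z * g\<^sub>2 z) (c z)" by (rule P[OF z])
    note d = holomorphic_derivI[OF hg(1) U(1) z] holomorphic_derivI[OF hg(2) U(1) z] holomorphic_derivI[OF holU(2) U(1) z]
    have D1: "((\<lambda>z. Phi x z $ k) has_field_derivative
       mvec \<epsilon> (deriv c z * (g\<^sub>1 z * g\<^sub>2 z) + c z * (deriv g\<^sub>1 z * g\<^sub>2 z + g\<^sub>1 z * deriv g\<^sub>2 z))
       (deriv c z * g\<^sub>1 z + c z * deriv g\<^sub>1 z) (deriv c z * g\<^sub>2 z + c z * deriv g\<^sub>2 z) (deriv c z) $ k) (at z)" for k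
    proof -
      have "((\<lambda>z. mvec \<epsilon> (c z * (g\<^sub>1 z * g\<^sub>2 z)) (c z * g\<^sub>1 z) (c z * g\<^sub>2 z) (c z) $ k) has_field_derivative
       mvec \<epsilon> (deriv c z * (g\<^sub>1 z * g\<^sub>2 z) + c z * (deriv g\<^sub>1 z * g\<^sub>2 z + g\<^sub>1 z * deriv g\<^sub>2 z))
       (deriv c z * g\<^sub>1 z + c z * deriv g\<^sub>1 z) (deriv c z * g\<^sub>2 z + c z * deriv g\<^sub>2 z) (deriv c z) $ k) (at z)"
        by (rule has_field_derivative_mvec) (auto intro!: derivative_eq_intros d simp: algebra_simps)
      then show ?thesis
        by (rule has_field_derivative_transform_within_open[OF _ U(1) z]) (simp add: P)
    qed
    have P': "Phi' x z = mvec \<epsilon> (deriv c z * (g\<^sub>1 z * g\<^sub>2 z) + c z * (deriv g\<^sub>1 z * g\<^sub>2 z + g\<^sub>1 z * deriv g\<^sub>2 z))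
       (deriv c z * g\<^sub>1 z + c z * deriv g\<^sub>1 z) (deriv c z * g\<^sub>2 z + c z * deriv g\<^sub>2 z) (deriv c z)"
      using DERIV_imp_deriv[OF D1] by (simp add: Phi'_def vec_eq_iff)
    have "sp (Phi' x z) (Phi' x z) = - ((c z)\<^sup>2 * (deriv g\<^sub>1 z * deriv g\<^sub>2 z))"
      unfolding P' sp_mvec[OF e2] by (simp add: field_simps power2_eq_square)
    then show "(c z)\<^sup>2 * (deriv g\<^sub>1 z * deriv g\<^sub>2 z) = 1" using F(3)[OF zD] by simp
    have iso: "sp (pd 2 x z) (pd 2 x z) = sp (pd 1 x z) (pd 1 x z)" using F(1)[OF zD] unfolding sp_Phi by (simp add: complex_eq_iff)
    \<comment> \<open>The formula for the metric is read backwards: x_u^2 > 0 becomes the sign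
      condition on g1 and g2.\<close>
    have "of_real (sp (pd 1 x z) (pd 1 x z) + sp (pd 2 x z) (pd 2 x z)) = sp (Phi x z) (cnjv (Phi x z))"
      unfolding Phi_def cnjv_pair sp_complex_pairs by (simp add: sp_commute)
    also have "\<dots> = of_real ((cmod (c z))\<^sup>2 * (((cmod (g\<^sub>1 z))\<^sup>2 - 1) * ((cmod (g\<^sub>2 z))\<^sup>2 - 1)) / 2)"
      unfolding P[OF z] cnjv_mvec sp_mvec[OF e2] of_real_mult of_real_diff of_real_divide complex_norm_square
      by (simp add: field_simps)
    finally have "(cmod (c z))\<^sup>2 * (((cmod (g\<^sub>1 z))\<^sup>2 - 1) * ((cmod (g\<^sub>2 z))\<^sup>2 - 1)) / 2 > 0"
      unfolding iso of_real_eq_iff using F(2)[OF zD] by linarith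
    then have "(cmod (c z))\<^sup>2 * (((cmod (g\<^sub>1 z))\<^sup>2 - 1) * ((cmod (g\<^sub>2 z))\<^sup>2 - 1)) > 0" by linarith
    then show "((cmod (g\<^sub>1 z))\<^sup>2 - 1) * ((cmod (g\<^sub>2 z))\<^sup>2 - 1) > 0"
      by (rule zero_less_mult_pos) (use cz in simp)
  qed
  with U \<epsilon> show ?thesis using that by blast
qed

text \<open>Regularity and the natural equations are local, so every point of D is treated with a
  representation of its own.\<close>

lemma curvature_SNE:
  assumes M: "(D, x) \<in> MSurf"
  shows "(D, gauss_curvature (induced_metric x), normal_curvature x) \<in> SNE"
proof -
  let ?K = "gauss_curvature (induced_metric x)" and ?k = "normal_curvature x"
  have loc: "\<exists>U. open U \<and> z \<in> U \<and> Ck_on 2 ?K U \<and> Ck_on 2 ?k U \<and> natural_equations ?K ?k z" if zD: "z \<in> D" for z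
  proof -
    obtain \<epsilon> U g\<^sub>1 g\<^sub>2 c where U: "z \<in> U" and w: "wrep \<epsilon> U g\<^sub>1 g\<^sub>2 c x"
      by (rule MSurf_local_representation[OF M zD])
    have o: "open U" "g\<^sub>1 holomorphic_on U" "g\<^sub>2 holomorphic_on U" using w by (auto simp: wrep_def)
    have d: "deriv g\<^sub>1 u * deriv g\<^sub>2 u \<noteq> 0" if "u \<in> U" for u using wrep_nonzero(2,3)[OF w that] by simp
    note n = formula_natural[OF o d wrep_nonzero(6)[OF w] wrep_gauss[OF w] wrep_normal_curvature(1)[OF w]]
    have "Ck_on 2 ?K U" "Ck_on 2 ?k U" "natural_equations ?K ?k z" using n U by auto
    then show ?thesis using o(1) U by blast
  qed
  have "Ck_on 2 ?K D" "Ck_on 2 ?k D" by (rule Ck_on_local; use loc in blast)+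
  moreover have "natural_equations ?K ?k z" if "z \<in> D" for z using loc[OF that] by blast
  moreover have "nbhd0 D" using M by (simp add: MSurf_iff)
  ultimately show ?thesis by (simp add: SNE_def)
qed

section \<open>The action of \<open>SO(2,2)\<close>\<close>

lemma pd_affine:
  fixes x :: "complex \<Rightarrow> real^4" and A :: "real^4^4"
  assumes "open U" "\<And>w. w \<in> U \<Longrightarrow> y w = A *v x w + b" "z \<in> U" "x differentiable (at z)"
  shows "pd i y z = A *v pd i x z"
proof -
  have "pd i y z = pd i (\<lambda>w. A *v x w + b) z" by (rule pd_cong_open[OF assms(1,3,2)])
  also have "\<dots> = A *v pd i x z"
    using pd_add[OF differentiable_linear[OF matrix_vector_mul_bounded_linear[of A] assms(4)] differentiable_const[of b]]
      pd_linear[OF matrix_vector_mul_bounded_linear[of A] assms(4)] by simp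
  finally show ?thesis .
qed

lemma det_rows_mult:
  fixes A :: "real^4^4"
  shows "det (vector [A *v a, A *v b, A *v c, A *v d] :: real^4^4) = det A * det (vector [a, b, c, d] :: real^4^4)"
proof -
  have "(vector [A *v a, A *v b, A *v c, A *v d] :: real^4^4) = vector [a, b, c, d] ** transpose A"
    by (simp add: vec_eq_iff matrix_matrix_mult_def matrix_vector_mult_def transpose_def sum_4 forall_4 mult.commute)
  then show ?thesis by (simp add: det_mul det_transpose)
qed

lemma MSurf_D:
  assumes "(D, x) \<in> MSurf"
  shows "open D" "0 \<in> D" "hol_phi D x" "isothermal D x" "z \<in> D \<Longrightarrow> sp (pd 1 x z) (pd 1 x z) > 0"
    "z \<in> D \<Longrightarrow> x differentiable (at z)" "z \<in> D \<Longrightarrow> pd i x differentiable (at z)"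
  using assms hol_phi_pd_differentiable unfolding MSurf_iff isothermal_iff nbhd0_def hol_phi_def by auto

text \<open>The metric is unchanged, and in the frame-free formula for the normal curvature the
  determinant is multiplied by det A = 1; an isometry of determinant -1 would reverse its
  sign.\<close>

lemma curvature_invariant:
  assumes M: "(D, x) \<in> MSurf" "(E, y) \<in> MSurf" and U: "open U" "U \<subseteq> D \<inter> E"
    and A: "A \<in> SO22" and eq: "\<And>w. w \<in> U \<Longrightarrow> y w = A *v x w + b" and z: "z \<in> U"
  shows "gauss_curvature (induced_metric y) z = gauss_curvature (induced_metric x) z"
    "normal_curvature y z = normal_curvature x z"
proof -
  have sp: "sp (A *v v) (A *v w) = sp v w" and dA: "det A = 1" for v w using A by (auto simp: SO22_def)
  note x = MSurf_D[OF M(1)] and y = MSurf_D[OF M(2)]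
  have UD: "w \<in> D" "w \<in> E" if "w \<in> U" for w using U that by auto
  have p: "pd i y w = A *v pd i x w" if "w \<in> U" for i w
    by (rule pd_affine[OF U(1) eq that x(6)[OF UD(1)[OF that]]])
  have pp: "pd i (pd j y) z = A *v pd i (pd j x) z" for i j
    by (rule pd_affine[where b = 0, OF U(1) _ z x(7)[OF UD(1)[OF z]]]) (simp add: p)
  have e: "sp (pd 1 y w) (pd 1 y w) = sp (pd 1 x w) (pd 1 x w)" if "w \<in> U" for w
    unfolding p[OF that] sp ..
  define L where "L = (\<lambda>w. ln (sp (pd 1 x w) (pd 1 x w)))"
  have CL: "Ck_on 2 L U"
    unfolding L_def
    by (rule Ck_on_ln[OF U(1)], rule Ck_on_bilinear[OF bounded_bilinear_sp U(1)])
       (use Ck_on_subset[OF hol_phi_Ck_pd[OF x(3)]] U(2) x(5) in auto)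
  have gx: "induced_metric x w = mat (exp (L w))" and gy: "induced_metric y w = mat (exp (L w))" if w: "w \<in> U" for w
    using induced_metric_isothermal[OF x(4) UD(1)[OF w]] induced_metric_isothermal[OF y(4) UD(2)[OF w]] e[OF w] x(5)[OF UD(1)[OF w]]
    by (simp_all add: L_def)
  show "gauss_curvature (induced_metric y) z = gauss_curvature (induced_metric x) z"
    using gauss_curvature_isothermal[OF U(1) gx CL z] gauss_curvature_isothermal[OF U(1) gy CL z] by simp
  have nc: "normal_curvature v z = 2 / (sp (pd 1 v z) (pd 1 v z)) ^ 3 *
      det (vector [pd 1 v z, pd 2 v z, pd 1 (pd 1 v) z, pd 2 (pd 1 v) z] :: real^4^4)"
    if "(F, v) \<in> MSurf" "z \<in> F" for F v
    by (rule MSurf_local_representation[OF that]) (rule wrep_normal_curvature(2))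
  show "normal_curvature y z = normal_curvature x z"
    unfolding nc[OF M(1) UD(1)[OF z]] nc[OF M(2) UD(2)[OF z]] e[OF z] p[OF z] pp det_rows_mult dA by (simp add: sp)
qed

lemma SO22_invertible:
  assumes "A \<in> SO22"
  obtains B where "B \<in> SO22" "A ** B = mat 1" "B ** A = mat 1"
proof -
  have sp: "sp (A *v v) (A *v w) = sp v w" and dA: "det A = 1" for v w using assms by (auto simp: SO22_def)
  obtain B where B: "A ** B = mat 1" "B ** A = mat 1"
    using dA invertible_det_nz[of A] unfolding invertible_def by auto
  have "sp (B *v v) (B *v w) = sp v w" for v w
    using sp[of "B *v v" "B *v w"] by (simp add: matrix_vector_mul_assoc B)
  moreover have "det B = 1" using arg_cong[OF B(1), of det] dA by (simp add: det_mul)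
  ultimately have "B \<in> SO22" by (simp add: SO22_def)
  then show ?thesis using that B by blast
qed

lemma SO22_mult: "A \<in> SO22 \<Longrightarrow> B \<in> SO22 \<Longrightarrow> A ** B \<in> SO22"
  by (simp add: SO22_def det_mul matrix_vector_mul_assoc[symmetric])

lemma MSurf_equivI:
  assumes "(D, x) \<in> MSurf" "(E, y) \<in> MSurf" "nbhd0 U" "U \<subseteq> D \<inter> E" "A \<in> SO22" "\<And>z. z \<in> U \<Longrightarrow> y z = A *v x z + b"
  shows "((D, x), (E, y)) \<in> MSurf_equiv"
  unfolding MSurf_equiv_def mem_Collect_eq prod.case
  by (intro conjI exI[of _ U] exI[of _ A] exI[of _ b] ballI) (use assms in auto)

lemma MSurf_equivE:
  assumes "((D, x), (E, y)) \<in> MSurf_equiv"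
  obtains U A b where "(D, x) \<in> MSurf" "(E, y) \<in> MSurf" "nbhd0 U" "U \<subseteq> D \<inter> E" "A \<in> SO22" "\<And>z. z \<in> U \<Longrightarrow> y z = A *v x z + b"
  using assms unfolding MSurf_equiv_def mem_Collect_eq prod.case by blast

lemma equiv_MSurf: "equiv MSurf MSurf_equiv"
proof (rule equivI)
  show "MSurf_equiv \<subseteq> MSurf \<times> MSurf" by (auto simp: MSurf_equiv_def)
  show "refl_on MSurf MSurf_equiv"
    unfolding refl_on_def
  proof clarify
    fix D x assume M: "(D, x) \<in> MSurf"
    have "mat 1 \<in> SO22" by (simp add: SO22_def)
    then show "((D, x), (D, x)) \<in> MSurf_equiv"
      using M by (intro MSurf_equivI[where U = D and A = "mat 1" and b = 0]) (auto simp: MSurf_iff)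
  qed
  show "sym MSurf_equiv"
  proof (rule symI, clarify)
    fix D x E y assume "((D, x), (E, y)) \<in> MSurf_equiv"
    then obtain U A b where *: "(D, x) \<in> MSurf" "(E, y) \<in> MSurf" "nbhd0 U" "U \<subseteq> D \<inter> E" "A \<in> SO22"
      "\<And>z. z \<in> U \<Longrightarrow> y z = A *v x z + b" by (rule MSurf_equivE) blast
    obtain B where B: "B \<in> SO22" "B ** A = mat 1" using SO22_invertible[OF *(5)] by blast
    show "((E, y), (D, x)) \<in> MSurf_equiv"
    proof (rule MSurf_equivI[where U = U and A = B and b = "- (B *v b)"])
      fix z assume "z \<in> U"
      then show "x z = B *v y z + - (B *v b)"
        using *(6) B(2) by (simp add: matrix_vector_right_distrib matrix_vector_mul_assoc)
    qed (use * B in auto)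
  qed
  show "trans MSurf_equiv"
  proof (rule transI, clarify)
    fix D x E y F w assume 1: "((D, x), (E, y)) \<in> MSurf_equiv" and 2: "((E, y), (F, w)) \<in> MSurf_equiv"
    obtain U A b where U: "(D, x) \<in> MSurf" "nbhd0 U" "U \<subseteq> D \<inter> E" "A \<in> SO22" "\<And>z. z \<in> U \<Longrightarrow> y z = A *v x z + b"
      using 1 by (rule MSurf_equivE) blast
    obtain V B c where V: "(F, w) \<in> MSurf" "nbhd0 V" "V \<subseteq> E \<inter> F" "B \<in> SO22" "\<And>z. z \<in> V \<Longrightarrow> w z = B *v y z + c"
      using 2 by (rule MSurf_equivE) blast
    show "((D, x), (F, w)) \<in> MSurf_equiv"
      by (rule MSurf_equivI[OF U(1) V(1) nbhd0_inter[OF U(2) V(2)] _ SO22_mult[OF V(4) U(4)], of "B *v b + c"])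
         (use U V in \<open>auto simp: matrix_vector_right_distrib matrix_vector_mul_assoc\<close>)
  qed
qed

lemma curvature_compat:
  assumes "((D, x), (E, y)) \<in> MSurf_equiv"
  shows "((D, gauss_curvature (induced_metric x), normal_curvature x),
          (E, gauss_curvature (induced_metric y), normal_curvature y)) \<in> SNE_equiv"
proof -
  obtain U A b where M: "(D, x) \<in> MSurf" "(E, y) \<in> MSurf" and U: "nbhd0 U" "U \<subseteq> D \<inter> E" and A: "A \<in> SO22"
    and eq: "\<And>z. z \<in> U \<Longrightarrow> y z = A *v x z + b" by (rule MSurf_equivE[OF assms]) blast
  have o: "open U" using U by (simp add: nbhd0_def)
  show ?thesis
    by (rule SNE_equivI[OF curvature_SNE[OF M(1)] curvature_SNE[OF M(2)] U])
       (use curvature_invariant[OF M o U(2) A eq] in blast)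
qed

text \<open>The two commuting actions \<open>M \<mapsto> V M\<close> and \<open>M \<mapsto> M V\<^sup>T\<close> of the matrix \<open>V\<close> with rows \<open>(a, cnj b)\<close>
  and \<open>(b, cnj a)\<close>, in the coordinates of \<^const>\<open>mvec\<close>.\<close>

definition Lmat :: "complex \<Rightarrow> complex \<Rightarrow> real^4^4" where
  "Lmat a b = vector [vector [Re a, Im a, Re b, Im b], vector [- Im a, Re a, Im b, - Re b],
     vector [Re b, Im b, Re a, Im a], vector [Im b, - Re b, - Im a, Re a]]"

definition Rmat :: "complex \<Rightarrow> complex \<Rightarrow> real^4^4" where
  "Rmat a b = vector [vector [Re a, Im a, Re b, - Im b], vector [- Im a, Re a, Im b, Re b],
     vector [Re b, Im b, Re a, - Im a], vector [- Im b, Re b, Im a, Re a]]"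

definition cmul :: "real^4^4 \<Rightarrow> complex^4 \<Rightarrow> complex^4" where
  "cmul A v = (\<chi> k. \<Sum>j\<in>UNIV. of_real (A $ k $ j) * v $ j)"

lemma cmul_Lmat:
  "cmul (Lmat a b) (mvec 1 p q u v) = mvec 1 (a * p + cnj b * u) (a * q + cnj b * v) (b * p + cnj a * u) (b * q + cnj a * v)"
  by (simp add: cmul_def Lmat_def mvec_def vec_eq_iff forall_4 sum_4 complex_eq_iff) (simp add: field_simps)

lemma cmul_Rmat:
  "cmul (Rmat a b) (mvec 1 p q u v) = mvec 1 (a * p + cnj b * q) (b * p + cnj a * q) (a * u + cnj b * v) (b * u + cnj a * v)"
  by (simp add: cmul_def Rmat_def mvec_def vec_eq_iff forall_4 sum_4 complex_eq_iff) (simp add: field_simps)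

lemma cmul_mult: "cmul (A ** B) v = cmul A (cmul B v)"
  by (simp add: cmul_def vec_eq_iff matrix_matrix_mult_def sum_4 forall_4 algebra_simps)

lemma sp_LRmat:
  "sp (Lmat a b *v v) (Lmat a b *v w) = ((cmod a)\<^sup>2 - (cmod b)\<^sup>2) * sp v w"
  "sp (Rmat a b *v v) (Rmat a b *v w) = ((cmod a)\<^sup>2 - (cmod b)\<^sup>2) * sp v w"
  unfolding cmod_power2
  by (simp_all add: sp_def Lmat_def Rmat_def matrix_vector_mult_def sum_4 power2_eq_square algebra_simps)

lemma det_LRmat:
  "det (Lmat a b) = ((cmod a)\<^sup>2 - (cmod b)\<^sup>2)\<^sup>2" "det (Rmat a b) = ((cmod a)\<^sup>2 - (cmod b)\<^sup>2)\<^sup>2"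
  unfolding cmod_power2 by (simp_all add: det_4 Lmat_def Rmat_def power2_eq_square algebra_simps)

text \<open>Each factor multiplies the scalar product by its own determinant t. Only because the two
  values coincide is the product an isometry; with opposite signs it would be an
  anti-isometry.\<close>

lemma LRmat_SO22:
  assumes "(cmod a)\<^sup>2 - (cmod b)\<^sup>2 = t" "(cmod a')\<^sup>2 - (cmod b')\<^sup>2 = t" "t\<^sup>2 = 1"
  shows "Lmat a b ** Rmat a' b' \<in> SO22"
  using assms
  by (simp add: SO22_def matrix_vector_mul_assoc[symmetric] sp_LRmat det_mul det_LRmat mult.assoc[symmetric] power2_eq_square[symmetric])

section \<open>The Weierstrass correspondence on equivalence classes\<close>

lemma pd_cmul:
  assumes "Phi y z = cmul A (Phi x z)"
  shows "pd i y z = A *v pd i x z"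
proof -
  have "pd 1 y z = A *v pd 1 x z" "pd 2 y z = A *v pd 2 x z"
    by (simp_all add: vec_eq_iff pd_Phi assms cmul_def matrix_vector_mult_def sum_negf)
  then show ?thesis using exhaust_2[of i] by auto
qed

text \<open>\<Phi> carries both partial derivatives, so y - A x has zero derivative on the convex
  disc.\<close>

lemma affine_of_Phi:
  assumes "\<And>z. z \<in> ball c r \<Longrightarrow> x differentiable (at z)" "\<And>z. z \<in> ball c r \<Longrightarrow> y differentiable (at z)"
    "\<And>z. z \<in> ball c r \<Longrightarrow> Phi y z = cmul A (Phi x z)"
  obtains b where "\<And>z. z \<in> ball c r \<Longrightarrow> y z = A *v x z + b"
proof -
  have "((\<lambda>w. y w - A *v x w) has_derivative (\<lambda>h. 0)) (at z within ball c r)" if z: "z \<in> ball c r" for z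
  proof -
    note A = bounded_linear.has_derivative[OF matrix_vector_mul_bounded_linear[of A] has_derivative_pd[OF assms(1)[OF z]]]
    have "((\<lambda>w. y w - A *v x w) has_derivative (\<lambda>h. 0)) (at z)"
      by (rule has_derivative_eq_rhs[OF has_derivative_diff[OF has_derivative_pd[OF assms(2)[OF z]] A]])
         (simp add: pd_cmul[OF assms(3)[OF z]] matrix_vector_right_distrib matrix_vector_mult_scaleR)
    then show ?thesis by (rule has_derivative_at_withinI)
  qed
  from has_derivative_zero_constant[OF convex_ball this]
  obtain b where "\<And>z. z \<in> ball c r \<Longrightarrow> y z - A *v x z = b" by auto
  then have "y z = A *v x z + b" if "z \<in> ball c r" for z using that by (simp add: algebra_simps)
  then show ?thesis using that by blast
qed

text \<open>The branch s of the square root is exchanged for c = 1/s, in which the representation is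
  linear.\<close>

lemma weierstrass_corr_iff:
  assumes H: "(D, g\<^sub>1, g\<^sub>2) \<in> HH"
  shows "((D, g\<^sub>1, g\<^sub>2), (E, x)) \<in> weierstrass_corr \<longleftrightarrow> nbhd0 E \<and> E \<subseteq> D \<and> (\<exists>c. wrep 1 E g\<^sub>1 g\<^sub>2 c x)"
proof
  have v: "vector [1/2 * ((p * q + 1) / s), \<i>/2 * ((p * q - 1) / s), 1/2 * ((p + q) / s), \<i>/2 * ((p - q) / s)]
      = mvec 1 (1 / s * (p * q)) (1 / s * p) (1 / s * q) (1 / s)" if "s \<noteq> 0" for p q s
    using that by (simp add: mvec_def vec_eq_iff forall_4 field_simps)
  note g = HH_D[OF H]
  {
    assume "((D, g\<^sub>1, g\<^sub>2), (E, x)) \<in> weierstrass_corr"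
    then obtain s where E: "nbhd0 E" "E \<subseteq> D" and dx: "\<And>z. z \<in> E \<Longrightarrow> x differentiable (at z)"
      and s: "s holomorphic_on E" "\<And>z. z \<in> E \<Longrightarrow> (s z)\<^sup>2 = deriv g\<^sub>1 z * deriv g\<^sub>2 z"
      and P: "\<And>z. z \<in> E \<Longrightarrow> Phi x z = vector [1/2 * ((g\<^sub>1 z * g\<^sub>2 z + 1) / s z), \<i>/2 * ((g\<^sub>1 z * g\<^sub>2 z - 1) / s z),
           1/2 * ((g\<^sub>1 z + g\<^sub>2 z) / s z), \<i>/2 * ((g\<^sub>1 z - g\<^sub>2 z) / s z)]"
      unfolding weierstrass_corr_def by auto
    have nz: "deriv g\<^sub>1 z * deriv g\<^sub>2 z \<noteq> 0" if "z \<in> E" for z using g(5,6) E(2) that by auto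
    have s0: "s z \<noteq> 0" if "z \<in> E" for z using nz[OF that] s(2)[OF that] by auto
    have "wrep 1 E g\<^sub>1 g\<^sub>2 (\<lambda>z. 1 / s z) x"
      unfolding wrep_def
    proof (intro conjI ballI)
      show "open E" using E by (simp add: nbhd0_def)
      show "g\<^sub>1 holomorphic_on E" "g\<^sub>2 holomorphic_on E" using g(3,4) E(2) holomorphic_on_subset by blast+
      show "(\<lambda>z. 1 / s z) holomorphic_on E" using s(1) s0 by (auto intro!: holomorphic_intros)
      fix z assume z: "z \<in> E"
      show "x differentiable (at z)" by (rule dx[OF z])
      show "(1 / s z)\<^sup>2 * (deriv g\<^sub>1 z * deriv g\<^sub>2 z) = 1" using s0[OF z] s(2)[OF z, symmetric] by (simp add: power_divide)
      show "((cmod (g\<^sub>1 z))\<^sup>2 - 1) * ((cmod (g\<^sub>2 z))\<^sup>2 - 1) > 0" using g(7) z E(2) by blast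
      show "Phi x z = mvec 1 (1 / s z * (g\<^sub>1 z * g\<^sub>2 z)) (1 / s z * g\<^sub>1 z) (1 / s z * g\<^sub>2 z) (1 / s z)"
        unfolding P[OF z] by (rule v[OF s0[OF z]])
    qed simp
    then show "nbhd0 E \<and> E \<subseteq> D \<and> (\<exists>c. wrep 1 E g\<^sub>1 g\<^sub>2 c x)" using E by blast
  }
  assume "nbhd0 E \<and> E \<subseteq> D \<and> (\<exists>c. wrep 1 E g\<^sub>1 g\<^sub>2 c x)"
  then obtain c where E: "nbhd0 E" "E \<subseteq> D" and w: "wrep 1 E g\<^sub>1 g\<^sub>2 c x" by blast
  have c0: "c z \<noteq> 0" if "z \<in> E" for z by (rule wrep_nonzero(1)[OF w that])
  have "(\<lambda>z. 1 / c z) holomorphic_on E" using w c0 by (auto simp: wrep_def intro!: holomorphic_intros)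
  moreover have "(1 / c z)\<^sup>2 = deriv g\<^sub>1 z * deriv g\<^sub>2 z" if "z \<in> E" for z
  proof -
    have "(c z)\<^sup>2 * (deriv g\<^sub>1 z * deriv g\<^sub>2 z) = 1" using w that by (simp add: wrep_def)
    then show ?thesis using c0[OF that] by (simp add: field_simps)
  qed
  moreover have "Phi x z = vector [1/2 * ((g\<^sub>1 z * g\<^sub>2 z + 1) / (1 / c z)), \<i>/2 * ((g\<^sub>1 z * g\<^sub>2 z - 1) / (1 / c z)),
           1/2 * ((g\<^sub>1 z + g\<^sub>2 z) / (1 / c z)), \<i>/2 * ((g\<^sub>1 z - g\<^sub>2 z) / (1 / c z))]" if "z \<in> E" for z
  proof -
    have "Phi x z = mvec 1 (c z * (g\<^sub>1 z * g\<^sub>2 z)) (c z * g\<^sub>1 z) (c z * g\<^sub>2 z) (c z)" using w that by (simp add: wrep_def)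
    also have "\<dots> = mvec 1 (1 / (1 / c z) * (g\<^sub>1 z * g\<^sub>2 z)) (1 / (1 / c z) * g\<^sub>1 z) (1 / (1 / c z) * g\<^sub>2 z) (1 / (1 / c z))" by simp
    finally show ?thesis using v[of "1 / c z" "g\<^sub>1 z" "g\<^sub>2 z"] c0[OF that] by simp
  qed
  moreover have "\<forall>z\<in>E. x differentiable (at z)" using w by (simp add: wrep_def)
  ultimately show "((D, g\<^sub>1, g\<^sub>2), (E, x)) \<in> weierstrass_corr"
    unfolding weierstrass_corr_def mem_Collect_eq prod.case using E
    by (intro conjI exI[of _ "\<lambda>z. 1 / c z"] ballI) auto
qed

lemma wrep_HH: "wrep \<epsilon> U g\<^sub>1 g\<^sub>2 c x \<Longrightarrow> 0 \<in> U \<Longrightarrow> (U, g\<^sub>1, g\<^sub>2) \<in> HH"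
  using wrep_nonzero by (auto simp: HH_def nbhd0_def wrep_def)

lemma weierstrass_total:
  assumes H: "(D, g\<^sub>1, g\<^sub>2) \<in> HH"
  obtains E x where "((D, g\<^sub>1, g\<^sub>2), (E, x)) \<in> weierstrass_corr"
proof -
  note g = HH_D[OF H]
  obtain r where r: "r > 0" "ball 0 r \<subseteq> D" using g(1,2) open_contains_ball by blast
  let ?B = "ball (0::complex) r"
  have hg: "g\<^sub>1 holomorphic_on ?B" "g\<^sub>2 holomorphic_on ?B" using g(3,4) r(2) holomorphic_on_subset by blast+
  have hp: "(\<lambda>z. deriv g\<^sub>1 z * deriv g\<^sub>2 z) holomorphic_on ?B" using hg by (intro holomorphic_intros) auto
  have nz: "deriv g\<^sub>1 z * deriv g\<^sub>2 z \<noteq> 0" if "z \<in> ?B" for z using g(5,6) r(2) that by auto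
  obtain s where s: "s holomorphic_on ?B" "\<And>z. z \<in> ?B \<Longrightarrow> deriv g\<^sub>1 z * deriv g\<^sub>2 z = (s z)\<^sup>2"
    using contractible_imp_holomorphic_sqrt[OF hp convex_imp_contractible[OF convex_ball] nz] by blast
  have s0: "s z \<noteq> 0" if "z \<in> ?B" for z using nz[OF that] s(2)[OF that] by auto
  define c where "c = (\<lambda>z. 1 / s z)"
  have hc: "c holomorphic_on ?B" unfolding c_def using s(1) s0 by (auto intro!: holomorphic_intros)
  define \<phi> where "\<phi> = (\<lambda>z. mvec 1 (c z * (g\<^sub>1 z * g\<^sub>2 z)) (c z * g\<^sub>1 z) (c z * g\<^sub>2 z) (c z))"
  have h\<phi>: "(\<lambda>z. \<phi> z $ k) holomorphic_on ?B" for k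
  proof -
    have "\<forall>k. (\<lambda>z. \<phi> z $ k) holomorphic_on ?B"
      unfolding forall_4 \<phi>_def mvec_def vector_4 by (intro conjI holomorphic_intros hc hg) simp_all
    then show ?thesis ..
  qed
  have "\<exists>F. \<forall>z\<in>?B. (F has_field_derivative \<phi> z $ k) (at z)" for k
  proof -
    obtain f where "\<And>z. z \<in> ?B \<Longrightarrow> (f has_field_derivative \<phi> z $ k) (at z within ?B)"
      using holomorphic_convex_primitive'[OF convex_ball open_ball h\<phi>[of k]] by blast
    then show ?thesis by (intro exI[of _ f]) (simp add: at_within_open[OF _ open_ball])
  qed
  then have "\<forall>k. \<exists>F. \<forall>z\<in>?B. (F has_field_derivative \<phi> z $ k) (at z)" by blast
  from choice[OF this] obtain F where F: "\<And>k z. z \<in> ?B \<Longrightarrow> (F k has_field_derivative \<phi> z $ k) (at z)" by blast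
  have hF: "F k holomorphic_on ?B" for k using F by (metis holomorphic_on_open open_ball)
  \<comment> \<open>The real part of a primitive of \<phi> has Re \<phi> and -Im \<phi> as its u-
    and v-derivatives.\<close>
  define x where "x = (\<lambda>z. (\<chi> k. Re (F k z)) :: real^4)"
  have "Ck_on (Suc 0) x ?B"
    by (rule Ck_on_vec[OF open_ball]) (simp only: x_def vec_lambda_beta, rule Ck_on_linear[OF bounded_linear_Re open_ball Ck_on_holomorphic[OF open_ball hF]])
  then have dx: "x differentiable (at z)" if "z \<in> ?B" for z using that by simp
  have pdx: "pd i x z $ k = Re (\<phi> z $ k * coord_dir i)" if z: "z \<in> ?B" for i z k
  proof -
    have "pd i x z $ k = pd i (\<lambda>w. Re (F k w)) z" using pd_nth[OF dx[OF z]] by (simp add: x_def)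
    also have "\<dots> = Re (deriv (F k) z * coord_dir i)"
      using pd_linear[OF bounded_linear_Re pd_holomorphic(1)[OF hF open_ball z]] pd_holomorphic(2)[OF hF open_ball z] by simp
    finally show ?thesis using DERIV_imp_deriv[OF F[OF z]] by simp
  qed
  have P: "Phi x z = \<phi> z" if "z \<in> ?B" for z
    by (simp add: vec_eq_iff Phi_nth pdx[OF that] complex_eq_iff)
  have "wrep 1 ?B g\<^sub>1 g\<^sub>2 c x"
    unfolding wrep_def
  proof (intro conjI ballI open_ball hg hc)
    fix z assume z: "z \<in> ?B"
    show "x differentiable (at z)" by (rule dx[OF z])
    show "(c z)\<^sup>2 * (deriv g\<^sub>1 z * deriv g\<^sub>2 z) = 1" using s0[OF z] s(2)[OF z] by (simp add: c_def power_divide)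
    show "((cmod (g\<^sub>1 z))\<^sup>2 - 1) * ((cmod (g\<^sub>2 z))\<^sup>2 - 1) > 0" using g(7) z r(2) by blast
    show "Phi x z = mvec 1 (c z * (g\<^sub>1 z * g\<^sub>2 z)) (c z * g\<^sub>1 z) (c z * g\<^sub>2 z) (c z)" using P[OF z] by (simp add: \<phi>_def)
  qed simp
  moreover have "nbhd0 ?B" using r by (simp add: nbhd0_def)
  ultimately have "((D, g\<^sub>1, g\<^sub>2), (?B, x)) \<in> weierstrass_corr" using weierstrass_corr_iff[OF H] r(2) by blast
  then show ?thesis by (rule that)
qed

lemma weierstrass_MSurf:
  assumes "(D, g\<^sub>1, g\<^sub>2) \<in> HH" "((D, g\<^sub>1, g\<^sub>2), (E, x)) \<in> weierstrass_corr"
  shows "(E, x) \<in> MSurf"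
  using assms(2) wrep_MSurf unfolding weierstrass_corr_iff[OF assms(1)] nbhd0_def by blast

text \<open>The Moebius maps multiply the columns (g1, 1) and the rows (g2, 1) by the matrices V1
  and V2 and divide by the denominators n1 and n2. The new factor \<open>d\<close> compensates n1 n2
  up to a sign, so the matrix M of \<Phi> becomes V1 M V2^T up to sign.\<close>

lemma weierstrass_compat:
  assumes e: "((D, g\<^sub>1, g\<^sub>2), (D', h\<^sub>1, h\<^sub>2)) \<in> HH_equiv"
    and x: "((D, g\<^sub>1, g\<^sub>2), (E, x)) \<in> weierstrass_corr" and y: "((D', h\<^sub>1, h\<^sub>2), (E', y)) \<in> weierstrass_corr"
  shows "((E, x), (E', y)) \<in> MSurf_equiv"
proof -
  obtain U a\<^sub>1 b\<^sub>1 a\<^sub>2 b\<^sub>2 where H: "(D, g\<^sub>1, g\<^sub>2) \<in> HH" "(D', h\<^sub>1, h\<^sub>2) \<in> HH" and U: "nbhd0 U" "U \<subseteq> D \<inter> D'"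
    and s: "(cmod a\<^sub>1)\<^sup>2 - (cmod b\<^sub>1)\<^sup>2 = 1 \<and> (cmod a\<^sub>2)\<^sup>2 - (cmod b\<^sub>2)\<^sup>2 = 1 \<or>
      (cmod a\<^sub>1)\<^sup>2 - (cmod b\<^sub>1)\<^sup>2 = -1 \<and> (cmod a\<^sub>2)\<^sup>2 - (cmod b\<^sub>2)\<^sup>2 = -1"
    and m: "moebius_related U a\<^sub>1 b\<^sub>1 g\<^sub>1 h\<^sub>1" "moebius_related U a\<^sub>2 b\<^sub>2 g\<^sub>2 h\<^sub>2"
    by (rule HH_equivE[OF e])
  obtain t :: real where t: "(cmod a\<^sub>1)\<^sup>2 - (cmod b\<^sub>1)\<^sup>2 = t" "(cmod a\<^sub>2)\<^sup>2 - (cmod b\<^sub>2)\<^sup>2 = t" "t\<^sup>2 = 1"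
    using s that[of 1] that[of "-1"] by (elim disjE conjE) simp_all
  obtain c where E: "nbhd0 E" and w: "wrep 1 E g\<^sub>1 g\<^sub>2 c x" using x unfolding weierstrass_corr_iff[OF H(1)] by blast
  obtain d where E': "nbhd0 E'" and w': "wrep 1 E' h\<^sub>1 h\<^sub>2 d y" using y unfolding weierstrass_corr_iff[OF H(2)] by blast
  have "nbhd0 (U \<inter> (E \<inter> E'))" by (intro nbhd0_inter U E E')
  then obtain r where r: "r > 0" "ball 0 r \<subseteq> U \<inter> (E \<inter> E')" unfolding nbhd0_def open_contains_ball by blast
  let ?B = "ball (0::complex) r"
  have B: "z \<in> U" "z \<in> E" "z \<in> E'" if "z \<in> ?B" for z using r that by auto
  have hol: "g\<^sub>1 holomorphic_on ?B" "g\<^sub>2 holomorphic_on ?B" "c holomorphic_on ?B" "d holomorphic_on ?B"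
    using w w' B unfolding wrep_def by (meson holomorphic_on_subset subsetI)+
  have mB: "moebius_related ?B a\<^sub>1 b\<^sub>1 g\<^sub>1 h\<^sub>1" "moebius_related ?B a\<^sub>2 b\<^sub>2 g\<^sub>2 h\<^sub>2"
    using m moebius_mono r(2) by blast+
  define n\<^sub>1 where "n\<^sub>1 = (\<lambda>z. b\<^sub>1 * g\<^sub>1 z + cnj a\<^sub>1)"
  define n\<^sub>2 where "n\<^sub>2 = (\<lambda>z. b\<^sub>2 * g\<^sub>2 z + cnj a\<^sub>2)"
  have n: "n\<^sub>1 z \<noteq> 0" "n\<^sub>2 z \<noteq> 0" "h\<^sub>1 z * n\<^sub>1 z = a\<^sub>1 * g\<^sub>1 z + cnj b\<^sub>1" "h\<^sub>2 z * n\<^sub>2 z = a\<^sub>2 * g\<^sub>2 z + cnj b\<^sub>2" if "z \<in> ?B" for z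
    using mB that by (simp_all add: moebius_related_def n\<^sub>1_def n\<^sub>2_def)
  \<comment> \<open>Quotient of two square roots of one function: \<open>d\<close> and c n1 n2 both
    square to 1/(h1' h2'). So q takes only the values 1 and -1, and by continuity just one of
    them.\<close>
  define q where "q = (\<lambda>z. d z / (c z * (n\<^sub>1 z * n\<^sub>2 z)))"
  have c0: "c z \<noteq> 0" if "z \<in> ?B" for z using wrep_nonzero(1)[OF w B(2)[OF that]] .
  have q2: "(q z)\<^sup>2 = 1" if z: "z \<in> ?B" for z
  proof -
    have cc: "(c z)\<^sup>2 * (deriv g\<^sub>1 z * deriv g\<^sub>2 z) = 1" using w B(2)[OF z] by (simp add: wrep_def)
    have dd: "(d z)\<^sup>2 * (deriv h\<^sub>1 z * deriv h\<^sub>2 z) = 1" using w' B(3)[OF z] by (simp add: wrep_def)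
    have tt: "complex_of_real t * of_real t = 1" using t(3) by (metis of_real_1 of_real_mult power2_eq_square)
    have "deriv h\<^sub>1 z * deriv h\<^sub>2 z = (of_real t * of_real t) * (deriv g\<^sub>1 z * deriv g\<^sub>2 z) / (n\<^sub>1 z * n\<^sub>2 z)\<^sup>2"
      using moebius_deriv[OF mB(1) open_ball hol(1) t(1) z] moebius_deriv[OF mB(2) open_ball hol(2) t(2) z]
      by (simp add: n\<^sub>1_def n\<^sub>2_def power_mult_distrib)
    then have h: "deriv h\<^sub>1 z * deriv h\<^sub>2 z = (deriv g\<^sub>1 z * deriv g\<^sub>2 z) / (n\<^sub>1 z * n\<^sub>2 z)\<^sup>2" unfolding tt by simp
    define G where "G = deriv g\<^sub>1 z * deriv g\<^sub>2 z"
    define N where "N = n\<^sub>1 z * n\<^sub>2 z"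
    have N: "N \<noteq> 0" using n(1,2)[OF z] by (simp add: N_def)
    have G: "(c z)\<^sup>2 * G = 1" "(d z)\<^sup>2 * (G / N\<^sup>2) = 1" using cc dd unfolding h by (simp_all add: G_def N_def)
    have "(d z)\<^sup>2 * G = N\<^sup>2" using G(2) N by (simp add: field_simps)
    then have "(d z)\<^sup>2 = (c z)\<^sup>2 * N\<^sup>2" using G(1) by algebra
    then show ?thesis using c0[OF z] N by (simp add: q_def N_def[symmetric] power_divide power_mult_distrib)
  qed
  have hq: "q holomorphic_on ?B"
    unfolding q_def n\<^sub>1_def n\<^sub>2_def using c0 n(1,2) by (intro holomorphic_intros hol) (simp add: n\<^sub>1_def n\<^sub>2_def)
  have q1: "q z = 1 \<or> q z = -1" if "z \<in> ?B" for z using q2[OF that] by (simp add: power2_eq_1_iff)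
  have ne: "Re (q z) \<noteq> 0" if "z \<in> ?B" for z using q1[OF that] by auto
  have cont: "continuous_on ?B (\<lambda>z. Re (q z))"
    by (intro continuous_intros holomorphic_on_imp_continuous_on hq)
  obtain \<sigma> :: real where \<sigma>: "\<sigma>\<^sup>2 = 1" "\<And>z. z \<in> ?B \<Longrightarrow> \<sigma> * Re (q z) > 0"
    using constant_sign[OF connected_ball cont ne] by blast
  have \<sigma>1: "\<sigma> = 1 \<or> \<sigma> = -1" using \<sigma>(1) by (simp add: power2_eq_1_iff)
  have dq: "d z = of_real \<sigma> * (c z * (n\<^sub>1 z * n\<^sub>2 z))" if z: "z \<in> ?B" for z
  proof -
    have "q z = of_real \<sigma>" using \<sigma>1 \<sigma>(2)[OF z] q1[OF z] by auto
    then show ?thesis using c0[OF z] n(1,2)[OF z] by (simp add: q_def field_simps)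
  qed
  \<comment> \<open>The sign \<sigma> between the branches is absorbed by passing from V1 to
    \<sigma> V1, which has the same determinant.\<close>
  define A where "A = Lmat (of_real \<sigma> * a\<^sub>1) (of_real \<sigma> * b\<^sub>1) ** Rmat a\<^sub>2 b\<^sub>2"
  have AS: "A \<in> SO22"
    unfolding A_def by (rule LRmat_SO22[OF _ t(2,3)]) (use t(1) \<sigma>1 in \<open>auto simp: norm_mult\<close>)
  have "Phi y z = cmul A (Phi x z)" if z: "z \<in> ?B" for z
  proof -
    have px: "Phi x z = mvec 1 (c z * (g\<^sub>1 z * g\<^sub>2 z)) (c z * g\<^sub>1 z) (c z * g\<^sub>2 z) (c z)" using w B(2)[OF z] by (simp add: wrep_def)
    have py: "Phi y z = mvec 1 (d z * (h\<^sub>1 z * h\<^sub>2 z)) (d z * h\<^sub>1 z) (d z * h\<^sub>2 z) (d z)" using w' B(3)[OF z] by (simp add: wrep_def)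
    have d: "d z * (h\<^sub>1 z * h\<^sub>2 z) = of_real \<sigma> * c z * (a\<^sub>1 * g\<^sub>1 z + cnj b\<^sub>1) * (a\<^sub>2 * g\<^sub>2 z + cnj b\<^sub>2)"
      "d z * h\<^sub>1 z = of_real \<sigma> * c z * (a\<^sub>1 * g\<^sub>1 z + cnj b\<^sub>1) * (b\<^sub>2 * g\<^sub>2 z + cnj a\<^sub>2)"
      "d z * h\<^sub>2 z = of_real \<sigma> * c z * (b\<^sub>1 * g\<^sub>1 z + cnj a\<^sub>1) * (a\<^sub>2 * g\<^sub>2 z + cnj b\<^sub>2)"
      "d z = of_real \<sigma> * c z * (b\<^sub>1 * g\<^sub>1 z + cnj a\<^sub>1) * (b\<^sub>2 * g\<^sub>2 z + cnj a\<^sub>2)"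
      unfolding dq[OF z] n(3,4)[OF z, symmetric] by (simp_all add: n\<^sub>1_def n\<^sub>2_def)
    show ?thesis
      unfolding A_def cmul_mult px cmul_Rmat cmul_Lmat py d(1) d(2) d(3) unfolding d(4)
      by (rule arg_cong4[where f = "mvec 1"]) (simp_all add: algebra_simps)
  qed
  moreover have "x differentiable (at z)" "y differentiable (at z)" if "z \<in> ?B" for z
    using w w' B[OF that] by (auto simp: wrep_def)
  ultimately obtain b where "\<And>z. z \<in> ?B \<Longrightarrow> y z = A *v x z + b" using affine_of_Phi[of 0 r x y A] by blast
  then show ?thesis
    using weierstrass_MSurf[OF H(1) x] weierstrass_MSurf[OF H(2) y] AS r
    by (intro MSurf_equivI[where U = ?B and A = A and b = b]) (auto simp: nbhd0_def)
qed

lemma weierstrass_surj: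
  assumes M: "(D, x) \<in> MSurf"
  obtains U g\<^sub>1 g\<^sub>2 y where "(U, g\<^sub>1, g\<^sub>2) \<in> HH" "((U, g\<^sub>1, g\<^sub>2), (U, y)) \<in> weierstrass_corr" "((U, y), (D, x)) \<in> MSurf_equiv"
proof -
  obtain \<epsilon> U g\<^sub>1 g\<^sub>2 c where U: "0 \<in> U" "U \<subseteq> D" and \<epsilon>: "\<epsilon> = 1 \<or> \<epsilon> = -1" and w: "wrep \<epsilon> U g\<^sub>1 g\<^sub>2 c x"
    by (rule MSurf_local_representation[OF M MSurf_D(2)[OF M]])
  have o: "open U" "nbhd0 U" using w U by (auto simp: wrep_def nbhd0_def)
  have H: "(U, g\<^sub>1, g\<^sub>2) \<in> HH" by (rule wrep_HH[OF w U(1)])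
  \<comment> \<open>For \<epsilon> = -1 this reverses one positive and one negative direction, so it
    has determinant 1. It is an involution and exchanges the two charts of
    \<open>wrep\<close>.\<close>
  define R where "R = (vector [vector [1, 0, 0, 0], vector [0, \<epsilon>, 0, 0], vector [0, 0, 1, 0], vector [0, 0, 0, \<epsilon>]] :: real^4^4)"
  have ec: "complex_of_real \<epsilon> * (of_real \<epsilon> * v) = v" for v using \<epsilon> by auto
  have R: "R \<in> SO22"
    using \<epsilon> by (auto simp: SO22_def R_def sp_def matrix_vector_mult_def sum_4 det_4)
  have RR: "R *v (R *v v) = v" for v
    using \<epsilon> by (auto simp: R_def matrix_vector_mult_def sum_4 vec_eq_iff forall_4)
  define y where "y = (\<lambda>z. R *v x z)"
  have dx: "x differentiable (at z)" if "z \<in> U" for z using w that by (simp add: wrep_def)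
  have "wrep 1 U g\<^sub>1 g\<^sub>2 c y"
    unfolding wrep_def
  proof (intro conjI ballI)
    fix z assume z: "z \<in> U"
    show "y differentiable (at z)"
      unfolding y_def by (rule differentiable_linear[OF matrix_vector_mul_bounded_linear dx[OF z]])
    have p: "pd i y z = R *v pd i x z" for i
      unfolding y_def by (rule pd_linear[OF matrix_vector_mul_bounded_linear dx[OF z]])
    have "Phi y z $ 1 = Phi x z $ 1" "Phi y z $ 2 = of_real \<epsilon> * Phi x z $ 2" "Phi y z $ 3 = Phi x z $ 3" "Phi y z $ 4 = of_real \<epsilon> * Phi x z $ 4"
      by (simp_all add: Phi_nth p R_def matrix_vector_mult_def sum_4 algebra_simps)
    moreover have "Phi x z = mvec \<epsilon> (c z * (g\<^sub>1 z * g\<^sub>2 z)) (c z * g\<^sub>1 z) (c z * g\<^sub>2 z) (c z)" using w z by (simp add: wrep_def)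
    ultimately show "Phi y z = mvec 1 (c z * (g\<^sub>1 z * g\<^sub>2 z)) (c z * g\<^sub>1 z) (c z * g\<^sub>2 z) (c z)"
      by (simp add: vec_eq_iff forall_4 mvec_def ec)
  qed (use w in \<open>auto simp: wrep_def\<close>)
  then have "((U, g\<^sub>1, g\<^sub>2), (U, y)) \<in> weierstrass_corr" using weierstrass_corr_iff[OF H] o(2) by blast
  moreover have "((U, y), (D, x)) \<in> MSurf_equiv"
    by (rule MSurf_equivI[OF weierstrass_MSurf[OF H calculation] M o(2) _ R, of 0]) (use U RR in \<open>auto simp: y_def\<close>)
  ultimately show ?thesis using that H by blast
qed

text \<open>The formula lives on D and the surface on a possibly smaller E; the two solutions
  coincide on E, which suffices for equivalence.\<close>

lemma triangle_commutes:
  assumes H: "(D, g\<^sub>1, g\<^sub>2) \<in> HH" and C: "((D, g\<^sub>1, g\<^sub>2), (E, x)) \<in> weierstrass_corr"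
  shows "((D, K_of g\<^sub>1 g\<^sub>2, kappa_of g\<^sub>1 g\<^sub>2), (E, gauss_curvature (induced_metric x), normal_curvature x)) \<in> SNE_equiv"
proof -
  obtain c where E: "nbhd0 E" "E \<subseteq> D" and w: "wrep 1 E g\<^sub>1 g\<^sub>2 c x" using C unfolding weierstrass_corr_iff[OF H] by blast
  show ?thesis
    by (rule SNE_equivI[OF formula_SNE[OF H] curvature_SNE[OF weierstrass_MSurf[OF H C]] E(1)])
       (use E(2) wrep_gauss[OF w] wrep_normal_curvature(1)[OF w] in auto)
qed

lemma curvature_corr_iff:
  "(a, b) \<in> curvature_corr \<longleftrightarrow> (\<exists>D x. a = (D, x) \<and> b = (D, gauss_curvature (induced_metric x), normal_curvature x))"
  by (auto simp: curvature_corr_def)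

theorem theorem11p6:
  shows "equiv MSurf MSurf_equiv \<and> equiv SNE SNE_equiv \<and> equiv HH HH_equiv \<and>
    (\<exists>\<Phi>\<^sub>i \<Phi>\<^sub>i\<^sub>i \<Phi>\<^sub>i\<^sub>i\<^sub>i.
       induces curvature_corr MSurf MSurf_equiv SNE SNE_equiv \<Phi>\<^sub>i \<and>
       induces weierstrass_corr HH HH_equiv MSurf MSurf_equiv \<Phi>\<^sub>i\<^sub>i \<and>
       induces formula_corr HH HH_equiv SNE SNE_equiv \<Phi>\<^sub>i\<^sub>i\<^sub>i \<and>
       (\<forall>c \<in> HH // HH_equiv. \<Phi>\<^sub>i\<^sub>i\<^sub>i c = \<Phi>\<^sub>i (\<Phi>\<^sub>i\<^sub>i c)) \<and>
       bij_betw \<Phi>\<^sub>i (MSurf // MSurf_equiv) (SNE // SNE_equiv) \<and>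
       bij_betw \<Phi>\<^sub>i\<^sub>i (HH // HH_equiv) (MSurf // MSurf_equiv) \<and>
       bij_betw \<Phi>\<^sub>i\<^sub>i\<^sub>i (HH // HH_equiv) (SNE // SNE_equiv))"
proof -
  have trans: "(a, c) \<in> SNE_equiv" if "(a, b) \<in> SNE_equiv" "(b, c) \<in> SNE_equiv" for a b c
    using equiv_SNE that by (meson equivE transE)
  have sym: "(b, a) \<in> SNE_equiv" if "(a, b) \<in> SNE_equiv" for a b
    using equiv_SNE that by (meson equivE symE)
  obtain F3 where F3: "induces formula_corr HH HH_equiv SNE SNE_equiv F3" "bij_betw F3 (HH // HH_equiv) (SNE // SNE_equiv)"
    using formula_induces_bij by blast
  obtain F1 where F1: "induces curvature_corr MSurf MSurf_equiv SNE SNE_equiv F1"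
  proof (rule induces_exists[OF equiv_MSurf equiv_SNE])
    show "\<exists>b. (a, b) \<in> curvature_corr" for a by (cases a) (auto simp: curvature_corr_iff)
    show "b \<in> SNE" if "a \<in> MSurf" "(a, b) \<in> curvature_corr" for a b
      using that curvature_SNE by (auto simp: curvature_corr_iff)
    show "(b, b') \<in> SNE_equiv" if "(a, a') \<in> MSurf_equiv" "(a, b) \<in> curvature_corr" "(a', b') \<in> curvature_corr" for a a' b b'
      using that curvature_compat by (auto simp: curvature_corr_iff)
  qed blast
  obtain F2 where F2: "induces weierstrass_corr HH HH_equiv MSurf MSurf_equiv F2"
  proof (rule induces_exists[OF equiv_HH equiv_MSurf])
    show "\<exists>b. (a, b) \<in> weierstrass_corr" if "a \<in> HH" for a
      using that by (cases a) (metis weierstrass_total)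
    show "b \<in> MSurf" if "a \<in> HH" "(a, b) \<in> weierstrass_corr" for a b
      using that by (cases a, cases b) (auto intro: weierstrass_MSurf)
    show "(b, b') \<in> MSurf_equiv" if "(a, a') \<in> HH_equiv" "(a, b) \<in> weierstrass_corr" "(a', b') \<in> weierstrass_corr" for a a' b b'
      using that by (cases a, cases a', cases b, cases b') (auto intro: weierstrass_compat)
  qed blast
  have bij2: "bij_betw F2 (HH // HH_equiv) (MSurf // MSurf_equiv)"
  proof (rule induces_bij[OF equiv_HH equiv_MSurf F2])
    show "(a, a') \<in> HH_equiv" if a: "a \<in> HH" "a' \<in> HH" "(a, b) \<in> weierstrass_corr" "(a', b') \<in> weierstrass_corr"
      "(b, b') \<in> MSurf_equiv" for a a' b b'
    proof -
      obtain D g\<^sub>1 g\<^sub>2 D' h\<^sub>1 h\<^sub>2 E x E' y where e: "a = (D, g\<^sub>1, g\<^sub>2)" "a' = (D', h\<^sub>1, h\<^sub>2)" "b = (E, x)" "b' = (E', y)"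
        by (metis prod_cases3 surj_pair)
      show ?thesis
        using formula_inj trans[OF trans[OF triangle_commutes[OF a(1,3)[unfolded e]] curvature_compat[OF a(5)[unfolded e]]]
            sym[OF triangle_commutes[OF a(2,4)[unfolded e]]]] a(1,2) unfolding e by blast
    qed
    show "\<exists>a b'. a \<in> HH \<and> (a, b') \<in> weierstrass_corr \<and> (b', b) \<in> MSurf_equiv" if b: "b \<in> MSurf" for b
    proof -
      obtain D x where e: "b = (D, x)" by (cases b)
      show ?thesis unfolding e by (rule weierstrass_surj[OF b[unfolded e]]) blast
    qed
  qed
  have comm: "F3 q = F1 (F2 q)" if q: "q \<in> HH // HH_equiv" for q
  proof -
    obtain a where a: "a \<in> HH" "q = HH_equiv `` {a}" using q by (meson quotientE)
    obtain D g\<^sub>1 g\<^sub>2 where e: "a = (D, g\<^sub>1, g\<^sub>2)" by (metis prod_cases3)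
    obtain E x where C: "((D, g\<^sub>1, g\<^sub>2), (E, x)) \<in> weierstrass_corr" using weierstrass_total[OF a(1)[unfolded e]] .
    let ?s = "(D, K_of g\<^sub>1 g\<^sub>2, kappa_of g\<^sub>1 g\<^sub>2)" and ?t = "(E, gauss_curvature (induced_metric x), normal_curvature x)"
    have "F3 q = SNE_equiv `` {?s}" using F3(1) a formula_corr_iff unfolding induces_def e by blast
    moreover have "F2 q = MSurf_equiv `` {(E, x)}" "(E, x) \<in> MSurf" using F2 a C unfolding induces_def e by blast+
    moreover have "F1 (MSurf_equiv `` {(E, x)}) = SNE_equiv `` {?t}"
      using F1 \<open>(E, x) \<in> MSurf\<close> curvature_corr_iff unfolding induces_def by blast
    moreover have "SNE_equiv `` {?s} = SNE_equiv `` {?t}"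
      by (rule equiv_class_eq[OF equiv_SNE triangle_commutes[OF a(1)[unfolded e] C]])
    ultimately show ?thesis by simp
  qed
  have "bij_betw (F1 \<circ> F2) (HH // HH_equiv) (SNE // SNE_equiv)"
    using F3(2) comm bij_betw_cong[of "HH // HH_equiv" F3 "F1 \<circ> F2"] by simp
  then have bij1: "bij_betw F1 (MSurf // MSurf_equiv) (SNE // SNE_equiv)"
    using bij_betw_comp_iff[OF bij2] by blast
  show ?thesis
    using equiv_MSurf equiv_SNE equiv_HH F1 F2 F3 comm bij1 bij2 by blast
qed

end
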